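(* Suppose that $C_\infty^{(q)}\neq 0$ for some $q$ satisfying $\mathcal{O}<q\le P$ (i.e., $A\tilde\theta(q)$ and $\tilde\theta_q(q)$ are asymptotically correlated), and let $q^\ast$ denote the largest such $q$. Then the following holds for every $\theta\in M_{q^\ast-1}$, every $\sigma$ with $0<\sigma<\infty$, and every $t\in\mathbb{R}^k$: There exist $\delta_0>0$ and $\rho_0$, $0<\rho_0<\infty$, such that any estimator $\hat G_n(t)$ of $G_{n,\theta,\sigma}(t)$ satisfying $$P_{n,\theta,\sigma}\left(\left|\hat G_n(t)-G_{n,\theta,\sigma}(t)\right|>\delta\right)\xrightarrow{n\to\infty}0\quad\text{for each }\delta>0$$ (in particular, every estimator that is consistent) also satisfies $$\sup_{\vartheta\in M_{q^\ast},\ \|\vartheta-\theta\|<\rho_0/\sqrt n}P_{n,\vartheta,\sigma}\left(\left|\hat G_n(t)-G_{n,\vartheta,\sigma}(t)\right|>\delta_0\right)\xrightarrow{n\to\infty}1 .$$ The constants $\delta_0$ and $\rho_0$ may be chosen in such a way that they depend only on $t$, $Q$, $A$, $\sigma$, and the critical values $c_p$ for $\mathcal{O}<p\le P$. Moreover, $$\liminf_{n\to\infty}\ \inf_{\hat G_n(t)}\ \sup_{\vartheta\in M_{q^\ast},\ \|\vartheta-\theta\|<\rho_0/\sqrt n}P_{n,\vartheta,\sigma}\left(\left|\hat G_n(t)-G_{n,\vartheta,\sigma}(t)\right|>\delta_0\right)>0$$ and $$\sup_{\delta>0}\ \liminf_{n\to\infty}\ \inf_{\hat G_n(t)}\ \sup_{\vartheta\in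 M_{q^\ast},\ \|\vartheta-\theta\|<\rho_0/\sqrt n}P_{n,\vartheta,\sigma}\left(\left|\hat G_n(t)-G_{n,\vartheta,\sigma}(t)\right|>\delta\right)\ge\frac12,$$ where the infima extend over all estimators $\hat G_n(t)$ of $G_{n,\theta,\sigma}(t)$.
   Context: Model. Fix integers $P\ge1$ and $0\le\mathcal{O}<P$. For each sample size $n>P$ one observes $Y=X\theta+u$, where $X$ is a non-stochastic $n\times P$ matrix of rank $P$ (its elements may depend on $n$), $\theta\in\mathbb{R}^P$, and $u\sim N(0,\sigma^2I_n)$ with $0<\sigma<\infty$. $P_{n,\theta,\sigma}$ is the distribution of the sample $Y$ of size $n$. It is assumed that $Q=\lim_{n\to\infty}X'X/n$ exists and is non-singular. $\|\cdot\|$ is the Euclidean norm. Notation. For a matrix $D$ with $P$ columns, $D[p]$ is the matrix of its first $p$ columns; $Q[p:p]$ is the upper-left $p\times p$ block of $Q$. For $0\le p\le P$, $M_p=\{\theta\in\mathbb{R}^P:\theta_{p+1}=\dots=\theta_P=0\}$. $\tilde\theta(p)\in\mathbb{R}^P$ is the restricted least-squares estimator under $\theta_{p+1}=\dots=\theta_P=0$: its first $p$ components are $(X[p]'X[p])^{-1}X[p]'Y$ and the others are $0$ (so $\tilde\theta(0)=0$); $\tilde\theta_p(p)$ is its $p$-th component. Model selection. $\hat\sigma^2=(n-P)^{-1}\|Y-X\tilde\theta(P)\|^2$, $\hat\sigma\ge 0$; for $0<p\le P$, $\xi_{n,p}=\left([(X[p]'X[p]/n)^{-1}]_{p,p}\right)^{1/2}$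 and $T_p=\sqrt n\,\tilde\theta_p(p)/(\hat\sigma\xi_{n,p})$; $T_0=0$. Critical values: $c_{\mathcal{O}}=0$ and $0<c_p<\infty$ for $\mathcal{O}<p\le P$, independent of $n$. The selected order is $\hat p=\max\{p:\mathcal{O}\le p\le P,\ |T_p|\ge c_p\}$, and the post-model-selection estimator is $\tilde\theta=\sum_{p=\mathcal{O}}^P\tilde\theta(p)\mathbf{1}(\hat p=p)$. Target. $A$ is a non-stochastic $k\times P$ matrix of rank $k$, $1\le k\le P$, and $G_{n,\theta,\sigma}(t)=P_{n,\theta,\sigma}\left(\sqrt n A(\tilde\theta-\theta)\le t\right)$ for $t\in\mathbb{R}^k$ (componentwise inequality). For $1\le p\le P$, $C_\infty^{(p)}=A[p]\,Q[p:p]^{-1}e_p\in\mathbb{R}^k$, where $e_p$ is the $p$-th standard basis vector of $\mathbb{R}^p$. Estimators. For fixed $t$, an estimator $\hat G_n(t)$ of $G_{n,\theta,\sigma}(t)$ is any real-valued (measurable) function of $(Y,X)$, for each $n$; it is not required to be the value at $t$ of an estimated cdf nor to lie in $[0,1]$. *)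

theory Defs
  imports
    "HOL-Probability.Probability"
    "Jordan_Normal_Form.Gauss_Jordan_Elimination"
    "Jordan_Normal_Form.DL_Rank"
begin

unbundle no vec_syntax
unbundle no inner_syntax

text \<open>
  Since the sample size varies, matrices and vectors are those of Jordan_Normal_Form, whose indices
  start at 0: the 1-based component \<open>p\<close> of the mathematics is the entry with index \<open>p - 1\<close>.
\<close>

definition vnorm :: "real vec \<Rightarrow> real" where
  "vnorm v = sqrt (v \<bullet> v)"

text \<open>Only meaningful for invertible matrices.\<close>
definition minv :: "real mat \<Rightarrow> real mat" where
  "minv B = the (mat_inverse B)"

definition first_cols :: "real mat \<Rightarrow> nat \<Rightarrow> real mat" where
  "first_cols D p = mat (dim_row D) p (\<lambda>(i, j). D $$ (i, j))"

definition upper_left :: "real mat \<Rightarrow> nat \<Rightarrow> real mat" where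
  "upper_left D p = mat p p (\<lambda>(i, j). D $$ (i, j))"

text \<open>The set \<open>M\<^sub>p\<close> of parameters in dimension \<open>P\<close>.\<close>
definition submodel :: "nat \<Rightarrow> nat \<Rightarrow> real vec set" where
  "submodel P p = {\<theta> \<in> carrier_vec P. \<forall>i. p \<le> i \<and> i < P \<longrightarrow> \<theta> $ i = 0}"

text \<open>
  An admissible sequence of regressor matrices; \<open>X n\<close> is constrained only for sample sizes \<open>n > P\<close>.
\<close>
definition regressors :: "nat \<Rightarrow> real mat \<Rightarrow> (nat \<Rightarrow> real mat) \<Rightarrow> bool" where
  "regressors P Q X \<longleftrightarrow>
     (\<forall>n>P. X n \<in> carrier_mat n P \<and> vec_space.rank n (X n) = P) \<and>
     (\<forall>i<P. \<forall>j<P. (\<lambda>n. (transpose_mat (X n) * X n) $$ (i, j) / real n) \<longlonglongrightarrow> Q $$ (i, j))"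

text \<open>
  In the following definitions \<open>X\<close> is a single \<open>n \<times> P\<close> regressor matrix, so that
  \<open>n = dim_row X\<close> and \<open>P = dim_col X\<close>. A sample is a function in the space of
  \<open>sample_space n\<close>; as a vector it is \<open>vec n Y\<close>.
\<close>

definition sample_space :: "nat \<Rightarrow> (nat \<Rightarrow> real) measure" where
  "sample_space n = PiM {..<n} (\<lambda>_. borel)"

text \<open>
  The law of \<open>Y = X \<theta> + u\<close> with \<open>u \<sim> N(0, \<sigma>\<^sup>2 I\<^sub>n)\<close>: the components are independent, and the
  \<open>i\<close>-th one has mean \<open>(X \<theta>)\<^sub>i\<close> and standard deviation \<open>\<sigma>\<close>.
\<close>
definition sample_law :: "real mat \<Rightarrow> real vec \<Rightarrow> real \<Rightarrow> (nat \<Rightarrow> real) measure" where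
  "sample_law X \<theta> \<sigma> =
     PiM {..<dim_row X} (\<lambda>i. density lborel (normal_density ((X *\<^sub>v \<theta>) $ i) \<sigma>))"

definition restricted_ls :: "real mat \<Rightarrow> nat \<Rightarrow> real vec \<Rightarrow> real vec" where
  "restricted_ls X p y =
     (let Xp = first_cols X p;
          b = minv (transpose_mat Xp * Xp) *\<^sub>v (transpose_mat Xp *\<^sub>v y)
      in vec (dim_col X) (\<lambda>i. if i < p then b $ i else 0))"

definition sigma_hat :: "real mat \<Rightarrow> real vec \<Rightarrow> real" where
  "sigma_hat X y =
     sqrt ((vnorm (y - X *\<^sub>v restricted_ls X (dim_col X) y))\<^sup>2 / (real (dim_row X) - real (dim_col X)))"

definition xi :: "real mat \<Rightarrow> nat \<Rightarrow> real" where
  "xi X p =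
     (let Xp = first_cols X p
      in sqrt (minv ((1 / real (dim_row X)) \<cdot>\<^sub>m (transpose_mat Xp * Xp)) $$ (p - 1, p - 1)))"

text \<open>On the null event \<open>sigma_hat X y = 0\<close> the statistic is 0 by the convention \<open>x / 0 = 0\<close>.\<close>
definition test_stat :: "real mat \<Rightarrow> nat \<Rightarrow> real vec \<Rightarrow> real" where
  "test_stat X p y =
     (if p = 0 then 0
      else sqrt (real (dim_row X)) * restricted_ls X p y $ (p - 1) / (sigma_hat X y * xi X p))"

text \<open>\<open>ord\<close> is the minimal order; the maximum exists because \<open>c ord = 0\<close>.\<close>
definition selected_order :: "real mat \<Rightarrow> nat \<Rightarrow> (nat \<Rightarrow> real) \<Rightarrow> real vec \<Rightarrow> nat" where
  "selected_order X ord c y = Max {p. ord \<le> p \<and> p \<le> dim_col X \<and> c p \<le> \<bar>test_stat X p y\<bar>}"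

definition post_selection :: "real mat \<Rightarrow> nat \<Rightarrow> (nat \<Rightarrow> real) \<Rightarrow> real vec \<Rightarrow> real vec" where
  "post_selection X ord c y =
     vec (dim_col X) (\<lambda>i. \<Sum>p = ord..dim_col X.
       restricted_ls X p y $ i * of_bool (selected_order X ord c y = p))"

text \<open>
  The finite-sample cdf \<open>G\<close>; the order on vectors is componentwise.
\<close>
definition post_cdf ::
  "real mat \<Rightarrow> real mat \<Rightarrow> nat \<Rightarrow> (nat \<Rightarrow> real) \<Rightarrow> real vec \<Rightarrow> real \<Rightarrow> real vec \<Rightarrow> real" where
  "post_cdf X A ord c \<theta> \<sigma> t =
     measure (sample_law X \<theta> \<sigma>)
       {Y \<in> space (sample_law X \<theta> \<sigma>).
          sqrt (real (dim_row X)) \<cdot>\<^sub>v (A *\<^sub>v (post_selection X ord c (vec (dim_row X) Y) - \<theta>)) \<le> t}"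

definition C_inf :: "real mat \<Rightarrow> real mat \<Rightarrow> nat \<Rightarrow> real vec" where
  "C_inf A Q p = first_cols A p *\<^sub>v (minv (upper_left Q p) *\<^sub>v unit_vec p (p - 1))"

text \<open>
  An estimator for sample size \<open>n\<close> is a measurable real function of the sample; its dependence on
  the non-stochastic \<open>X\<close> is implicit, as it is always chosen after \<open>X\<close>.
\<close>
definition estimators :: "nat \<Rightarrow> ((nat \<Rightarrow> real) \<Rightarrow> real) set" where
  "estimators n = borel_measurable (sample_space n)"

definition miss_prob ::
  "real mat \<Rightarrow> real mat \<Rightarrow> nat \<Rightarrow> (nat \<Rightarrow> real) \<Rightarrow> real vec \<Rightarrow> real \<Rightarrow> real vec
    \<Rightarrow> ((nat \<Rightarrow> real) \<Rightarrow> real) \<Rightarrow> real \<Rightarrow> real" where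
  "miss_prob X A ord c \<theta> \<sigma> t g \<delta> =
     measure (sample_law X \<theta> \<sigma>)
       {Y \<in> space (sample_law X \<theta> \<sigma>). \<bar>g Y - post_cdf X A ord c \<theta> \<sigma> t\<bar> > \<delta>}"

text \<open>
  The worst case over \<open>\<eta>\<close> in \<open>M\<^sub>q\<close> within distance \<open>r\<close> of \<open>\<theta>\<close>, in the extended reals so that
  suprema, infima and limits inferior are taken in a complete lattice.
\<close>
definition worst_miss_prob ::
  "real mat \<Rightarrow> real mat \<Rightarrow> nat \<Rightarrow> (nat \<Rightarrow> real) \<Rightarrow> nat \<Rightarrow> real vec \<Rightarrow> real \<Rightarrow> real \<Rightarrow> real vec
    \<Rightarrow> ((nat \<Rightarrow> real) \<Rightarrow> real) \<Rightarrow> real \<Rightarrow> ereal" where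
  "worst_miss_prob X A ord c q \<theta> r \<sigma> t g \<delta> =
     (SUP \<eta> \<in> {\<eta> \<in> submodel (dim_col X) q. vnorm (\<eta> - \<theta>) < r}.
        ereal (miss_prob X A ord c \<eta> \<sigma> t g \<delta>))"

end

theory Submission
  imports Defs "HOL-Real_Asymp.Real_Asymp"
begin

text \<open>
  The Gram-Schmidt vectors of the columns of \<open>X\<close> turn the model into independent Gaussian
  coordinates: the order \<open>p\<close> is tested with the \<open>p\<close>-th coordinate alone, the scaled error of the
  restricted estimator of order \<open>p\<close> is linear in the first \<open>p\<close> coordinates, and \<open>C_inf A Q p\<close>
  is, up to a positive factor, the limit of the coefficient of the \<open>p\<close>-th one. Under local
  alternatives whose coordinate \<open>q\<^sup>* = qs\<close> is \<open>x\<close>, and whose preceding coordinate is so large that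
  practically no order below \<open>q\<^sup>* - 1\<close> is selected, the cdf therefore converges to a function of \<open>x\<close>.
  As \<open>x \<rightarrow> \<infinity>\<close> this function tends to a constant \<open>\<Phi>\<close>, and it differs from \<open>\<Phi>\<close> at \<open>x\<close> by a
  positive multiple of \<open>\<integral> 1(\<bar>x - z\<bar> < r) (f x - f z) dN(z)\<close> with a bounded non-constant \<open>f\<close>.
  Integrated against \<open>f dN\<close> this expression gives a Dirichlet form, which is positive, so that the
  limit is not constant. Hence the cdf varies by a fixed amount over a local neighbourhood on which
  the laws of the sample remain mutually contiguous. A consistent estimator follows the cdf at
  \<open>\<theta>\<close> and so misses it elsewhere; for the bound \<open>1/2\<close> the local segment is cut into pieces so short
  that the laws at the ends of each piece almost coincide.
\<close>

subsection \<open>Gaussian laws and characteristic functions\<close>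

text \<open>The constants must not depend on \<open>\<theta>\<close> or on the regressors, although
  \<open>\<theta>\<close> is an arbitrary point of the smaller model. This is why the coordinate
  before the last one is pushed away from 0: with the lower orders suppressed, one limit function
  serves every \<open>\<theta>\<close>, and only its values at two points \<open>s\<close> and
  \<open>s'\<close> are used. Convergence is obtained by comparing the finite sample event and the
  limit event on one probability space: they agree unless the noise is near a boundary of the limit
  event or the variance estimate is off. The boundaries are null except at finitely many
  \<open>x\<close>, which \<open>s\<close> and \<open>s'\<close> avoid. Closeness of sample laws is
  measured by chi-square integrals, which are explicit for normal densities and depend only on the
  distance of the means. The positive lower limit is a by-product of the bound \<open>1/2\<close>:
  cutting the segment finely enough to reach \<open>1/4\<close> yields
  \<open>\<delta>\<^sub>0\<close>, and the claim on consistent estimators holds for this same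
  smaller constant.\<close>

abbreviation gauss :: "real \<Rightarrow> real \<Rightarrow> real measure" where
  "gauss \<mu> \<sigma> \<equiv> density lborel (\<lambda>x. ennreal (normal_density \<mu> \<sigma> x))"

lemma real_distribution_gauss: "0 < \<sigma> \<Longrightarrow> real_distribution (gauss \<mu> \<sigma>)"
  by (simp add: real_distribution_def real_distribution_axioms_def prob_space_normal_density)

lemma distr_gauss_affine:
  assumes \<sigma>: "0 < \<sigma>" and a: "a \<noteq> 0"
  shows "distr (gauss \<mu> \<sigma>) borel (\<lambda>x. b + a * x) = gauss (b + a * \<mu>) (\<bar>a\<bar> * \<sigma>)"
proof -
  interpret prob_space "gauss \<mu> \<sigma>" using \<sigma> by (rule prob_space_normal_density)
  have "distributed (gauss \<mu> \<sigma>) lborel (\<lambda>x. x) (\<lambda>x. ennreal (normal_density \<mu> \<sigma> x))"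
    by (auto simp: distributed_def distr_id2 intro!: measure_eqI)
  from normal_density_affine[OF this \<sigma> a, of b]
  have "distr (gauss \<mu> \<sigma>) lborel (\<lambda>x. b + a * x) = gauss (b + a * \<mu>) (\<bar>a\<bar> * \<sigma>)"
    by (simp add: distributed_def)
  moreover have "distr (gauss \<mu> \<sigma>) lborel (\<lambda>x. b + a * x) = distr (gauss \<mu> \<sigma>) borel (\<lambda>x. b + a * x)"
    by (rule distr_cong) auto
  ultimately show ?thesis by simp
qed

lemma char_gauss:
  assumes "0 < \<sigma>"
  shows "char (gauss 0 \<sigma>) \<tau> = complex_of_real (exp (- (\<sigma> * \<tau>)\<^sup>2 / 2))"
proof -
  have "char (gauss 0 \<sigma>) \<tau> = char std_normal_distribution (\<sigma> * \<tau>)"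
  proof -
    have "gauss 0 \<sigma> = distr (gauss 0 1) borel (\<lambda>x. \<sigma> * x)"
      using distr_gauss_affine[of 1 \<sigma> 0 0] assms by simp
    then show ?thesis
      unfolding char_def by (simp only:) (subst integral_distr, auto simp: mult_ac)
  qed
  then show ?thesis by (simp add: char_std_normal_distribution)
qed

text \<open>The weight \<open>2 + H\<close> is at least 1, so it can be normalised to a density. The
  factorisation \<open>char_HX\<close> says that \<open>X\<close> keeps its characteristic function
  under the tilted probability. Levy uniqueness gives the law of \<open>X\<close> there and under
  \<open>M\<close>, and comparing the two isolates the contribution of \<open>H\<close>.\<close>

lemma (in prob_space) expectation_indicator_char_real:
  fixes H X :: "'a \<Rightarrow> real"
  assumes [measurable]: "H \<in> borel_measurable M" "X \<in> borel_measurable M" "A \<in> sets borel"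
    and H1: "\<And>\<omega>. \<bar>H \<omega>\<bar> \<le> 1"
    and \<nu>: "real_distribution \<nu>"
    and char_X: "\<And>\<tau>. (CLINT \<omega>|M. iexp (\<tau> * X \<omega>)) = char \<nu> \<tau>"
    and char_HX: "\<And>\<tau>. (CLINT \<omega>|M. complex_of_real (H \<omega>) * iexp (\<tau> * X \<omega>)) =
                     complex_of_real (expectation H) * char \<nu> \<tau>"
  shows "expectation (\<lambda>\<omega>. H \<omega> * indicator A (X \<omega>)) = expectation H * measure \<nu> A"
proof -
  have intH: "integrable M H"
    by (rule integrable_const_bound[where B=1]) (auto simp: H1)
  have intI: "integrable M (\<lambda>\<omega>. indicator A (X \<omega>) :: real)"
    by (rule integrable_const_bound[where B=1]) (auto simp: indicator_def)
  have intHI: "integrable M (\<lambda>\<omega>. H \<omega> * indicator A (X \<omega>) :: real)"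
    by (rule integrable_const_bound[where B=1]) (auto simp: indicator_def H1)
  have intE: "integrable M (\<lambda>\<omega>. iexp (\<tau> * X \<omega>))" for \<tau>
    by (rule integrable_const_bound[where B=1]) auto
  have intHE: "integrable M (\<lambda>\<omega>. complex_of_real (H \<omega>) * iexp (\<tau> * X \<omega>))" for \<tau>
    by (rule integrable_const_bound[where B=1]) (auto simp: norm_mult H1)
  have eH: "expectation H \<ge> -1"
  proof -
    have "expectation (\<lambda>_. -1) \<le> expectation H"
      by (rule integral_mono) (use intH H1 in \<open>auto simp: abs_le_iff minus_le_iff\<close>)
    then show ?thesis by (simp add: prob_space)
  qed
  define m where "m = 2 + expectation H"
  have m: "m > 0" using eH by (simp add: m_def)
  define w where "w = (\<lambda>\<omega>. (2 + H \<omega>) / m)"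
  have [measurable]: "w \<in> borel_measurable M" unfolding w_def by measurable
  have H1': "H \<omega> \<ge> -1" for \<omega> using H1[of \<omega>] by linarith
  have w0: "w \<omega> \<ge> 0" for \<omega> using H1'[of \<omega>] m by (auto simp: w_def)
  define D where "D = density M (\<lambda>\<omega>. ennreal (w \<omega>))"
  have intw: "integrable M w" unfolding w_def using intH by auto
  have ew: "expectation w = 1"
    unfolding w_def using intH m by (simp add: prob_space m_def)
  have D: "prob_space D"
  proof
    have "emeasure D (space D) = (\<integral>\<^sup>+\<omega>. ennreal (w \<omega>) \<partial>M)"
      unfolding D_def by (subst emeasure_density) (auto intro!: nn_integral_cong)
    also have "\<dots> = 1"
      using w0 intw by (subst nn_integral_eq_integral) (auto simp: ew)
    finally show "emeasure D (space D) = 1" .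
  qed
  have XD[measurable]: "X \<in> borel_measurable D" unfolding D_def by measurable
  interpret D: prob_space D by (rule D)
  interpret DX: real_distribution "distr D borel X"
    using D.prob_space_distr[OF XD] by (simp add: real_distribution_def real_distribution_axioms_def)
  have "char (distr D borel X) \<tau> = char \<nu> \<tau>" for \<tau>
  proof -
    have "char (distr D borel X) \<tau> = (CLINT \<omega>|D. iexp (\<tau> * X \<omega>))"
      unfolding char_def by (subst integral_distr) auto
    also have "\<dots> = (CLINT \<omega>|M. w \<omega> *\<^sub>R iexp (\<tau> * X \<omega>))"
      unfolding D_def using w0 by (subst integral_density) auto
    also have "\<dots> = (CLINT \<omega>|M. (2 / m) * iexp (\<tau> * X \<omega>) + (1 / m) * (complex_of_real (H \<omega>) * iexp (\<tau> * X \<omega>)))"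
      by (rule Bochner_Integration.integral_cong) (auto simp: w_def scaleR_conv_of_real algebra_simps add_divide_distrib)
    also have "\<dots> = (2 / m) * (CLINT \<omega>|M. iexp (\<tau> * X \<omega>)) +
        (1 / m) * (CLINT \<omega>|M. complex_of_real (H \<omega>) * iexp (\<tau> * X \<omega>))"
      using intE[of \<tau>] intHE[of \<tau>] by (subst Bochner_Integration.integral_add) auto
    also have "\<dots> = (2 / m) * char \<nu> \<tau> + (1 / m) * (expectation H * char \<nu> \<tau>)"
      by (simp only: char_X char_HX)
    also have "\<dots> = char \<nu> \<tau> * complex_of_real ((2 + expectation H) / m)"
      by (simp add: algebra_simps add_divide_distrib)
    also have "\<dots> = char \<nu> \<tau>" using m by (simp add: m_def)
    finally show ?thesis .
  qed
  then have DX: "distr D borel X = \<nu>"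
    by (intro Levy_uniqueness DX.real_distribution_axioms \<nu>) auto
  interpret MX: real_distribution "distr M borel X"
    using prob_space_distr[of X borel] by (simp add: real_distribution_def real_distribution_axioms_def)
  have "char (distr M borel X) \<tau> = char \<nu> \<tau>" for \<tau>
    using char_X by (simp add: char_def integral_distr)
  then have MX: "distr M borel X = \<nu>"
    by (intro Levy_uniqueness MX.real_distribution_axioms \<nu>) auto
  have "measure \<nu> A = (\<integral>x. indicator A x \<partial>distr D borel X)"
    unfolding DX using \<nu> by (simp add: real_distribution.space_eq_univ)
  also have "\<dots> = (\<integral>\<omega>. indicator A (X \<omega>) \<partial>D)"
    by (subst integral_distr) auto
  also have "\<dots> = (\<integral>\<omega>. w \<omega> * indicator A (X \<omega>) \<partial>M)"
    unfolding D_def using w0 by (subst integral_density) auto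
  also have "\<dots> = (\<integral>\<omega>. (2 / m) * indicator A (X \<omega>) + (1 / m) * (H \<omega> * indicator A (X \<omega>)) \<partial>M)"
    by (rule Bochner_Integration.integral_cong) (auto simp: w_def algebra_simps add_divide_distrib)
  also have "\<dots> = (2 / m) * (\<integral>\<omega>. indicator A (X \<omega>) \<partial>M) + (1 / m) * (\<integral>\<omega>. H \<omega> * indicator A (X \<omega>) \<partial>M)"
    using intI intHI by simp
  also have "(\<integral>\<omega>. indicator A (X \<omega>) \<partial>M) = (\<integral>x. indicator A x \<partial>distr M borel X :: real)"
    by (subst integral_distr) auto
  also have "\<dots> = measure \<nu> A"
    unfolding MX using \<nu> by (simp add: real_distribution.space_eq_univ)
  finally have "m * measure \<nu> A = 2 * measure \<nu> A + (\<integral>\<omega>. H \<omega> * indicator A (X \<omega>) \<partial>M)"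
    using m by (simp add: field_simps)
  then show ?thesis by (simp add: m_def algebra_simps)
qed

text \<open>The real version is applied to the real part (\<open>z = 1\<close>) and the imaginary
  part (\<open>z = - \<i>\<close>) of \<open>H\<close>. They inherit the factorisation because
  conjugating it at \<open>- \<tau>\<close> gives it for the conjugate of \<open>H\<close>.\<close>

lemma (in prob_space) expectation_indicator_char:
  fixes H :: "'a \<Rightarrow> complex" and X :: "'a \<Rightarrow> real"
  assumes [measurable]: "H \<in> borel_measurable M" "X \<in> borel_measurable M" "A \<in> sets borel"
    and H1: "\<And>\<omega>. norm (H \<omega>) \<le> 1"
    and \<nu>: "real_distribution \<nu>"
    and char_X: "\<And>\<tau>. (CLINT \<omega>|M. iexp (\<tau> * X \<omega>)) = char \<nu> \<tau>"
    and char_HX: "\<And>\<tau>. (CLINT \<omega>|M. H \<omega> * iexp (\<tau> * X \<omega>)) = (CLINT \<omega>|M. H \<omega>) * char \<nu> \<tau>"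
  shows "(CLINT \<omega>|M. H \<omega> * indicator A (X \<omega>)) = (CLINT \<omega>|M. H \<omega>) * measure \<nu> A"
proof -
  have re: "expectation (\<lambda>\<omega>. Re (z * H \<omega>) * indicator A (X \<omega>)) = expectation (\<lambda>\<omega>. Re (z * H \<omega>)) * measure \<nu> A"
    if z: "norm z = 1" for z
  proof -
    define F where "F = (\<lambda>\<omega>. z * H \<omega>)"
    have [measurable]: "F \<in> borel_measurable M" unfolding F_def by measurable
    have [measurable]: "(\<lambda>\<omega>. cnj (F \<omega>)) \<in> borel_measurable M"
      by (rule measurable_compose[of F M borel]) (auto intro!: borel_measurable_continuous_onI continuous_intros)
    have F1: "norm (F \<omega>) \<le> 1" for \<omega> using H1 z by (simp add: F_def norm_mult)
    have int: "integrable M F" "integrable M (\<lambda>\<omega>. F \<omega> * iexp (\<tau> * X \<omega>))"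
        "integrable M (\<lambda>\<omega>. cnj (F \<omega>) * iexp (\<tau> * X \<omega>))" for \<tau>
      by (rule integrable_const_bound[where B=1]; auto simp: norm_mult F1)+
    have F: "(CLINT \<omega>|M. F \<omega> * iexp (\<tau> * X \<omega>)) = (CLINT \<omega>|M. F \<omega>) * char \<nu> \<tau>" for \<tau>
      unfolding F_def mult.assoc integral_mult_right_zero char_HX ..
    have char_cnj: "cnj (char \<nu> (- \<tau>)) = char \<nu> \<tau>" for \<tau>
    proof -
      have "cnj (char \<nu> (- \<tau>)) = (CLINT \<omega>|M. cnj (iexp (- \<tau> * X \<omega>)))"
        unfolding char_X[symmetric] by (rule Bochner_Integration.integral_cnj[symmetric])
      also have "\<dots> = (CLINT \<omega>|M. iexp (\<tau> * X \<omega>))"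
        by (rule Bochner_Integration.integral_cong) (auto simp: exp_cnj)
      finally show ?thesis by (simp only: char_X)
    qed
    have cnjF: "(CLINT \<omega>|M. cnj (F \<omega>) * iexp (\<tau> * X \<omega>)) = cnj (CLINT \<omega>|M. F \<omega>) * char \<nu> \<tau>" for \<tau>
    proof -
      have "(CLINT \<omega>|M. cnj (F \<omega>) * iexp (\<tau> * X \<omega>)) = (CLINT \<omega>|M. cnj (F \<omega> * iexp (- \<tau> * X \<omega>)))"
        by (rule Bochner_Integration.integral_cong) (auto simp: exp_cnj)
      also have "\<dots> = cnj (CLINT \<omega>|M. F \<omega> * iexp (- \<tau> * X \<omega>))" by (rule Bochner_Integration.integral_cnj)
      finally show ?thesis by (simp only: F complex_cnj_mult char_cnj)
    qed
    have "expectation (\<lambda>\<omega>. Re (F \<omega>) * indicator A (X \<omega>)) = expectation (\<lambda>\<omega>. Re (F \<omega>)) * measure \<nu> A"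
    proof (rule expectation_indicator_char_real[OF _ _ _ _ \<nu> char_X])
      show "\<bar>Re (F \<omega>)\<bar> \<le> 1" for \<omega> using abs_Re_le_cmod[of "F \<omega>"] F1[of \<omega>] by linarith
      fix \<tau>
      have "(CLINT \<omega>|M. complex_of_real (Re (F \<omega>)) * iexp (\<tau> * X \<omega>)) =
        (CLINT \<omega>|M. (F \<omega> * iexp (\<tau> * X \<omega>) + cnj (F \<omega>) * iexp (\<tau> * X \<omega>)) / 2)"
        by (rule Bochner_Integration.integral_cong) (simp_all add: distrib_right[symmetric] complex_add_cnj)
      also have "\<dots> = ((CLINT \<omega>|M. F \<omega>) * char \<nu> \<tau> + cnj (CLINT \<omega>|M. F \<omega>) * char \<nu> \<tau>) / 2"
        by (subst F[symmetric], subst cnjF[symmetric]) (use int(2,3)[of \<tau>] in auto)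
      also have "\<dots> = complex_of_real (expectation (\<lambda>\<omega>. Re (F \<omega>))) * char \<nu> \<tau>"
        using int(1) by (simp add: distrib_right[symmetric] complex_add_cnj)
      finally show "(CLINT \<omega>|M. complex_of_real (Re (F \<omega>)) * iexp (\<tau> * X \<omega>)) =
         complex_of_real (expectation (\<lambda>\<omega>. Re (F \<omega>))) * char \<nu> \<tau>" .
    qed auto
    then show ?thesis by (simp only: F_def)
  qed
  have int: "integrable M H" "integrable M (\<lambda>\<omega>. H \<omega> * indicator A (X \<omega>))"
    by (rule integrable_const_bound[where B=1]; auto simp: indicator_def H1)+
  have ind: "Re (indicator A x) = indicator A x" "Im (indicator A x) = 0" for x :: real
    by (auto simp: indicator_def)
  show ?thesis
    using re[of 1] re[of "- \<i>"] int
    by (intro complex_eqI) (simp_all add: integral_Re[symmetric] integral_Im[symmetric] ind del: integral_Re integral_Im)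
qed

text \<open>One-dimensional uniqueness is lifted to the product: exponentials are traded for
  indicators one coordinate at a time, and after the last trade the probabilities of all boxes are
  known, which determine the product measure.\<close>

lemma (in prob_space) distr_PiM_eq_if_char_eq:
  fixes W :: "'b \<Rightarrow> 'a \<Rightarrow> real"
  assumes J: "finite J" and [measurable]: "\<And>j. j \<in> J \<Longrightarrow> W j \<in> borel_measurable M"
    and \<nu>: "\<And>j. real_distribution (\<nu> j)"
    and char: "\<And>s. (CLINT \<omega>|M. iexp (\<Sum>j\<in>J. s j * W j \<omega>)) = (\<Prod>j\<in>J. char (\<nu> j) (s j))"
  shows "distr M (PiM J (\<lambda>_. borel)) (\<lambda>\<omega>. \<lambda>j\<in>J. W j \<omega>) = PiM J \<nu>"
proof -
  have char0: "char (\<nu> j) 0 = 1" for j using real_distribution.char_zero[OF \<nu>] .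
  \<comment> \<open>Invariant of the exchange: the coordinates in \<open>I\<close> already enter
    through indicators, the others still through exponentials.\<close>
  have main: "(CLINT \<omega>|M. (\<Prod>i\<in>I. indicator (A i) (W i \<omega>)) * iexp (\<Sum>j\<in>J-I. s j * W j \<omega>)) =
      (\<Prod>i\<in>I. complex_of_real (measure (\<nu> i) (A i))) * (\<Prod>j\<in>J-I. char (\<nu> j) (s j))"
    if "I \<subseteq> J" "\<And>i. i \<in> I \<Longrightarrow> A i \<in> sets borel" for I A s
  proof -
    have "finite I" using J that(1) finite_subset by blast
    then show ?thesis using that
    proof (induction I arbitrary: s)
      case empty
      show ?case using char by simp
    next
      case (insert l I)
      have lJ: "l \<in> J" "I \<subseteq> J" and [measurable]: "\<And>i. i \<in> I \<Longrightarrow> A i \<in> sets borel" "A l \<in> sets borel"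
        using insert by auto
      have [measurable]: "W l \<in> borel_measurable M" "\<And>i. i \<in> I \<Longrightarrow> W i \<in> borel_measurable M"
        using lJ by auto
      \<comment> \<open>\<open>H\<close> carries every coordinate but \<open>l\<close>. By the
        induction hypothesis, appending the exponential of coordinate \<open>l\<close> multiplies
        the mean by \<open>char (\<nu> l)\<close>, which is what the exchange of that coordinate
        requires.\<close>
      define H where "H = (\<lambda>\<omega>. (\<Prod>i\<in>I. indicator (A i) (W i \<omega>)) * iexp (\<Sum>j\<in>J-insert l I. s j * W j \<omega>))"
      have [measurable]: "H \<in> borel_measurable M"
        unfolding H_def by measurable
      have Jl: "J - I = insert l (J - insert l I)" using insert by auto
      have pr: "(\<Prod>j\<in>J-insert l I. char (\<nu> j) ((s(l:=\<tau>)) j)) = (\<Prod>j\<in>J-insert l I. char (\<nu> j) (s j))" for \<tau>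
        by (rule prod.cong) auto
      have step: "(CLINT \<omega>|M. H \<omega> * iexp (\<tau> * W l \<omega>)) =
          (\<Prod>i\<in>I. complex_of_real (measure (\<nu> i) (A i))) * (\<Prod>j\<in>J-insert l I. char (\<nu> j) (s j)) * char (\<nu> l) \<tau>" for \<tau>
      proof -
        have "(\<Sum>j\<in>J - I. (s(l:=\<tau>)) j * W j \<omega>) = \<tau> * W l \<omega> + (\<Sum>j\<in>J-insert l I. s j * W j \<omega>)" for \<omega>
        proof -
          have "(\<Sum>j\<in>J-insert l I. (s(l:=\<tau>)) j * W j \<omega>) = (\<Sum>j\<in>J-insert l I. s j * W j \<omega>)"
            by (rule sum.cong) auto
          then show ?thesis unfolding Jl using J by simp
        qed
        then have "(CLINT \<omega>|M. H \<omega> * iexp (\<tau> * W l \<omega>)) =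
          (CLINT \<omega>|M. (\<Prod>i\<in>I. indicator (A i) (W i \<omega>)) * iexp (\<Sum>j\<in>J-I. (s(l:=\<tau>)) j * W j \<omega>))"
          by (intro Bochner_Integration.integral_cong) (auto simp: H_def exp_add distrib_left mult_ac)
        also have "\<dots> = (\<Prod>i\<in>I. complex_of_real (measure (\<nu> i) (A i))) * (\<Prod>j\<in>J-I. char (\<nu> j) ((s(l:=\<tau>)) j))"
          by (rule insert.IH) (use insert in auto)
        also have "(\<Prod>j\<in>J-I. char (\<nu> j) ((s(l:=\<tau>)) j)) = char (\<nu> l) \<tau> * (\<Prod>j\<in>J-insert l I. char (\<nu> j) (s j))"
          by (subst Jl, subst prod.insert) (use J in \<open>auto simp: pr\<close>)
        finally show ?thesis by (simp add: mult_ac)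
      qed
      have "(CLINT \<omega>|M. H \<omega> * indicator (A l) (W l \<omega>)) = (CLINT \<omega>|M. H \<omega>) * measure (\<nu> l) (A l)"
      proof (rule expectation_indicator_char[OF _ _ _ _ \<nu>])
        show "cmod (H \<omega>) \<le> 1" for \<omega>
          by (simp add: H_def norm_mult flip: prod_norm) (auto intro!: prod_le_1 simp: indicator_def)
        show "(CLINT \<omega>|M. iexp (\<tau> * W l \<omega>)) = char (\<nu> l) \<tau>" for \<tau>
        proof -
          have "(\<Sum>j\<in>J. ((\<lambda>_. 0)(l:=\<tau>)) j * W j \<omega>) = \<tau> * W l \<omega>" for \<omega>
            using J lJ by (subst sum.remove[of _ l]) auto
          moreover have "(\<Prod>j\<in>J. char (\<nu> j) (((\<lambda>_. 0)(l:=\<tau>)) j)) = char (\<nu> l) \<tau>"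
            using J lJ by (subst prod.remove[of _ l]) (auto simp: char0)
          ultimately show ?thesis using char[of "(\<lambda>_. 0)(l:=\<tau>)"] by simp
        qed
        show "(CLINT \<omega>|M. H \<omega> * iexp (\<tau> * W l \<omega>)) = (CLINT \<omega>|M. H \<omega>) * char (\<nu> l) \<tau>" for \<tau>
          using step[of \<tau>] step[of 0] by (simp add: char0)
      qed auto
      moreover have "(CLINT \<omega>|M. H \<omega>) =
          (\<Prod>i\<in>I. complex_of_real (measure (\<nu> i) (A i))) * (\<Prod>j\<in>J-insert l I. char (\<nu> j) (s j))"
        using step[of 0] by (simp add: char0)
      ultimately show ?case
        using insert(1,2) by (simp add: H_def mult_ac)
    qed
  qed
  interpret P: product_prob_space \<nu> J
    using \<nu> by (intro product_prob_spaceI) (auto simp: real_distribution_def)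
  have sets_\<nu>: "sets (\<nu> j) = sets borel" "space (\<nu> j) = UNIV" for j
    using \<nu>[of j] by (auto simp: real_distribution.space_eq_univ real_distribution.events_eq_borel)
  have Wm[measurable]: "(\<lambda>\<omega>. \<lambda>j\<in>J. W j \<omega>) \<in> measurable M (PiM J (\<lambda>_. borel))"
    by (rule measurable_restrict) auto
  show ?thesis
  proof (rule P.PiM_eqI[OF J])
    show "sets (distr M (PiM J (\<lambda>_. borel)) (\<lambda>\<omega>. \<lambda>j\<in>J. W j \<omega>)) = sets (PiM J \<nu>)"
      by (simp, rule sets_PiM_cong) (auto simp: sets_\<nu>)
    fix A assume "\<And>i. i \<in> J \<Longrightarrow> A i \<in> sets (\<nu> i)"
    then have A[measurable]: "\<And>i. i \<in> J \<Longrightarrow> A i \<in> sets borel" by (simp add: sets_\<nu>)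
    have S: "PiE J A \<in> sets (PiM J (\<lambda>_. borel))"
      by (rule sets_PiM_I_finite[OF J]) auto
    have "complex_of_real (\<Prod>i\<in>J. measure (\<nu> i) (A i)) = (CLINT \<omega>|M. complex_of_real (\<Prod>i\<in>J. indicator (A i) (W i \<omega>)))"
      using main[of J A "\<lambda>_. 0"] A by (simp add: of_real_indicator)
    also have "\<dots> = complex_of_real (expectation (\<lambda>\<omega>. \<Prod>i\<in>J. indicator (A i) (W i \<omega>)))"
      by (rule integral_complex_of_real)
    also have "expectation (\<lambda>\<omega>. \<Prod>i\<in>J. indicator (A i) (W i \<omega>)) =
       (expectation (indicator ((\<lambda>\<omega>. \<lambda>j\<in>J. W j \<omega>) -` (PiE J A) \<inter> space M)) :: real)"
    proof (rule Bochner_Integration.integral_cong[OF refl])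
      fix \<omega> assume "\<omega> \<in> space M"
      then show "(\<Prod>i\<in>J. indicator (A i) (W i \<omega>) :: real) = indicator ((\<lambda>\<omega>. \<lambda>j\<in>J. W j \<omega>) -` (PiE J A) \<inter> space M) \<omega>"
        using J by (auto simp: indicator_def PiE_def Pi_def)
    qed
    also have "\<dots> = prob ((\<lambda>\<omega>. \<lambda>j\<in>J. W j \<omega>) -` (PiE J A) \<inter> space M)"
      by simp
    finally have e: "prob ((\<lambda>\<omega>. \<lambda>j\<in>J. W j \<omega>) -` (PiE J A) \<inter> space M) = (\<Prod>i\<in>J. measure (\<nu> i) (A i))"
      by (simp only: of_real_eq_iff)
    have "emeasure (distr M (PiM J (\<lambda>_. borel)) (\<lambda>\<omega>. \<lambda>j\<in>J. W j \<omega>)) (PiE J A) =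
       ennreal (prob ((\<lambda>\<omega>. \<lambda>j\<in>J. W j \<omega>) -` (PiE J A) \<inter> space M))"
      by (subst emeasure_distr[OF Wm S]) (simp add: emeasure_eq_measure)
    also have "\<dots> = (\<Prod>i\<in>J. emeasure (\<nu> i) (A i))"
      unfolding e using J
      by (subst prod_ennreal[symmetric]) (auto intro!: prod.cong simp: P.M.emeasure_eq_measure)
    finally show "emeasure (distr M (PiM J (\<lambda>_. borel)) (\<lambda>\<omega>. \<lambda>j\<in>J. W j \<omega>)) (PiE J A) = (\<Prod>i\<in>J. emeasure (\<nu> i) (A i))" .
  qed
qed

text \<open>A combination of the new variables with weights \<open>s\<close> is a combination of the
  old ones with weights \<open>a\<close>. Orthonormality preserves the sum of squared weights, and
  the Gaussian characteristic function depends on nothing else.\<close>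

lemma (in prob_space) distr_orthonormal_gauss:
  fixes u :: "'i \<Rightarrow> 'a \<Rightarrow> real" and U :: "'j \<Rightarrow> 'i \<Rightarrow> real"
  assumes \<sigma>: "0 < \<sigma>" and I: "finite I" and J: "finite J"
    and indep: "indep_vars (\<lambda>_. borel) u I"
    and u: "\<And>i. i \<in> I \<Longrightarrow> distr M borel (u i) = gauss 0 \<sigma>"
    and U: "\<And>j k. j \<in> J \<Longrightarrow> k \<in> J \<Longrightarrow> (\<Sum>i\<in>I. U j i * U k i) = of_bool (j = k)"
  shows "distr M (PiM J (\<lambda>_. borel)) (\<lambda>\<omega>. \<lambda>j\<in>J. \<Sum>i\<in>I. U j i * u i \<omega>) = PiM J (\<lambda>_. gauss 0 \<sigma>)"
proof (rule distr_PiM_eq_if_char_eq[OF J _ real_distribution_gauss[OF \<sigma>]])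
  have [measurable]: "\<And>i. i \<in> I \<Longrightarrow> u i \<in> borel_measurable M"
    using indep by (simp add: indep_vars_def)
  show "(\<lambda>\<omega>. \<Sum>i\<in>I. U j i * u i \<omega>) \<in> borel_measurable M" for j
    by measurable
  fix s :: "'j \<Rightarrow> real"
  define a where "a = (\<lambda>i. \<Sum>j\<in>J. s j * U j i)"
  have swap: "(\<Sum>j\<in>J. s j * (\<Sum>i\<in>I. U j i * u i \<omega>)) = (\<Sum>i\<in>I. a i * u i \<omega>)" for \<omega>
    unfolding a_def sum_distrib_left sum_distrib_right by (subst sum.swap) (simp add: mult_ac)
  have "(\<Sum>i\<in>I. (a i)\<^sup>2) = (\<Sum>i\<in>I. \<Sum>j\<in>J. \<Sum>k\<in>J. s j * s k * (U j i * U k i))"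
    unfolding a_def power2_eq_square sum_product by (simp add: mult_ac)
  also have "\<dots> = (\<Sum>j\<in>J. \<Sum>k\<in>J. \<Sum>i\<in>I. s j * s k * (U j i * U k i))"
    by (subst sum.swap, rule sum.cong[OF refl], rule sum.swap)
  also have "\<dots> = (\<Sum>j\<in>J. \<Sum>k\<in>J. s j * s k * of_bool (j = k))"
    by (intro sum.cong refl) (simp add: U flip: sum_distrib_left)
  also have "\<dots> = (\<Sum>j\<in>J. (s j)\<^sup>2)"
  proof (rule sum.cong[OF refl])
    fix j assume "j \<in> J"
    have "(\<Sum>k\<in>J. s j * s k * of_bool (j = k)) = (\<Sum>k\<in>J. if k = j then (s j)\<^sup>2 else 0)"
      by (rule sum.cong) (auto simp: power2_eq_square)
    then show "(\<Sum>k\<in>J. s j * s k * of_bool (j = k)) = (s j)\<^sup>2"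
      using \<open>j \<in> J\<close> J by simp
  qed
  finally have asum: "(\<Sum>i\<in>I. (a i)\<^sup>2) = (\<Sum>j\<in>J. (s j)\<^sup>2)" .
  have ind: "indep_vars (\<lambda>_. borel) (\<lambda>i \<omega>. a i * u i \<omega>) I"
    by (rule indep_vars_compose2[OF indep]) auto
  have "(CLINT \<omega>|M. iexp (\<Sum>j\<in>J. s j * (\<Sum>i\<in>I. U j i * u i \<omega>))) =
      char (distr M borel (\<lambda>\<omega>. \<Sum>i\<in>I. a i * u i \<omega>)) 1"
    unfolding swap char_def by (subst integral_distr) auto
  also have "\<dots> = (\<Prod>i\<in>I. char (distr M borel (\<lambda>\<omega>. a i * u i \<omega>)) 1)"
    by (rule char_distr_sum[OF ind])
  also have "\<dots> = (\<Prod>i\<in>I. char (gauss 0 \<sigma>) (a i))"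
  proof (rule prod.cong[OF refl])
    fix i assume i: "i \<in> I"
    have "char (distr M borel (\<lambda>\<omega>. a i * u i \<omega>)) 1 = char (distr M borel (u i)) (a i)"
      using i unfolding char_def by (simp add: integral_distr)
    then show "char (distr M borel (\<lambda>\<omega>. a i * u i \<omega>)) 1 = char (gauss 0 \<sigma>) (a i)"
      by (simp add: u i)
  qed
  also have "\<dots> = complex_of_real (exp (\<Sum>i\<in>I. - (\<sigma> * a i)\<^sup>2 / 2))"
    using I by (simp add: char_gauss[OF \<sigma>] exp_sum)
  also have "(\<Sum>i\<in>I. - (\<sigma> * a i)\<^sup>2 / 2) = (\<Sum>j\<in>J. - (\<sigma> * s j)\<^sup>2 / 2)"
  proof -
    have "(\<Sum>i\<in>I. - (\<sigma> * a i)\<^sup>2 / 2) = - \<sigma>\<^sup>2 / 2 * (\<Sum>i\<in>I. (a i)\<^sup>2)"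
      by (simp add: sum_distrib_left power_mult_distrib)
    moreover have "(\<Sum>j\<in>J. - (\<sigma> * s j)\<^sup>2 / 2) = - \<sigma>\<^sup>2 / 2 * (\<Sum>j\<in>J. (s j)\<^sup>2)"
      by (simp add: sum_distrib_left power_mult_distrib)
    ultimately show ?thesis by (simp add: asum)
  qed
  also have "complex_of_real (exp (\<Sum>j\<in>J. - (\<sigma> * s j)\<^sup>2 / 2)) = (\<Prod>j\<in>J. char (gauss 0 \<sigma>) (s j))"
    using J by (simp add: char_gauss[OF \<sigma>] exp_sum)
  finally show "(CLINT \<omega>|M. iexp (\<Sum>j\<in>J. s j * (\<Sum>i\<in>I. U j i * u i \<omega>))) = (\<Prod>j\<in>J. char (gauss 0 \<sigma>) (s j))" .
qed

subsection \<open>Likelihood ratios of Gaussian product laws\<close>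

lemma PiM_density:
  fixes f :: "'i \<Rightarrow> real \<Rightarrow> real"
  assumes I: "finite I" and [measurable]: "\<And>i. f i \<in> borel_measurable borel"
    and f0: "\<And>i x. 0 \<le> f i x"
    and prob: "\<And>i. prob_space (density lborel (\<lambda>x. ennreal (f i x)))"
  shows "PiM I (\<lambda>i. density lborel (\<lambda>x. ennreal (f i x))) =
    density (PiM I (\<lambda>_. lborel)) (\<lambda>x. ennreal (\<Prod>i\<in>I. f i (x i)))"
proof -
  interpret L: product_sigma_finite "\<lambda>_::'i. lborel :: real measure" by standard
  interpret P: product_prob_space "\<lambda>i. density lborel (\<lambda>x. ennreal (f i x))" I
    using prob by (rule product_prob_spaceI)
  show ?thesis
  proof (rule P.PiM_eqI[symmetric, OF I])
    show "sets (density (PiM I (\<lambda>_. lborel)) (\<lambda>x. ennreal (\<Prod>i\<in>I. f i (x i)))) =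
      sets (PiM I (\<lambda>i. density lborel (\<lambda>x. ennreal (f i x))))"
      by (simp cong: sets_PiM_cong)
    fix A assume "\<And>i. i \<in> I \<Longrightarrow> A i \<in> sets (density lborel (\<lambda>x. ennreal (f i x)))"
    then have A[measurable]: "\<And>i. i \<in> I \<Longrightarrow> A i \<in> sets borel" by simp
    have "emeasure (density (PiM I (\<lambda>_. lborel)) (\<lambda>x. ennreal (\<Prod>i\<in>I. f i (x i)))) (PiE I A) =
       (\<integral>\<^sup>+x. ennreal (\<Prod>i\<in>I. f i (x i)) * indicator (PiE I A) x \<partial>PiM I (\<lambda>_. lborel))"
      by (subst emeasure_density) (auto intro!: sets_PiM_I_finite I)
    also have "\<dots> = (\<integral>\<^sup>+x. (\<Prod>i\<in>I. ennreal (f i (x i)) * indicator (A i) (x i)) \<partial>PiM I (\<lambda>_. lborel))"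
    proof (rule nn_integral_cong)
      fix x assume "x \<in> space (PiM I (\<lambda>_. lborel :: real measure))"
      then have "indicator (PiE I A) x = (\<Prod>i\<in>I. indicator (A i) (x i) :: ennreal)"
        using I by (auto simp: indicator_def space_PiM PiE_def Pi_def)
      then show "ennreal (\<Prod>i\<in>I. f i (x i)) * indicator (PiE I A) x =
        (\<Prod>i\<in>I. ennreal (f i (x i)) * indicator (A i) (x i))"
        using f0 by (simp add: prod.distrib prod_ennreal)
    qed
    also have "\<dots> = (\<Prod>i\<in>I. \<integral>\<^sup>+x. ennreal (f i x) * indicator (A i) x \<partial>lborel)"
      by (rule L.product_nn_integral_prod[OF I]) auto
    also have "\<dots> = (\<Prod>i\<in>I. emeasure (density lborel (\<lambda>x. ennreal (f i x))) (A i))"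
      by (intro prod.cong refl) (auto simp: emeasure_density)
    finally show "emeasure (density (PiM I (\<lambda>_. lborel)) (\<lambda>x. ennreal (\<Prod>i\<in>I. f i (x i)))) (PiE I A) =
       (\<Prod>i\<in>I. emeasure (density lborel (\<lambda>x. ennreal (f i x))) (A i))" .
  qed
qed

text \<open>Completing the square: \<open>f\<^sub>b\<^sup>2 / f\<^sub>a\<close> is a constant times
  the normal density with the reflected mean \<open>2 * b - a\<close>. This makes chi-square
  integrals between shifted Gaussian laws explicit.\<close>

lemma normal_density_square:
  assumes "0 < \<sigma>"
  shows "(normal_density b \<sigma> x)\<^sup>2 =
    exp ((b - a)\<^sup>2 / \<sigma>\<^sup>2) * normal_density (2 * b - a) \<sigma> x * normal_density a \<sigma> x"
proof -
  have "- (2 * (x - b)\<^sup>2) / (2 * \<sigma>\<^sup>2) = (b - a)\<^sup>2 / \<sigma>\<^sup>2 + - (x - (2 * b - a))\<^sup>2 / (2 * \<sigma>\<^sup>2) + - (x - a)\<^sup>2 / (2 * \<sigma>\<^sup>2)"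
    using assms by (simp add: field_simps power2_eq_square)
  then have "exp (- (x - b)\<^sup>2 / (2 * \<sigma>\<^sup>2)) * exp (- (x - b)\<^sup>2 / (2 * \<sigma>\<^sup>2)) =
    exp ((b - a)\<^sup>2 / \<sigma>\<^sup>2) * exp (- (x - (2 * b - a))\<^sup>2 / (2 * \<sigma>\<^sup>2)) * exp (- (x - a)\<^sup>2 / (2 * \<sigma>\<^sup>2))"
    unfolding exp_add[symmetric] by (simp add: field_simps)
  then show ?thesis
    unfolding normal_density_def power2_eq_square[of "_ * _"] by simp
qed

context
  fixes I :: "'i set" and \<sigma> :: real
  assumes I: "finite I" and \<sigma>: "0 < \<sigma>"
begin

definition joint_normal_density :: "('i \<Rightarrow> real) \<Rightarrow> ('i \<Rightarrow> real) \<Rightarrow> real" where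
  "joint_normal_density \<mu> x = (\<Prod>i\<in>I. normal_density (\<mu> i) \<sigma> (x i))"

lemma joint_normal_density_measurable[measurable]:
  "joint_normal_density \<mu> \<in> borel_measurable (PiM I (\<lambda>_. lborel))"
  unfolding joint_normal_density_def by measurable

lemma joint_normal_density_pos: "0 < joint_normal_density \<mu> x"
  unfolding joint_normal_density_def using \<sigma> by (intro prod_pos) (auto intro: normal_density_pos)

lemma PiM_gauss:
  "PiM I (\<lambda>i. gauss (\<mu> i) \<sigma>) = density (PiM I (\<lambda>_. lborel)) (\<lambda>x. ennreal (joint_normal_density \<mu> x))"
  unfolding joint_normal_density_def
  by (rule PiM_density[OF I]) (auto intro: prob_space_normal_density \<sigma>)

lemma prob_space_PiM_gauss: "prob_space (PiM I (\<lambda>i. gauss (\<mu> i) \<sigma>))"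
  by (intro prob_space_PiM prob_space_normal_density \<sigma>)

lemma has_bochner_integral_joint_normal_density:
  assumes E: "E \<in> sets (PiM I (\<lambda>_. borel))"
  shows "has_bochner_integral (PiM I (\<lambda>_. lborel)) (\<lambda>x. indicator E x * joint_normal_density \<mu> x)
    (measure (PiM I (\<lambda>i. gauss (\<mu> i) \<sigma>)) E)"
proof -
  interpret prob_space "PiM I (\<lambda>i. gauss (\<mu> i) \<sigma>)" by (rule prob_space_PiM_gauss)
  have s: "sets (PiM I (\<lambda>_. borel)) = sets (PiM I (\<lambda>i. gauss (\<mu> i) \<sigma>))"
      "sets (PiM I (\<lambda>_. borel :: real measure)) = sets (PiM I (\<lambda>_. lborel :: real measure))"
    by (auto intro!: sets_PiM_cong)
  have "emeasure (PiM I (\<lambda>i. gauss (\<mu> i) \<sigma>)) E =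
     (\<integral>\<^sup>+x. ennreal (indicator E x * joint_normal_density \<mu> x) \<partial>PiM I (\<lambda>_. lborel))"
    using E unfolding PiM_gauss s(2)
    by (subst emeasure_density) (auto intro!: nn_integral_cong simp: indicator_def)
  then have *: "(\<integral>\<^sup>+x. ennreal (indicator E x * joint_normal_density \<mu> x) \<partial>PiM I (\<lambda>_. lborel)) =
      ennreal (measure (PiM I (\<lambda>i. gauss (\<mu> i) \<sigma>)) E)"
    by (simp add: emeasure_eq_measure)
  show ?thesis
    by (rule has_bochner_integral_nn_integral[OF _ _ _ *])
      (use E in \<open>auto simp: s(2) indicator_def intro!: less_imp_le[OF joint_normal_density_pos]\<close>)
qed

lemma joint_normal_density_square:
  "(joint_normal_density b x)\<^sup>2 = exp ((\<Sum>i\<in>I. (b i - a i)\<^sup>2) / \<sigma>\<^sup>2) *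
     joint_normal_density (\<lambda>i. 2 * b i - a i) x * joint_normal_density a x"
proof -
  have "(joint_normal_density b x)\<^sup>2 = (\<Prod>i\<in>I. (normal_density (b i) \<sigma> (x i))\<^sup>2)"
    by (simp add: joint_normal_density_def prod_power_distrib)
  also have "\<dots> = (\<Prod>i\<in>I. exp ((b i - a i)\<^sup>2 / \<sigma>\<^sup>2) * normal_density (2 * b i - a i) \<sigma> (x i) *
      normal_density (a i) \<sigma> (x i))"
    by (intro prod.cong refl normal_density_square \<sigma>)
  finally show ?thesis
    by (simp add: joint_normal_density_def prod.distrib exp_sum I sum_divide_distrib)
qed

text \<open>
  With \<open>\<alpha> = 0\<close> this is a contiguity bound, with \<open>\<alpha> = 1\<close> a bound for the total variation distance.
  It integrates \<open>2 (f\<^sub>b - \<alpha> f\<^sub>a) \<le> l (f\<^sub>b - \<alpha> f\<^sub>a)\<^sup>2 / f\<^sub>a + f\<^sub>a / l\<close>.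
\<close>
lemma measure_PiM_gauss_compare:
  assumes E: "E \<in> sets (PiM I (\<lambda>_. borel))" and l: "0 < l"
  shows "2 * (measure (PiM I (\<lambda>i. gauss (b i) \<sigma>)) E - \<alpha> * measure (PiM I (\<lambda>i. gauss (a i) \<sigma>)) E) \<le>
    l * (exp ((\<Sum>i\<in>I. (b i - a i)\<^sup>2) / \<sigma>\<^sup>2) - 2 * \<alpha> + \<alpha>\<^sup>2) + measure (PiM I (\<lambda>i. gauss (a i) \<sigma>)) E / l"
proof -
  let ?K = "exp ((\<Sum>i\<in>I. (b i - a i)\<^sup>2) / \<sigma>\<^sup>2)" and ?c = "\<lambda>i. 2 * b i - a i"
  let ?L = "PiM I (\<lambda>_. lborel :: real measure)"
  let ?a = "joint_normal_density a" and ?b = "joint_normal_density b"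
  note h = has_bochner_integral_joint_normal_density[OF E]
  have h1: "has_bochner_integral ?L (joint_normal_density \<mu>) 1" for \<mu>
  proof -
    interpret prob_space "PiM I (\<lambda>i. gauss (\<mu> i) \<sigma>)" by (rule prob_space_PiM_gauss)
    have sp: "space (PiM I (\<lambda>_. borel :: real measure)) = space (PiM I (\<lambda>i. gauss (\<mu> i) \<sigma>))"
       "space (PiM I (\<lambda>_. borel :: real measure)) = space ?L"
      by (auto simp: space_PiM)
    have "has_bochner_integral ?L (\<lambda>x. indicator (space (PiM I (\<lambda>_. borel :: real measure))) x * joint_normal_density \<mu> x) 1"
      using has_bochner_integral_joint_normal_density[OF sets.top, of \<mu>] unfolding sp(1) prob_space .
    then show ?thesis
      by (rule has_bochner_integral_cong[THEN iffD1, rotated -1]) (auto simp: sp(2) indicator_def)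
  qed
  \<comment> \<open>\<open>r\<close> is the quotient
    \<open>(f\<^sub>b - \<alpha> f\<^sub>a)\<^sup>2 / f\<^sub>a\<close>, written as a combination of
    three densities so that its integral can be read off.\<close>
  define r where "r = (\<lambda>x. ?K * joint_normal_density ?c x - 2 * \<alpha> * ?b x + \<alpha>\<^sup>2 * ?a x)"
  have r: "r x = (?b x - \<alpha> * ?a x)\<^sup>2 / ?a x" for x
  proof -
    have "?K * joint_normal_density ?c x = (?b x)\<^sup>2 / ?a x"
      unfolding joint_normal_density_square[of b x a] using joint_normal_density_pos[of a x] by simp
    then show ?thesis
      using joint_normal_density_pos[of a x] by (simp add: r_def field_simps power2_eq_square)
  qed
  have r0: "0 \<le> r x" for x
    unfolding r using joint_normal_density_pos[of a x] by simp
  have "has_bochner_integral ?L r (?K * 1 - 2 * \<alpha> * 1 + \<alpha>\<^sup>2 * 1)"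
    unfolding r_def by (intro has_bochner_integral_add has_bochner_integral_diff has_bochner_integral_mult_right h1)
  then have hr: "has_bochner_integral ?L r (?K - 2 * \<alpha> + \<alpha>\<^sup>2)" by simp
  have pw: "2 * (?b x - \<alpha> * ?a x) \<le> l * r x + ?a x / l" for x
  proof -
    have "0 \<le> (l * (?b x - \<alpha> * ?a x) - ?a x)\<^sup>2 / (l * ?a x)"
      using l joint_normal_density_pos[of a x] by simp
    also have "\<dots> = l * ((?b x - \<alpha> * ?a x)\<^sup>2 / ?a x) - 2 * (?b x - \<alpha> * ?a x) + ?a x / l"
      using l joint_normal_density_pos[of a x] by (simp add: field_simps power2_eq_square)
    finally show ?thesis by (simp add: r)
  qed
  have "2 * (measure (PiM I (\<lambda>i. gauss (b i) \<sigma>)) E - \<alpha> * measure (PiM I (\<lambda>i. gauss (a i) \<sigma>)) E) =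
      (\<integral>x. 2 * (indicator E x * ?b x - \<alpha> * (indicator E x * ?a x)) \<partial>?L)"
    using h[of b] h[of a] by (simp add: has_bochner_integral_iff)
  also have "\<dots> \<le> (\<integral>x. l * r x + (indicator E x * ?a x) / l \<partial>?L)"
  proof (rule integral_mono)
    show "2 * (indicator E x * ?b x - \<alpha> * (indicator E x * ?a x)) \<le> l * r x + (indicator E x * ?a x) / l" for x
      using pw[of x] r0[of x] l by (cases "x \<in> E") auto
  qed (use h hr in \<open>auto simp: has_bochner_integral_iff\<close>)
  also have "\<dots> = l * (?K - 2 * \<alpha> + \<alpha>\<^sup>2) + measure (PiM I (\<lambda>i. gauss (a i) \<sigma>)) E / l"
    using hr h[of a] by (simp add: has_bochner_integral_iff)
  finally show ?thesis .
qed

end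

text \<open>Chebyshev's inequality: each centred square has variance
  \<open>3 * \<sigma>^4 - \<sigma>^4\<close>, and independence removes the cross terms, so the
  variance grows only linearly in the number of variables.\<close>

lemma (in prob_space) concentration_sum_squares_gauss:
  fixes u :: "'i \<Rightarrow> 'a \<Rightarrow> real" and \<sigma> \<eta> :: real
  assumes \<sigma>: "0 < \<sigma>" and I: "finite I" and eta: "0 < \<eta>"
    and indep: "indep_vars (\<lambda>_. borel) u I"
    and u: "\<And>i. i \<in> I \<Longrightarrow> distr M borel (u i) = gauss 0 \<sigma>"
  shows "prob {\<omega>\<in>space M. \<eta> \<le> \<bar>(\<Sum>i\<in>I. (u i \<omega>)\<^sup>2) - card I * \<sigma>\<^sup>2\<bar>} \<le> 2 * \<sigma>^4 * card I / \<eta>\<^sup>2"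
proof -
  have um[measurable]: "\<And>i. i \<in> I \<Longrightarrow> u i \<in> borel_measurable M"
    using indep by (simp add: indep_vars_def)
  have int: "integrable (gauss 0 \<sigma>) (\<lambda>x. x ^ k)" for k
    using integrable_normal_moment[OF \<sigma>, of 0 k] by (subst integrable_density) auto
  have m2: "(\<integral>x. x\<^sup>2 \<partial>gauss 0 \<sigma>) = \<sigma>\<^sup>2"
    using integral_normal_moment_even[OF \<sigma>, of 0 1] by (subst integral_density) (auto simp: fact_numeral)
  have m4: "(\<integral>x. x ^ 4 \<partial>gauss 0 \<sigma>) = 3 * \<sigma> ^ 4"
    using integral_normal_moment_even[OF \<sigma>, of 0 2] by (subst integral_density) (auto simp: fact_numeral power_divide field_simps)
  have m0: "(\<integral>x. 1 \<partial>gauss 0 \<sigma>) = (1 :: real)"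
    using prob_space.prob_space[OF prob_space_normal_density[OF \<sigma>]] by simp
  define v where "v = (\<lambda>i \<omega>. (u i \<omega>)\<^sup>2 - \<sigma>\<^sup>2)"
  have [measurable]: "\<And>i. i \<in> I \<Longrightarrow> v i \<in> borel_measurable M" unfolding v_def by measurable
  have indv: "indep_vars (\<lambda>_. borel) v I"
    unfolding v_def by (rule indep_vars_compose2[OF indep]) auto
  have tr: "integrable M (\<lambda>\<omega>. f (u i \<omega>)) = integrable (gauss 0 \<sigma>) f"
    "expectation (\<lambda>\<omega>. f (u i \<omega>)) = (\<integral>x. f x \<partial>gauss 0 \<sigma>)"
    if "i \<in> I" "f \<in> borel_measurable borel" for i and f :: "real \<Rightarrow> real"
    unfolding u[OF that(1), symmetric] using that by (auto simp: integrable_distr_eq integral_distr)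
  have sq: "(x\<^sup>2 - \<sigma>\<^sup>2)\<^sup>2 = x ^ 4 - 2 * \<sigma>\<^sup>2 * x\<^sup>2 + \<sigma> ^ 4" for x :: real
    by (simp add: power2_eq_square power4_eq_xxxx algebra_simps)
  have c: "integrable (gauss 0 \<sigma>) (\<lambda>_. k :: real)" for k using int[of 0] integrable_mult_right[of k "gauss 0 \<sigma>" "\<lambda>_. 1"] by simp
  have h: "has_bochner_integral (gauss 0 \<sigma>) (\<lambda>x. x\<^sup>2) (\<sigma>\<^sup>2)"
    "has_bochner_integral (gauss 0 \<sigma>) (\<lambda>x. x ^ 4) (3 * \<sigma> ^ 4)"
    "has_bochner_integral (gauss 0 \<sigma>) (\<lambda>x. 1) (1 :: real)"
    using int[of 2] int[of 4] c[of 1] m0 m2 m4 by (simp_all add: has_bochner_integral_iff)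
  have "has_bochner_integral (gauss 0 \<sigma>) (\<lambda>x. x\<^sup>2 - \<sigma>\<^sup>2 * 1) (\<sigma>\<^sup>2 - \<sigma>\<^sup>2 * 1)"
    by (intro has_bochner_integral_diff has_bochner_integral_mult_right h)
  then have g2: "integrable (gauss 0 \<sigma>) (\<lambda>x. x\<^sup>2 - \<sigma>\<^sup>2)" "(\<integral>x. x\<^sup>2 - \<sigma>\<^sup>2 \<partial>gauss 0 \<sigma>) = 0"
    by (simp_all add: has_bochner_integral_iff)
  have "has_bochner_integral (gauss 0 \<sigma>) (\<lambda>x. x ^ 4 - 2 * \<sigma>\<^sup>2 * x\<^sup>2 + \<sigma> ^ 4 * 1)
      (3 * \<sigma> ^ 4 - 2 * \<sigma>\<^sup>2 * \<sigma>\<^sup>2 + \<sigma> ^ 4 * 1)"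
    by (intro has_bochner_integral_add has_bochner_integral_diff has_bochner_integral_mult_right h)
  moreover have "3 * \<sigma> ^ 4 - 2 * \<sigma>\<^sup>2 * \<sigma>\<^sup>2 + \<sigma> ^ 4 * 1 = 2 * \<sigma> ^ 4"
    by (simp add: power2_eq_square power4_eq_xxxx)
  ultimately have g4: "integrable (gauss 0 \<sigma>) (\<lambda>x. x ^ 4 - 2 * \<sigma>\<^sup>2 * x\<^sup>2 + \<sigma> ^ 4)"
    "(\<integral>x. x ^ 4 - 2 * \<sigma>\<^sup>2 * x\<^sup>2 + \<sigma> ^ 4 \<partial>gauss 0 \<sigma>) = 2 * \<sigma> ^ 4"
    by (simp_all add: has_bochner_integral_iff)
  have iv: "integrable M (v i)" "integrable M (\<lambda>\<omega>. (v i \<omega>)\<^sup>2)" if "i \<in> I" for i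
    unfolding v_def sq
    using tr(1)[OF that, of "\<lambda>x. x\<^sup>2 - \<sigma>\<^sup>2"] tr(1)[OF that, of "\<lambda>x. x ^ 4 - 2 * \<sigma>\<^sup>2 * x\<^sup>2 + \<sigma> ^ 4"] g2(1) g4(1)
    by auto
  have ev: "expectation (v i) = 0" "expectation (\<lambda>\<omega>. (v i \<omega>)\<^sup>2) = 2 * \<sigma> ^ 4" if "i \<in> I" for i
    unfolding v_def sq
    using tr(2)[OF that, of "\<lambda>x. x\<^sup>2 - \<sigma>\<^sup>2"] tr(2)[OF that, of "\<lambda>x. x ^ 4 - 2 * \<sigma>\<^sup>2 * x\<^sup>2 + \<sigma> ^ 4"] g2(2) g4(2)
    by auto
  have main: "integrable M (\<lambda>\<omega>. (\<Sum>i\<in>I'. v i \<omega>)\<^sup>2) \<and> expectation (\<lambda>\<omega>. (\<Sum>i\<in>I'. v i \<omega>)\<^sup>2) = 2 * \<sigma> ^ 4 * card I'"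
    if "finite I'" "I' \<subseteq> I" for I'
    using that
  proof (induction I')
    case (insert x F)
    let ?S = "\<lambda>\<omega>. \<Sum>i\<in>F. v i \<omega>"
    have x: "x \<in> I" "F \<subseteq> I" using insert by auto
    have ind: "indep_var borel (v x) borel ?S"
      by (rule indep_vars_sum) (use insert indep_vars_subset[OF indv] in auto)
    have S: "integrable M ?S" "expectation ?S = 0"
      using x iv ev by (auto intro!: Bochner_Integration.integrable_sum simp: subset_iff Bochner_Integration.integral_sum)
    have prd: "integrable M (\<lambda>\<omega>. v x \<omega> * ?S \<omega>)" "expectation (\<lambda>\<omega>. v x \<omega> * ?S \<omega>) = 0"
      using indep_var_integrable[OF ind] indep_var_lebesgue_integral[OF ind] x iv S ev by auto
    have e: "(\<Sum>i\<in>insert x F. v i \<omega>)\<^sup>2 = (v x \<omega>)\<^sup>2 + 2 * (v x \<omega> * ?S \<omega>) + (?S \<omega>)\<^sup>2" for \<omega>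
      using insert by (simp add: power2_eq_square algebra_simps)
    show ?case unfolding e using insert x iv ev prd by (auto simp: algebra_simps)
  qed simp
  have sum_v: "(\<Sum>i\<in>I. v i \<omega>) = (\<Sum>i\<in>I. (u i \<omega>)\<^sup>2) - card I * \<sigma>\<^sup>2" for \<omega>
    by (simp add: v_def sum_subtractf)
  have "prob {\<omega>\<in>space M. \<eta> \<le> \<bar>\<Sum>i\<in>I. v i \<omega>\<bar>} \<le> expectation (\<lambda>\<omega>. (\<Sum>i\<in>I. v i \<omega>)\<^sup>2) / \<eta>\<^sup>2"
    by (rule second_moment_method) (use main[OF I] eta in auto)
  then show ?thesis using main[OF I] by (simp add: sum_v)
qed

subsection \<open>A rigidity property of local means\<close>

lemma borel_measurable_of_bool[measurable (raw)]:
  "Measurable.pred M Q \<Longrightarrow> (\<lambda>x. of_bool (Q x) :: real) \<in> borel_measurable M"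
  unfolding of_bool_def by measurable

lemma (in prob_space) prob_Collect_eq_expectation:
  "Measurable.pred M Q \<Longrightarrow> prob {x\<in>space M. Q x} = expectation (\<lambda>x. of_bool (Q x))"
proof -
  assume [measurable]: "Measurable.pred M Q"
  have "expectation (\<lambda>x. of_bool (Q x)) = (expectation (indicator {x\<in>space M. Q x}) :: real)"
    by (rule Bochner_Integration.integral_cong) (auto simp: indicator_def)
  then show ?thesis by simp
qed

lemma (in prob_space) integrable_of_bool[simp]:
  "Measurable.pred M Q \<Longrightarrow> integrable M (\<lambda>x. of_bool (Q x) :: real)"
  by (rule integrable_const_bound[where B=1]) auto

lemma AE_gauss_iff:
  assumes "0 < \<sigma>"
  shows "(AE x in gauss \<mu> \<sigma>. Q x) \<longleftrightarrow> (AE x in lborel. Q x)"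
  using assms by (subst AE_density) (auto simp: normal_density_pos)

lemma AE_lborel_ex_interval:
  fixes a b :: real
  assumes "AE x in lborel. Q x" "a < b"
  shows "\<exists>x. a < x \<and> x < b \<and> Q x"
proof (rule ccontr)
  assume "\<not> ?thesis"
  then have "AE x in lborel. x \<notin> {a<..<b}"
    using assms(1) by (auto elim!: eventually_mono)
  then have "emeasure lborel {a<..<b} = 0"
    by (subst (asm) AE_iff_measurable[of "{a<..<b}"]) auto
  then show False using assms(2) by simp
qed

lemma measure_gauss_interval_pos:
  assumes "0 < \<sigma>" "a < b"
  shows "0 < measure (gauss \<mu> \<sigma>) {a<..<b}"
proof -
  interpret prob_space "gauss \<mu> \<sigma>" using assms by (intro prob_space_normal_density)
  have "measure (gauss \<mu> \<sigma>) {a<..<b} \<noteq> 0"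
  proof
    assume "measure (gauss \<mu> \<sigma>) {a<..<b} = 0"
    then have "AE x in gauss \<mu> \<sigma>. x \<notin> {a<..<b}"
      by (intro AE_not_in null_setsI) (auto simp: emeasure_eq_measure)
    then have "AE x in lborel. x \<notin> {a<..<b}" using assms by (simp add: AE_gauss_iff)
    from AE_lborel_ex_interval[OF this assms(2)] show False by auto
  qed
  then show ?thesis using measure_nonneg[of "gauss \<mu> \<sigma>" "{a<..<b}"] by linarith
qed

lemma distr_gauss_uminus: "0 < \<sigma> \<Longrightarrow> distr (gauss 0 \<sigma>) borel uminus = gauss 0 \<sigma>"
  using distr_gauss_affine[of \<sigma> "-1" 0 0] by simp

text \<open>The interval around \<open>x0\<close> on which \<open>f\<close> equals
  \<open>f x0\<close> almost everywhere grows by \<open>r / 2\<close> at each step: good points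
  within \<open>r / 2\<close> of either end carry the value across that end. Countably many steps
  cover the line.\<close>

lemma AE_locally_const_imp_const:
  fixes f :: "real \<Rightarrow> real"
  assumes r: "0 < r" and loc: "AE x in lborel. AE z in lborel. \<bar>x - z\<bar> < r \<longrightarrow> f z = f x"
  shows "\<exists>v. AE z in lborel. f z = v"
proof -
  obtain x0 where x0: "AE z in lborel. \<bar>x0 - z\<bar> < r \<longrightarrow> f z = f x0"
    using AE_lborel_ex_interval[OF loc, of 0 1] by auto
  have grow: "AE z in lborel. \<bar>x0 - z\<bar> < r + real m * (r / 2) \<longrightarrow> f z = f x0" for m
  proof (induction m)
    case 0
    show ?case using x0 by simp
  next
    case (Suc m)
    define \<rho> where "\<rho> = r + real m * (r / 2)"
    have \<rho>: "r \<le> \<rho>" using r by (simp add: \<rho>_def)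
    have both: "AE x in lborel. (\<bar>x0 - x\<bar> < \<rho> \<longrightarrow> f x = f x0) \<and> (AE z in lborel. \<bar>x - z\<bar> < r \<longrightarrow> f z = f x)"
      using Suc loc by (simp add: \<rho>_def)
    obtain x1 where x1: "x0 + \<rho> - r / 2 < x1" "x1 < x0 + \<rho>"
      "\<bar>x0 - x1\<bar> < \<rho> \<longrightarrow> f x1 = f x0" "AE z in lborel. \<bar>x1 - z\<bar> < r \<longrightarrow> f z = f x1"
      using AE_lborel_ex_interval[OF both, of "x0 + \<rho> - r / 2" "x0 + \<rho>"] r by auto
    obtain x2 where x2: "x0 - \<rho> < x2" "x2 < x0 - \<rho> + r / 2"
      "\<bar>x0 - x2\<bar> < \<rho> \<longrightarrow> f x2 = f x0" "AE z in lborel. \<bar>x2 - z\<bar> < r \<longrightarrow> f z = f x2"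
      using AE_lborel_ex_interval[OF both, of "x0 - \<rho>" "x0 - \<rho> + r / 2"] r by auto
    have fx: "f x1 = f x0" "f x2 = f x0" using x1 x2 \<rho> r by auto
    show ?case using Suc x1(4) x2(4)
    proof eventually_elim
      case (elim z)
      show ?case
      proof
        assume "\<bar>x0 - z\<bar> < r + real (Suc m) * (r / 2)"
        moreover have "r + real (Suc m) * (r / 2) = \<rho> + r / 2" by (simp add: \<rho>_def field_simps)
        ultimately have z: "\<bar>x0 - z\<bar> < \<rho> + r / 2" by simp
        from z consider "\<bar>x0 - z\<bar> < \<rho>" | "\<bar>x1 - z\<bar> < r" | "\<bar>x2 - z\<bar> < r"
          using x1(1,2) x2(1,2) by linarith
        then show "f z = f x0" using elim fx by cases (auto simp: \<rho>_def)
      qed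
    qed
  qed
  have "AE z in lborel. \<forall>m. \<bar>x0 - z\<bar> < r + real m * (r / 2) \<longrightarrow> f z = f x0"
    by (subst AE_all_countable) (use grow in auto)
  then have "AE z in lborel. f z = f x0"
  proof eventually_elim
    case (elim z)
    obtain m :: nat where "\<bar>x0 - z\<bar> / (r / 2) < real m" using reals_Archimedean2 by blast
    then have "\<bar>x0 - z\<bar> < r + real m * (r / 2)" using r by (simp add: field_simps)
    then show ?case using elim by auto
  qed
  then show ?thesis by auto
qed

text \<open>
  The integral of \<open>f D\<close>, where \<open>D\<close> denotes the left hand side of the hypothesis \<open>mean\<close>, is half of a
  Dirichlet form.
\<close>
lemma AE_const_if_mean_value:
  fixes f :: "real \<Rightarrow> real"
  assumes \<sigma>: "0 < \<sigma>" and r: "0 < r" and [measurable]: "f \<in> borel_measurable borel"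
    and bnd: "\<And>x. \<bar>f x\<bar> \<le> 1"
    and mean: "AE x in lborel. (\<integral>z. of_bool (\<bar>x - z\<bar> < r) * (f x - f z) \<partial>gauss 0 \<sigma>) = 0"
  shows "\<exists>v. AE z in lborel. f z = v"
proof -
  let ?g = "gauss 0 \<sigma>"
  interpret g: prob_space ?g using \<sigma> by (rule prob_space_normal_density)
  interpret gg: pair_prob_space ?g ?g ..
  have fb: "\<bar>f x - f z\<bar> \<le> 2" for x z using bnd[of x] bnd[of z] by linarith
  define h where "h = (\<lambda>x z. of_bool (\<bar>x - z\<bar> < r) * (f x - f z) * f x)"
  have [measurable]: "case_prod h \<in> borel_measurable (?g \<Otimes>\<^sub>M ?g)"
    unfolding h_def by measurable
  have hb: "\<bar>h x z\<bar> \<le> 2" for x z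
    unfolding h_def using mult_mono[OF fb[of x z] bnd[of x]] by (auto simp: abs_mult)
  have inth: "integrable (?g \<Otimes>\<^sub>M ?g) (case_prod h)"
    by (rule gg.P.integrable_const_bound[where B=2]) (auto simp: hb)
  have [measurable]: "(\<lambda>(x, z). h z x) \<in> borel_measurable (?g \<Otimes>\<^sub>M ?g)"
    unfolding h_def by measurable
  have inth': "integrable (?g \<Otimes>\<^sub>M ?g) (\<lambda>(x, z). h z x)"
    by (rule gg.P.integrable_const_bound[where B=2]) (auto simp: hb)
  have meang: "AE x in ?g. (\<integral>z. h x z \<partial>?g) = 0"
  proof -
    have "AE x in ?g. (\<integral>z. of_bool (\<bar>x - z\<bar> < r) * (f x - f z) \<partial>?g) = 0"
      using mean \<sigma> by (simp add: AE_gauss_iff)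
    then show ?thesis
    proof eventually_elim
      case (elim x)
      have "(\<integral>z. h x z \<partial>?g) = (\<integral>z. of_bool (\<bar>x - z\<bar> < r) * (f x - f z) \<partial>?g) * f x"
        unfolding h_def by (rule integral_mult_left_zero)
      then show ?case using elim by simp
    qed
  qed
  have "(\<integral>x. (\<integral>z. h x z \<partial>?g) \<partial>?g) = 0"
    using meang by (subst integral_cong_AE[where g="\<lambda>_. 0"]) auto
  then have h0: "integral\<^sup>L (?g \<Otimes>\<^sub>M ?g) (case_prod h) = 0"
    using gg.integral_fst'[OF inth] by simp
  have "(\<integral>z. (\<integral>x. h z x \<partial>?g) \<partial>?g) = 0"
    using meang by (subst integral_cong_AE[where g="\<lambda>_. 0"]) auto
  then have h0': "integral\<^sup>L (?g \<Otimes>\<^sub>M ?g) (\<lambda>(x, z). h z x) = 0"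
    using gg.integral_snd[OF inth'] by simp
  \<comment> \<open>Symmetrising in \<open>x\<close> and \<open>z\<close> produces a square. Both
    orders integrate to 0 by \<open>mean\<close>, so the nonnegative sum vanishes almost
    everywhere.\<close>
  have e: "h x z + h z x = of_bool (\<bar>x - z\<bar> < r) * (f x - f z)\<^sup>2" for x z
    by (auto simp: h_def power2_eq_square algebra_simps abs_minus_commute)
  have "integral\<^sup>L (?g \<Otimes>\<^sub>M ?g) (\<lambda>(x, z). of_bool (\<bar>x - z\<bar> < r) * (f x - f z)\<^sup>2) =
    integral\<^sup>L (?g \<Otimes>\<^sub>M ?g) (\<lambda>p. case_prod h p + (\<lambda>(x, z). h z x) p)"
    by (rule Bochner_Integration.integral_cong) (auto simp: e)
  also have "\<dots> = 0"
    using inth inth' h0 h0' by (subst Bochner_Integration.integral_add) auto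
  finally have I0: "integral\<^sup>L (?g \<Otimes>\<^sub>M ?g) (\<lambda>(x, z). of_bool (\<bar>x - z\<bar> < r) * (f x - f z)\<^sup>2) = 0" .
  have intq: "integrable (?g \<Otimes>\<^sub>M ?g) (\<lambda>(x, z). of_bool (\<bar>x - z\<bar> < r) * (f x - f z)\<^sup>2)"
    using Bochner_Integration.integrable_add[OF inth inth'] by (simp add: split_beta' e)
  have "AE p in ?g \<Otimes>\<^sub>M ?g. (\<lambda>(x, z). of_bool (\<bar>x - z\<bar> < r) * (f x - f z)\<^sup>2) p = 0"
    using I0 by (subst (asm) integral_nonneg_eq_0_iff_AE[OF intq]) auto
  then have "AE p in ?g \<Otimes>\<^sub>M ?g. (\<lambda>(x, z). \<bar>x - z\<bar> < r \<longrightarrow> f z = f x) p"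
    by eventually_elim auto
  then have "AE x in ?g. AE z in ?g. \<bar>x - z\<bar> < r \<longrightarrow> f z = f x"
    using gg.AE_pair by fastforce
  then have "AE x in lborel. AE z in lborel. \<bar>x - z\<bar> < r \<longrightarrow> f z = f x"
    using \<sigma> by (simp add: AE_gauss_iff)
  from AE_locally_const_imp_const[OF r this] show ?thesis .
qed

subsection \<open>The limit experiment\<close>

lemma product_prob_space_gauss: "0 < \<sigma> \<Longrightarrow> product_prob_space (\<lambda>_. gauss \<mu> \<sigma>)"
  by (intro product_prob_spaceI prob_space_normal_density)

text \<open>
  Coordinates are numbered from 0, so that the order \<open>p\<close> is tested with the coordinate \<open>p - 1\<close>, and
  \<open>q\<close> is \<open>q\<^sup>* - 1\<close>; \<open>d j\<close> is the critical value \<open>c\<^sub>p\<close> for \<open>p = j + 1\<close>. The event \<open>rejects\<close> means that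
  an order above \<open>q\<close> is selected, and \<open>full\<close> and \<open>part\<close> describe the event that the scaled error is
  at most \<open>t\<close> if the selected order is above \<open>q\<close> or equal to \<open>q\<close>, respectively.
\<close>
locale limit_experiment =
  fixes P q k :: nat and \<sigma> :: real and B :: "nat \<Rightarrow> nat \<Rightarrow> real" and d t :: "nat \<Rightarrow> real"
  assumes \<sigma>: "0 < \<sigma>" and qP: "q < P"
    and d: "\<And>j. q \<le> j \<Longrightarrow> j < P \<Longrightarrow> 0 < d j"
    and Bq: "\<exists>i<k. B i q \<noteq> 0"
    and surj: "\<And>s. \<exists>w. \<forall>i<k. (\<Sum>j<Suc q. B i j * w j) = s i"
begin

definition rejects :: "real \<Rightarrow> (nat \<Rightarrow> real) \<Rightarrow> bool" where
  "rejects x w \<longleftrightarrow> d q * \<sigma> \<le> \<bar>w q + x\<bar> \<or> (\<exists>j\<in>{q<..<P}. d j * \<sigma> \<le> \<bar>w j\<bar>)"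

text \<open>The sum stops at \<open>q\<close> whichever order above \<open>q\<close> is selected: by
  maximality of \<open>q\<^sup>*\<close> the limit coefficients vanish in the later columns.\<close>

definition full :: "(nat \<Rightarrow> real) \<Rightarrow> bool" where
  "full w \<longleftrightarrow> (\<forall>i\<in>{..<k}. (\<Sum>j<Suc q. B i j * w j) \<le> t i)"

text \<open>Order \<open>q\<close> estimates the coordinate \<open>q\<close>, whose mean is
  \<open>x\<close>, by 0, so its error is the constant \<open>- x\<close>.\<close>

definition part :: "real \<Rightarrow> (nat \<Rightarrow> real) \<Rightarrow> bool" where
  "part x w \<longleftrightarrow> (\<forall>i\<in>{..<k}. (\<Sum>j<q. B i j * w j) - B i q * x \<le> t i)"

abbreviation "noise \<equiv> PiM {..<P} (\<lambda>_. gauss 0 \<sigma>)"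

definition limit_prob :: "real \<Rightarrow> real" where
  "limit_prob x = measure noise {w\<in>space noise. if rejects x w then full w else part x w}"

definition full_prob :: real where
  "full_prob = measure noise {w\<in>space noise. full w}"

text \<open>This is the function \<open>f\<close> of the Dirichlet form. After the coordinates below
  \<open>q\<close> are integrated out, \<open>part x\<close> has probability
  \<open>sub_prob x\<close>, and \<open>full\<close> has probability \<open>sub_prob z\<close> given
  \<open>w q = - z\<close>. Writing it as an integral gives measurability in \<open>x\<close>
  directly.\<close>

definition sub_prob :: "real \<Rightarrow> real" where
  "sub_prob x = (\<integral>v. of_bool (\<forall>i\<in>{..<k}. (\<Sum>j<q. B i j * v j) \<le> t i + B i q * x) \<partial>PiM {..<q} (\<lambda>_. gauss 0 \<sigma>))"

lemma prob_space_noise: "prob_space (PiM I (\<lambda>_. gauss 0 \<sigma>))"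
  by (intro prob_space_PiM prob_space_normal_density \<sigma>)

lemma component_measurable[measurable (raw)]: "j \<in> I \<Longrightarrow> (\<lambda>w. w j) \<in> borel_measurable (PiM I (\<lambda>_. gauss 0 \<sigma>))"
  using measurable_component_singleton[of j I "\<lambda>_. gauss 0 \<sigma>"] by (simp cong: measurable_cong_sets)

lemma measurable_events[measurable]:
  "Measurable.pred noise (rejects x)" "Measurable.pred noise full" "Measurable.pred noise (part x)"
proof -
  have [measurable]: "(\<lambda>w. \<Sum>j<m. B i j * w j) \<in> borel_measurable noise" if "m \<le> P" for m i
    using that by (intro borel_measurable_sum borel_measurable_times) auto
  have q: "Suc q \<le> P" "q \<le> P" "q \<in> {..<P}" using qP by auto
  note [measurable] = q
  show "Measurable.pred noise (rejects x)"
    unfolding rejects_def using q by measurable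
  show "Measurable.pred noise full" unfolding full_def using q by measurable
  show "Measurable.pred noise (part x)" unfolding part_def using q by measurable
qed

lemma sub_prob_measurable[measurable]: "sub_prob \<in> borel_measurable borel"
proof -
  interpret prob_space "PiM {..<q} (\<lambda>_. gauss 0 \<sigma>)" by (rule prob_space_noise)
  have [measurable]: "(\<lambda>w. w j) \<in> borel_measurable (PiM {..<q} (\<lambda>_. gauss 0 \<sigma>))" if "j \<in> {..<q}" for j
    using that by (rule component_measurable)
  show ?thesis unfolding sub_prob_def by measurable
qed

lemma sub_prob_eq:
  "sub_prob x = measure (PiM {..<q} (\<lambda>_. gauss 0 \<sigma>))
     {v\<in>space (PiM {..<q} (\<lambda>_. gauss 0 \<sigma>)). \<forall>i\<in>{..<k}. (\<Sum>j<q. B i j * v j) \<le> t i + B i q * x}"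
proof -
  interpret prob_space "PiM {..<q} (\<lambda>_. gauss 0 \<sigma>)" by (rule prob_space_noise)
  show ?thesis unfolding sub_prob_def by (rule prob_Collect_eq_expectation[symmetric]) measurable
qed

lemma sub_prob_bounds: "0 \<le> sub_prob x" "sub_prob x \<le> 1"
  using prob_space.prob_le_1[OF prob_space_noise] by (auto simp: sub_prob_eq)

text \<open>The two events agree where \<open>rejects\<close> holds, so only acceptance contributes.
  Fubini then separates the coordinates: those below \<open>q\<close> turn the events into values of
  \<open>sub_prob\<close>, the coordinate \<open>q\<close> gives the integral over \<open>z\<close>,
  and those above \<open>q\<close> give the constant factor.\<close>

lemma limit_prob_minus_full_prob:
  "limit_prob x - full_prob =
    measure (PiM {q<..<P} (\<lambda>_. gauss 0 \<sigma>)) {y\<in>space (PiM {q<..<P} (\<lambda>_. gauss 0 \<sigma>)). \<forall>j\<in>{q<..<P}. \<bar>y j\<bar> < d j * \<sigma>} *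
    (\<integral>z. of_bool (\<bar>x - z\<bar> < d q * \<sigma>) * (sub_prob x - sub_prob z) \<partial>gauss 0 \<sigma>)"
proof -
  let ?M = "\<lambda>_::nat. gauss 0 \<sigma>"
  have pp: "product_sigma_finite ?M"
    using \<sigma> by (intro product_prob_space.axioms(1) product_prob_space_gauss)
  interpret N: prob_space noise by (rule prob_space_noise)
  interpret g: prob_space "gauss 0 \<sigma>" using \<sigma> by (rule prob_space_normal_density)
  interpret Q: prob_space "PiM {..<q} ?M" by (rule prob_space_noise)
  interpret R: prob_space "PiM {q<..<P} ?M" by (rule prob_space_noise)
  define h :: "(nat \<Rightarrow> real) \<Rightarrow> real" where "h = (\<lambda>w. of_bool (\<not> rejects x w) * (of_bool (part x w) - of_bool (full w)))"
  have [measurable]: "h \<in> borel_measurable noise" unfolding h_def by measurable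
  have inth: "integrable noise h"
    by (rule N.integrable_const_bound[where B=1]) (auto simp: h_def)
  have "limit_prob x - full_prob = N.expectation (\<lambda>w. of_bool (if rejects x w then full w else part x w)) - N.expectation (\<lambda>w. of_bool (full w))"
    unfolding limit_prob_def full_prob_def by (simp add: N.prob_Collect_eq_expectation)
  also have "\<dots> = N.expectation (\<lambda>w. of_bool (if rejects x w then full w else part x w) - of_bool (full w))"
    by (subst Bochner_Integration.integral_diff) auto
  also have "\<dots> = N.expectation h"
    by (rule Bochner_Integration.integral_cong) (auto simp: h_def)
  also have "\<dots> = (\<integral>y. \<integral>v. h (merge {q..<P} {..<q} (y, v)) \<partial>PiM {..<q} ?M \<partial>PiM {q..<P} ?M)"
  proof -
    have e: "{..<P} = {q..<P} \<union> {..<q}" using qP by auto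
    show ?thesis using inth unfolding e
      by (subst product_sigma_finite.product_integral_fold[OF pp]) auto
  qed
  also have "\<dots> = (\<integral>y. of_bool (\<not> rejects x y) * (sub_prob x - sub_prob (- y q)) \<partial>PiM {q..<P} ?M)"
  proof (rule Bochner_Integration.integral_cong[OF refl])
    fix y assume "y \<in> space (PiM {q..<P} ?M)"
    have rj: "rejects x (merge {q..<P} {..<q} (y, v)) = rejects x y" for v
      using qP by (auto simp: rejects_def merge_def)
    have pt: "part x (merge {q..<P} {..<q} (y, v)) \<longleftrightarrow> (\<forall>i\<in>{..<k}. (\<Sum>j<q. B i j * v j) \<le> t i + B i q * x)" for v
      by (simp add: part_def merge_def le_diff_eq diff_le_eq)
    have fl: "full (merge {q..<P} {..<q} (y, v)) \<longleftrightarrow> (\<forall>i\<in>{..<k}. (\<Sum>j<q. B i j * v j) \<le> t i + B i q * (- y q))" for v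
      using qP by (simp add: full_def merge_def le_diff_eq)
    have "(\<integral>v. h (merge {q..<P} {..<q} (y, v)) \<partial>PiM {..<q} ?M) =
       (\<integral>v. of_bool (\<not> rejects x y) * (of_bool (\<forall>i\<in>{..<k}. (\<Sum>j<q. B i j * v j) \<le> t i + B i q * x)
           - of_bool (\<forall>i\<in>{..<k}. (\<Sum>j<q. B i j * v j) \<le> t i + B i q * (- y q))) \<partial>PiM {..<q} ?M)"
      unfolding h_def rj pt fl ..
    also have "\<dots> = of_bool (\<not> rejects x y) * (sub_prob x - sub_prob (- y q))"
      unfolding sub_prob_def integral_mult_right_zero
      by (subst Bochner_Integration.integral_diff) (auto intro!: Q.integrable_of_bool)
    finally show "(\<integral>v. h (merge {q..<P} {..<q} (y, v)) \<partial>PiM {..<q} ?M) =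
      of_bool (\<not> rejects x y) * (sub_prob x - sub_prob (- y q))" .
  qed
  also have "\<dots> = (\<integral>y. \<integral>z. of_bool (\<not> rejects x (y(q:=z))) * (sub_prob x - sub_prob (- z)) \<partial>gauss 0 \<sigma> \<partial>PiM {q<..<P} ?M)"
  proof -
    interpret Q': prob_space "PiM (insert q {q<..<P}) ?M" by (rule prob_space_noise)
    have e: "{q..<P} = insert q {q<..<P}" using qP by auto
    have b: "\<bar>sub_prob x - sub_prob z\<bar> \<le> 1" for z
      using sub_prob_bounds[of x] sub_prob_bounds[of z] by linarith
    have "integrable (PiM (insert q {q<..<P}) ?M) (\<lambda>y. of_bool (\<not> rejects x y) * (sub_prob x - sub_prob (- y q)))"
      unfolding rejects_def
      by (rule Q'.integrable_const_bound[where B=1]) (use b in auto)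
    then show ?thesis unfolding e
      by (subst product_sigma_finite.product_integral_insert[OF pp]) auto
  qed
  also have "\<dots> = (\<integral>y. of_bool (\<forall>j\<in>{q<..<P}. \<bar>y j\<bar> < d j * \<sigma>) *
      (\<integral>z. of_bool (\<bar>z + x\<bar> < d q * \<sigma>) * (sub_prob x - sub_prob (- z)) \<partial>gauss 0 \<sigma>) \<partial>PiM {q<..<P} ?M)"
  proof (rule Bochner_Integration.integral_cong[OF refl])
    fix y :: "nat \<Rightarrow> real"
    have "of_bool (\<not> rejects x (y(q:=z))) = (of_bool (\<forall>j\<in>{q<..<P}. \<bar>y j\<bar> < d j * \<sigma>) * of_bool (\<bar>z + x\<bar> < d q * \<sigma>) :: real)" for z
      by (auto simp: rejects_def not_le)
    then show "(\<integral>z. of_bool (\<not> rejects x (y(q:=z))) * (sub_prob x - sub_prob (- z)) \<partial>gauss 0 \<sigma>) =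
       of_bool (\<forall>j\<in>{q<..<P}. \<bar>y j\<bar> < d j * \<sigma>) *
      (\<integral>z. of_bool (\<bar>z + x\<bar> < d q * \<sigma>) * (sub_prob x - sub_prob (- z)) \<partial>gauss 0 \<sigma>)"
      by (simp add: mult.assoc)
  qed
  also have "\<dots> = R.expectation (\<lambda>y. of_bool (\<forall>j\<in>{q<..<P}. \<bar>y j\<bar> < d j * \<sigma>)) *
      (\<integral>z. of_bool (\<bar>z + x\<bar> < d q * \<sigma>) * (sub_prob x - sub_prob (- z)) \<partial>gauss 0 \<sigma>)"
    by (rule integral_mult_left_zero)
  also have "R.expectation (\<lambda>y. of_bool (\<forall>j\<in>{q<..<P}. \<bar>y j\<bar> < d j * \<sigma>)) =
      measure (PiM {q<..<P} ?M) {y\<in>space (PiM {q<..<P} ?M). \<forall>j\<in>{q<..<P}. \<bar>y j\<bar> < d j * \<sigma>}"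
    by (rule R.prob_Collect_eq_expectation[symmetric]) measurable
  \<comment> \<open>The centred normal law is symmetric, so \<open>z\<close> may be replaced by
    \<open>- z\<close>.\<close>
  also have "(\<integral>z. of_bool (\<bar>z + x\<bar> < d q * \<sigma>) * (sub_prob x - sub_prob (- z)) \<partial>gauss 0 \<sigma>) =
     (\<integral>z. of_bool (\<bar>x - z\<bar> < d q * \<sigma>) * (sub_prob x - sub_prob z) \<partial>distr (gauss 0 \<sigma>) borel uminus)"
    by (subst integral_distr) (auto simp: add.commute)
  also have "\<dots> = (\<integral>z. of_bool (\<bar>x - z\<bar> < d q * \<sigma>) * (sub_prob x - sub_prob z) \<partial>gauss 0 \<sigma>)"
    unfolding distr_gauss_uminus[OF \<sigma>] ..
  finally show ?thesis .
qed

lemma measure_box_pos: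
  assumes "finite I" "\<And>j. j \<in> I \<Longrightarrow> a j < b j"
  shows "0 < measure (PiM I (\<lambda>_. gauss 0 \<sigma>)) (PiE I (\<lambda>j. {a j<..<b j}))"
proof -
  interpret finite_product_prob_space "\<lambda>_. gauss 0 \<sigma>" I
    by (intro finite_product_prob_space.intro product_prob_space_gauss \<sigma> finite_product_sigma_finite.intro
      finite_product_sigma_finite_axioms.intro assms product_prob_space.axioms(1))
  have "prob (PiE I (\<lambda>j. {a j<..<b j})) = (\<Prod>j\<in>I. measure (gauss 0 \<sigma>) {a j<..<b j})"
    by (rule prob_times) auto
  also have "\<dots> > 0"
    by (intro prod_pos measure_gauss_interval_pos \<sigma> ballI assms)
  finally show ?thesis .
qed

text \<open>By \<open>surj\<close> some \<open>w\<close> puts every linear form at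
  \<open>t i - 1\<close>. A small box around \<open>w\<close> stays below \<open>t i\<close>, and
  its side in direction \<open>q\<close> becomes the interval of values \<open>- x\<close>.\<close>

lemma sub_prob_ge_on_interval:
  obtains a b e where "a < b" "0 < e" "\<And>x. a < x \<Longrightarrow> x < b \<Longrightarrow> e \<le> sub_prob x"
proof -
  obtain w where w: "\<And>i. i < k \<Longrightarrow> (\<Sum>j<Suc q. B i j * w j) = t i - 1"
    using surj[of "\<lambda>i. t i - 1"] by blast
  define S where "S = (\<Sum>i<k. \<Sum>j<Suc q. \<bar>B i j\<bar>)"
  have S: "0 \<le> S" "\<And>i. i < k \<Longrightarrow> (\<Sum>j<Suc q. \<bar>B i j\<bar>) \<le> S"
    unfolding S_def by (auto intro!: sum_nonneg member_le_sum simp del: sum.lessThan_Suc)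
  \<comment> \<open>Moving every coordinate by at most \<open>\<epsilon>\<close> changes a form by
    at most \<open>S * \<epsilon>\<close>, which must not exceed the margin 1.\<close>
  define \<epsilon> where "\<epsilon> = 1 / (1 + S)"
  have \<epsilon>: "0 < \<epsilon>" "S * \<epsilon> \<le> 1" using S(1) by (auto simp: \<epsilon>_def field_simps)
  let ?M = "PiM {..<q} (\<lambda>_. gauss 0 \<sigma>)"
  let ?box = "PiE {..<q} (\<lambda>j. {w j - \<epsilon><..<w j + \<epsilon>})"
  interpret prob_space ?M by (rule prob_space_noise)
  have "measure ?M ?box \<le> sub_prob x" if x: "- w q - \<epsilon> < x" "x < - w q + \<epsilon>" for x
    unfolding sub_prob_eq
  proof (rule finite_measure_mono)
    show "?box \<subseteq> {v \<in> space ?M. \<forall>i\<in>{..<k}. (\<Sum>j<q. B i j * v j) \<le> t i + B i q * x}"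
    proof safe
      fix v assume v: "v \<in> ?box"
      then show "v \<in> space ?M" by (auto simp: space_PiM)
      fix i assume i: "i < k"
      define v' where "v' = v(q := - x)"
      have v': "\<bar>v' j - w j\<bar> \<le> \<epsilon>" if "j < Suc q" for j
      proof (cases "j = q")
        case True
        then show ?thesis using x by (simp add: v'_def abs_le_iff)
      next
        case False
        then have "j < q" using that by simp
        then have "v j \<in> {w j - \<epsilon><..<w j + \<epsilon>}" using v by (auto simp: PiE_iff)
        then show ?thesis using False by (simp add: v'_def abs_le_iff)
      qed
      have "(\<Sum>j<Suc q. B i j * v' j) - (\<Sum>j<Suc q. B i j * w j) = (\<Sum>j<Suc q. B i j * (v' j - w j))"
        by (simp only: right_diff_distrib sum_subtractf)
      also have "\<dots> \<le> (\<Sum>j<Suc q. \<bar>B i j\<bar> * \<epsilon>)"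
      proof (rule sum_mono)
        fix j assume "j \<in> {..<Suc q}"
        then have "\<bar>B i j * (v' j - w j)\<bar> \<le> \<bar>B i j\<bar> * \<epsilon>"
          using v'[of j] by (simp add: abs_mult mult_left_mono)
        then show "B i j * (v' j - w j) \<le> \<bar>B i j\<bar> * \<epsilon>" by linarith
      qed
      also have "\<dots> = (\<Sum>j<Suc q. \<bar>B i j\<bar>) * \<epsilon>" by (rule sum_distrib_right[symmetric])
      also have "\<dots> \<le> S * \<epsilon>" using S(2)[OF i] \<epsilon>(1) by (intro mult_right_mono) auto
      also have "\<dots> \<le> 1" by (rule \<epsilon>(2))
      finally have "(\<Sum>j<Suc q. B i j * v' j) \<le> t i" using w[OF i] by simp
      moreover have "(\<Sum>j<Suc q. B i j * v' j) = (\<Sum>j<q. B i j * v j) - B i q * x"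
        by (simp add: v'_def)
      ultimately show "(\<Sum>j<q. B i j * v j) \<le> t i + B i q * x" by simp
    qed
  qed measurable
  moreover have "0 < measure ?M ?box"
    by (rule measure_box_pos) (use \<epsilon> in auto)
  ultimately show thesis
    using \<epsilon>(1) by (intro that[of "- w q - \<epsilon>" "- w q + \<epsilon>" "measure ?M ?box"]) auto
qed

text \<open>Some row has \<open>B i q \<noteq> 0\<close>. Moving \<open>x\<close> far in the
  direction that tightens this one constraint makes its probability arbitrarily small.\<close>

lemma sub_prob_small_on_interval:
  assumes "0 < e"
  obtains a b where "a < b" "\<And>x. a < x \<Longrightarrow> x < b \<Longrightarrow> sub_prob x < e"
proof -
  obtain i where i: "i < k" "B i q \<noteq> 0" using Bq by auto
  let ?M = "PiM {..<q} (\<lambda>_. gauss 0 \<sigma>)"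
  let ?S = "\<lambda>v. \<Sum>j<q. B i j * v j"
  interpret prob_space ?M by (rule prob_space_noise)
  interpret D: real_distribution "distr ?M borel ?S"
    by (intro real_distribution.intro prob_space_distr real_distribution_axioms.intro) auto
  have "eventually (\<lambda>y. cdf (distr ?M borel ?S) y < e) at_bot"
    using D.cdf_lim_at_bot assms by (rule order_tendstoD)
  then obtain K where K: "\<And>y. y \<le> K \<Longrightarrow> cdf (distr ?M borel ?S) y < e"
    by (auto simp: eventually_at_bot_linorder)
  have small: "sub_prob x < e" if "t i + B i q * x \<le> K" for x
  proof -
    have "sub_prob x \<le> measure ?M (?S -` {..t i + B i q * x} \<inter> space ?M)"
      unfolding sub_prob_eq by (rule finite_measure_mono) (use i in auto)
    also have "\<dots> = cdf (distr ?M borel ?S) (t i + B i q * x)"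
      unfolding cdf_def by (subst measure_distr) auto
    also have "\<dots> < e" by (rule K) (rule that)
    finally show ?thesis .
  qed
  define y where "y = (K - t i) / B i q"
  show thesis
  proof (cases "B i q > 0")
    case True
    show thesis
    proof (rule that[of "y - 1" y])
      fix x assume "x < y"
      then show "sub_prob x < e" using True by (intro small) (simp add: y_def field_simps)
    qed simp
  next
    case False
    then have neg: "B i q < 0" using i by simp
    show thesis
    proof (rule that[of y "y + 1"])
      fix x assume "y < x"
      then show "sub_prob x < e" using neg by (intro small) (simp add: y_def field_simps)
    qed simp
  qed
qed

text \<open>Equality off \<open>F\<close> would make the local mean vanish almost everywhere, hence
  \<open>sub_prob\<close> almost everywhere constant, against an interval where it is at least
  \<open>e\<close> and another where it is below \<open>e\<close>. The set \<open>F\<close> will be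
  the set of points at which convergence to the limit may fail.\<close>

lemma limit_prob_ne_full_prob:
  assumes "finite F"
  shows "\<exists>x. x \<notin> F \<and> limit_prob x \<noteq> full_prob"
proof (rule ccontr)
  assume "\<not> ?thesis"
  then have eq: "limit_prob x = full_prob" if "x \<notin> F" for x using that by auto
  let ?M = "PiM {q<..<P} (\<lambda>_. gauss 0 \<sigma>)"
  let ?\<kappa> = "measure ?M {y\<in>space ?M. \<forall>j\<in>{q<..<P}. \<bar>y j\<bar> < d j * \<sigma>}"
  \<comment> \<open>The constant factor of the integral is positive because the critical values
    above \<open>q\<close> are.\<close>
  have "0 < measure ?M (PiE {q<..<P} (\<lambda>j. {- (d j * \<sigma>)<..<d j * \<sigma>}))"
    by (rule measure_box_pos) (use d \<sigma> in auto)
  also have "PiE {q<..<P} (\<lambda>j. {- (d j * \<sigma>)<..<d j * \<sigma>}) = {y\<in>space ?M. \<forall>j\<in>{q<..<P}. \<bar>y j\<bar> < d j * \<sigma>}"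
  proof -
    have "{- a<..<a} = {x. \<bar>x\<bar> < a}" for a :: real by auto
    then show ?thesis by (auto simp: space_PiM PiE_def Pi_def)
  qed
  finally have \<kappa>: "0 < ?\<kappa>" .
  have "AE x in lborel. x \<notin> F"
    using finite_imp_null_set_lborel[OF assms] by (rule AE_not_in)
  then have "AE x in lborel. (\<integral>z. of_bool (\<bar>x - z\<bar> < d q * \<sigma>) * (sub_prob x - sub_prob z) \<partial>gauss 0 \<sigma>) = 0"
  proof eventually_elim
    case (elim x)
    then show ?case using limit_prob_minus_full_prob[of x] eq[OF elim] \<kappa> by simp
  qed
  then have "\<exists>v. AE z in lborel. sub_prob z = v"
    by (intro AE_const_if_mean_value[OF \<sigma>, of "d q * \<sigma>"])
      (use d[of q] qP \<sigma> sub_prob_bounds in \<open>auto simp: abs_le_iff intro: order_trans[of _ 0]\<close>)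
  then obtain v where v: "AE z in lborel. sub_prob z = v" by auto
  obtain a b e where 1: "a < b" "0 < e" "\<And>x. a < x \<Longrightarrow> x < b \<Longrightarrow> e \<le> sub_prob x"
    using sub_prob_ge_on_interval by blast
  obtain a' b' where 2: "a' < b'" "\<And>x. a' < x \<Longrightarrow> x < b' \<Longrightarrow> sub_prob x < e"
    using sub_prob_small_on_interval[OF 1(2)] by metis
  show False
    using AE_lborel_ex_interval[OF v 1(1)] AE_lborel_ex_interval[OF v 2(1)] 1(3) 2(2) by fastforce
qed

text \<open>The two events differ only if the test of the coordinate \<open>q\<close> accepts, which
  forces \<open>w q \<le> d q * \<sigma> - x\<close>. The probability of this vanishes as
  \<open>x\<close> grows.\<close>

lemma tendsto_limit_prob: "(limit_prob \<longlongrightarrow> full_prob) at_top"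
proof (rule tendsto_sandwich)
  interpret N: prob_space noise by (rule prob_space_noise)
  interpret g: real_distribution "gauss 0 \<sigma>" using \<sigma> by (rule real_distribution_gauss)
  have [measurable]: "(\<lambda>w. w q) \<in> borel_measurable noise"
    using qP by (intro component_measurable) simp
  let ?b = "\<lambda>x. cdf (gauss 0 \<sigma>) (d q * \<sigma> - x)"
  have b: "\<bar>limit_prob x - full_prob\<bar> \<le> ?b x" for x
  proof -
    let ?L = "{w\<in>space noise. if rejects x w then full w else part x w}" and ?F = "{w\<in>space noise. full w}"
      and ?C = "{w\<in>space noise. w q \<in> {..d q * \<sigma> - x}}"
    have LF: "?L \<in> sets noise" "?F \<in> sets noise" by measurable
    have C: "?C \<in> sets noise" by measurable
    have nr: "w \<in> ?C" if "w \<in> space noise" "\<not> rejects x w" for w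
      using that by (auto simp: rejects_def abs_le_iff not_le abs_less_iff)
    have "measure noise ?L \<le> measure noise (?F \<union> ?C)" "measure noise ?F \<le> measure noise (?L \<union> ?C)"
      using nr C LF by (intro N.finite_measure_mono sets.Un; force split: if_splits)+
    moreover have "measure noise (?F \<union> ?C) \<le> measure noise ?F + measure noise ?C"
      "measure noise (?L \<union> ?C) \<le> measure noise ?L + measure noise ?C"
      by (intro measure_Un_le LF C)+
    moreover have "measure noise ?C = ?b x"
    proof -
      have "gauss 0 \<sigma> = distr noise (gauss 0 \<sigma>) (\<lambda>w. w q)"
        using qP by (intro distr_PiM_component[symmetric] prob_space_normal_density \<sigma>) auto
      then have "?b x = measure (distr noise (gauss 0 \<sigma>) (\<lambda>w. w q)) {..d q * \<sigma> - x}"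
        by (simp add: cdf_def)
      also have "\<dots> = measure noise ?C"
        by (subst measure_distr) (auto intro!: arg_cong[where f="measure noise"])
      finally show ?thesis by simp
    qed
    ultimately show ?thesis unfolding limit_prob_def full_prob_def by linarith
  qed
  have "filterlim (\<lambda>x. d q * \<sigma> - x) at_bot at_top"
  proof (subst filterlim_uminus_at_bot)
    have "(\<lambda>x. - (d q * \<sigma> - x)) = (\<lambda>x. - (d q * \<sigma>) + x)" by (rule ext) linarith
    then show "filterlim (\<lambda>x. - (d q * \<sigma> - x)) at_top at_top"
      using filterlim_tendsto_add_at_top[OF tendsto_const filterlim_ident, of "- (d q * \<sigma>)"] by (simp only:)
  qed
  then have b0: "(?b \<longlongrightarrow> 0) at_top"
    by (rule filterlim_compose[OF g.cdf_lim_at_bot])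
  show "((\<lambda>x. full_prob - ?b x) \<longlongrightarrow> full_prob) at_top" "((\<lambda>x. full_prob + ?b x) \<longlongrightarrow> full_prob) at_top"
    using tendsto_diff[OF tendsto_const b0] tendsto_add[OF tendsto_const b0] by auto
  show "\<forall>\<^sub>F x in at_top. full_prob - ?b x \<le> limit_prob x" "\<forall>\<^sub>F x in at_top. limit_prob x \<le> full_prob + ?b x"
    using b by (auto intro!: always_eventually simp: abs_le_iff algebra_simps)
qed

end

section \<open>Null boundaries of the limit events and stability under small errors\<close>

lemma (in prob_space) prob_small_values:
  fixes h :: "'a \<Rightarrow> real"
  assumes [measurable]: "h \<in> borel_measurable M" and h0: "prob {\<omega>\<in>space M. h \<omega> = 0} = 0" and "0 < e"
  shows "\<exists>\<eta>>0. prob {\<omega>\<in>space M. \<bar>h \<omega>\<bar> \<le> \<eta>} < e"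
proof -
  let ?A = "\<lambda>n. {\<omega>\<in>space M. \<bar>h \<omega>\<bar> \<le> 1 / real (Suc n)}"
  have "(\<lambda>n. prob (?A n)) \<longlonglongrightarrow> prob (\<Inter>n. ?A n)"
  proof (rule finite_Lim_measure_decseq)
    show "range ?A \<subseteq> sets M" by auto
    show "decseq ?A"
    proof (rule decseq_SucI, safe)
      fix n \<omega> assume "\<bar>h \<omega>\<bar> \<le> 1 / real (Suc (Suc n))"
      also have "\<dots> \<le> 1 / real (Suc n)" by (simp add: frac_le)
      finally show "\<bar>h \<omega>\<bar> \<le> 1 / real (Suc n)" .
    qed
  qed
  moreover have "(\<Inter>n. ?A n) = {\<omega>\<in>space M. h \<omega> = 0}"
  proof safe
    fix \<omega> assume "\<omega> \<in> (\<Inter>n. ?A n)"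
    then have le: "\<bar>h \<omega>\<bar> \<le> 1 / real (Suc n)" for n by auto
    show "h \<omega> = 0"
    proof (rule ccontr)
      assume "h \<omega> \<noteq> 0"
      then obtain n where "1 / real (Suc n) < \<bar>h \<omega>\<bar>"
        using nat_approx_posE[of "\<bar>h \<omega>\<bar>"] by auto
      then show False using le[of n] by simp
    qed
  qed auto
  ultimately have "(\<lambda>n. prob (?A n)) \<longlonglongrightarrow> 0" using h0 by simp
  from order_tendstoD(2)[OF this \<open>0 < e\<close>] obtain n where "prob (?A n) < e"
    by (auto simp: eventually_sequentially)
  then show ?thesis by (intro exI[of _ "1 / real (Suc n)"]) simp
qed

lemma (in prob_space) prob_small_values_family:
  fixes H :: "('a \<Rightarrow> real) set"
  assumes "finite H" "\<And>h. h \<in> H \<Longrightarrow> h \<in> borel_measurable M"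
    and "\<And>h. h \<in> H \<Longrightarrow> prob {\<omega>\<in>space M. h \<omega> = 0} = 0" and "0 < e"
  shows "\<exists>\<eta>>0. {\<omega>\<in>space M. \<exists>h\<in>H. \<bar>h \<omega>\<bar> \<le> \<eta>} \<in> events \<and> prob {\<omega>\<in>space M. \<exists>h\<in>H. \<bar>h \<omega>\<bar> \<le> \<eta>} < e"
  using assms
proof (induction H arbitrary: e rule: finite_induct)
  case empty
  then show ?case by (intro exI[of _ 1]) auto
next
  case (insert h H)
  obtain \<eta>1 where 1: "\<eta>1 > 0" "{\<omega>\<in>space M. \<exists>h\<in>H. \<bar>h \<omega>\<bar> \<le> \<eta>1} \<in> events"
      "prob {\<omega>\<in>space M. \<exists>h\<in>H. \<bar>h \<omega>\<bar> \<le> \<eta>1} < e / 2"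
    using insert.IH[of "e / 2"] insert.prems by auto
  obtain \<eta>2 where 2: "\<eta>2 > 0" "prob {\<omega>\<in>space M. \<bar>h \<omega>\<bar> \<le> \<eta>2} < e / 2"
    using prob_small_values[of h "e / 2"] insert.prems by auto
  define \<eta> where "\<eta> = min \<eta>1 \<eta>2"
  have [measurable]: "\<And>g. g \<in> insert h H \<Longrightarrow> g \<in> borel_measurable M" by (rule insert.prems)
  have fin: "finite (insert h H)" using insert.hyps by simp
  have ev: "{\<omega>\<in>space M. \<exists>h\<in>insert h H. \<bar>h \<omega>\<bar> \<le> \<eta>} \<in> events"
    by (rule sets.sets_Collect_finite_Ex[OF _ fin]) (use insert.prems in measurable)
  have evh: "{\<omega>\<in>space M. \<bar>h \<omega>\<bar> \<le> \<eta>2} \<in> events" by measurable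
  have "prob {\<omega>\<in>space M. \<exists>h\<in>insert h H. \<bar>h \<omega>\<bar> \<le> \<eta>} \<le>
      prob ({\<omega>\<in>space M. \<exists>h\<in>H. \<bar>h \<omega>\<bar> \<le> \<eta>1} \<union> {\<omega>\<in>space M. \<bar>h \<omega>\<bar> \<le> \<eta>2})"
    using 1(2) evh by (intro finite_measure_mono sets.Un) (auto simp: \<eta>_def)
  also have "\<dots> \<le> prob {\<omega>\<in>space M. \<exists>h\<in>H. \<bar>h \<omega>\<bar> \<le> \<eta>1} + prob {\<omega>\<in>space M. \<bar>h \<omega>\<bar> \<le> \<eta>2}"
    by (rule measure_Un_le[OF 1(2) evh])
  also have "\<dots> < e" using 1 2 by simp
  finally have "prob {\<omega>\<in>space M. \<exists>h\<in>insert h H. \<bar>h \<omega>\<bar> \<le> \<eta>} < e" .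
  moreover have "\<eta> > 0" using 1(1) 2(1) by (simp add: \<eta>_def)
  ultimately show ?case using ev by blast
qed

lemma measure_gauss_singleton: "0 < \<sigma> \<Longrightarrow> measure (gauss \<mu> \<sigma>) {x} = 0"
proof -
  assume s: "0 < \<sigma>"
  interpret prob_space "gauss \<mu> \<sigma>" using s by (rule prob_space_normal_density)
  have "AE z in lborel. z \<notin> {x}" by (intro AE_not_in finite_imp_null_set_lborel) simp
  then have "AE z in gauss \<mu> \<sigma>. z \<notin> {x}" using s by (simp add: AE_gauss_iff)
  then have "emeasure (gauss \<mu> \<sigma>) {x} = 0"
    by (subst (asm) AE_iff_measurable[of "{x}"]) auto
  then show ?thesis by (simp add: measure_def)
qed

context limit_experiment
begin

lemma linear_measurable:
  "m \<le> P \<Longrightarrow> (\<lambda>w. \<Sum>j<m. a j * w j) \<in> borel_measurable noise"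
  by (intro borel_measurable_sum borel_measurable_times component_measurable) auto

text \<open>Integrating first over a coordinate with nonzero coefficient leaves a single point,
  which is null. If there is no such coordinate, \<open>s \<noteq> 0\<close> makes the event
  empty.\<close>

lemma noise_hyperplane_null:
  fixes a :: "nat \<Rightarrow> real"
  assumes m: "m \<le> P" and a: "(\<exists>j<m. a j \<noteq> 0) \<or> s \<noteq> 0"
  shows "measure noise {w\<in>space noise. (\<Sum>j<m. a j * w j) - s = 0} = 0"
proof (cases "\<exists>j<m. a j \<noteq> 0")
  case False
  then have "{w\<in>space noise. (\<Sum>j<m. a j * w j) - s = 0} = {}" using a by auto
  then show ?thesis by (simp only: measure_empty)
next
  case True
  then obtain l where l: "l < m" "a l \<noteq> 0" by auto
  let ?M = "\<lambda>_::nat. gauss 0 \<sigma>"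
  have pp: "product_sigma_finite ?M"
    using \<sigma> by (intro product_prob_space.axioms(1) product_prob_space_gauss)
  interpret N: prob_space noise by (rule prob_space_noise)
  interpret g: prob_space "gauss 0 \<sigma>" using \<sigma> by (rule prob_space_normal_density)
  have e: "{..<P} = insert l ({..<P} - {l})" using l m by auto
  have [measurable]: "(\<lambda>w. \<Sum>j<m. a j * w j) \<in> borel_measurable noise" using m by (rule linear_measurable)
  have "N.prob {w\<in>space noise. (\<Sum>j<m. a j * w j) - s = 0} = N.expectation (\<lambda>w. of_bool ((\<Sum>j<m. a j * w j) - s = 0))"
    by (rule N.prob_Collect_eq_expectation) measurable
  also have "\<dots> = (\<integral>y. \<integral>z. of_bool ((\<Sum>j<m. a j * (y(l:=z)) j) - s = 0) \<partial>gauss 0 \<sigma> \<partial>PiM ({..<P} - {l}) ?M)"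
  proof -
    have "integrable noise (\<lambda>w. of_bool ((\<Sum>j<m. a j * w j) - s = 0) :: real)"
      by (rule N.integrable_of_bool) measurable
    then show ?thesis
      by (subst (asm) e, subst e) (subst product_sigma_finite.product_integral_insert[OF pp]; simp)
  qed
  also have "(\<lambda>y. \<integral>z. of_bool ((\<Sum>j<m. a j * (y(l:=z)) j) - s = 0) \<partial>gauss 0 \<sigma>) = (\<lambda>_. 0 :: real)"
  proof
    fix y :: "nat \<Rightarrow> real"
    define r where "r = (\<Sum>j\<in>{..<m}-{l}. a j * y j)"
    have "(\<Sum>j<m. a j * (y(l:=z)) j) = a l * z + r" for z
    proof -
      have "(\<Sum>j\<in>{..<m}-{l}. a j * (y(l:=z)) j) = r" unfolding r_def by (rule sum.cong) auto
      then show ?thesis using l by (subst sum.remove[of _ l]) auto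
    qed
    then have "(\<integral>z. of_bool ((\<Sum>j<m. a j * (y(l:=z)) j) - s = 0) \<partial>gauss 0 \<sigma>) = (\<integral>z. indicator {(s - r) / a l} z \<partial>gauss 0 \<sigma> :: real)"
      using l by (intro Bochner_Integration.integral_cong) (auto simp: indicator_def field_simps)
    also have "\<dots> = 0" using measure_gauss_singleton[OF \<sigma>] by simp
    finally show "(\<integral>z. of_bool ((\<Sum>j<m. a j * (y(l:=z)) j) - s = 0) \<partial>gauss 0 \<sigma>) = (0 :: real)" .
  qed
  finally show ?thesis by simp
qed

lemma noise_component_null:
  assumes "j < P"
  shows "measure noise {w\<in>space noise. w j = s} = 0"
proof -
  have "(\<Sum>l<Suc j. (if l = j then 1 else 0) * w l) = w j" for w :: "nat \<Rightarrow> real"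
    by (simp add: if_distrib[of "\<lambda>x. x * _"] cong: if_cong)
  then show ?thesis
    using noise_hyperplane_null[of "Suc j" "\<lambda>l. if l = j then 1 else 0" s] assms by force
qed

text \<open>If row \<open>i\<close> of \<open>B\<close> vanishes below \<open>q\<close>, then
  \<open>part x\<close> compares the constant \<open>- B i q * x\<close> with \<open>t i\<close>. At
  the point listed for \<open>i\<close> the two coincide, and arbitrarily small errors in the
  coefficients could flip the event.\<close>

definition exceptional :: "real set" where
  "exceptional = (\<lambda>i. - t i / B i q) ` {..<k}"

lemma finite_exceptional: "finite exceptional"
  by (simp add: exceptional_def)

lemma row_nonzero: "i < k \<Longrightarrow> \<exists>j<Suc q. B i j \<noteq> 0"
proof (rule ccontr)
  assume i: "i < k" and "\<not> ?thesis"
  then have z: "\<And>j. j < Suc q \<Longrightarrow> B i j = 0" by auto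
  obtain w where "(\<Sum>j<Suc q. B i j * w j) = 1" using surj[of "\<lambda>_. 1"] i by blast
  moreover have "(\<Sum>j<Suc q. B i j * w j) = 0" by (rule sum.neutral) (use z in auto)
  ultimately show False by linarith
qed

text \<open>Off this event every test and every linear inequality is decided with a margin above
  \<open>\<eta>\<close>. The first clause bounds the noise by \<open>1 / \<eta>\<close>, so that
  errors in the coefficients have a controlled effect.\<close>

definition near_boundary :: "real \<Rightarrow> real \<Rightarrow> (nat \<Rightarrow> real) \<Rightarrow> bool" where
  "near_boundary x \<eta> w \<longleftrightarrow>
     (\<exists>j<P. 1 / \<eta> < \<bar>w j\<bar>) \<or>
     (\<exists>j\<in>{q..<P}. \<bar>\<bar>w j + (if j = q then x else 0)\<bar> - d j * \<sigma>\<bar> \<le> \<eta>) \<or>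
     (\<exists>i<k. \<bar>(\<Sum>j<Suc q. B i j * w j) - t i\<bar> \<le> \<eta>) \<or>
     (\<exists>i<k. \<bar>(\<Sum>j<q. B i j * w j) - (t i + B i q * x)\<bar> \<le> \<eta>)"

lemma near_boundary_measurable[measurable]: "Measurable.pred noise (near_boundary x \<eta>)"
proof -
  have [measurable]: "(\<lambda>w. \<Sum>j<Suc q. B i j * w j) \<in> borel_measurable noise"
    "(\<lambda>w. \<Sum>j<q. B i j * w j) \<in> borel_measurable noise" for i
    using qP by (auto intro!: linear_measurable simp del: sum.lessThan_Suc)
  have b: "(\<exists>j<P. 1 / \<eta> < \<bar>w j\<bar>) \<longleftrightarrow> (\<exists>j\<in>{..<P}. 1 / \<eta> < \<bar>w j\<bar>)"
    "(\<exists>i<k. Q i) \<longleftrightarrow> (\<exists>i\<in>{..<k}. Q i)" for w :: "nat \<Rightarrow> real" and Q by auto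
  have [measurable]: "j \<in> {q..<P} \<Longrightarrow> (\<lambda>w. w j) \<in> borel_measurable noise" for j
    by (rule component_measurable) auto
  show ?thesis unfolding near_boundary_def b by measurable
qed

text \<open>Each clause says that one of finitely many functions is small in absolute value, and
  each of these has a null zero set. The hypothesis on \<open>x\<close> handles rows that vanish
  below \<open>q\<close>, whose last function is constant.\<close>

lemma near_boundary_small:
  assumes x: "x \<notin> exceptional" and "0 < e"
  shows "\<exists>\<eta>>0. measure noise {w\<in>space noise. near_boundary x \<eta> w} < e"
proof -
  interpret N: prob_space noise by (rule prob_space_noise)
  \<comment> \<open>The functions \<open>1 / (1 + \<bar>w j\<bar>)\<close> have no zero, and they
    are small exactly when the noise is large; tightness thus becomes another instance of the same
    argument.\<close>
  define H where "H = (\<lambda>j w. 1 / (1 + \<bar>w j\<bar>)) ` {..<P} \<union>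
    (\<lambda>j w. \<bar>w j + (if j = q then x else 0)\<bar> - d j * \<sigma>) ` {q..<P} \<union>
    (\<lambda>i w. (\<Sum>j<Suc q. B i j * w j) - t i) ` {..<k} \<union>
    (\<lambda>i w. (\<Sum>j<q. B i j * w j) - (t i + B i q * x)) ` {..<k}"
  have fin: "finite H" by (simp add: H_def)
  have lin[measurable]: "(\<lambda>w. \<Sum>j<Suc q. B i j * w j) \<in> borel_measurable noise"
    "(\<lambda>w. \<Sum>j<q. B i j * w j) \<in> borel_measurable noise" for i
    using qP by (auto intro!: linear_measurable simp del: sum.lessThan_Suc)
  have meas: "h \<in> borel_measurable noise" if "h \<in> H" for h
  proof -
    have c: "(\<lambda>w. w j) \<in> borel_measurable noise" if "j < P" for j
      using that by (intro component_measurable) auto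
    show ?thesis using that unfolding H_def
      by (auto intro!: borel_measurable_diff borel_measurable_divide borel_measurable_add borel_measurable_abs c lin
          simp del: sum.lessThan_Suc)
  qed
  have null: "measure noise {w\<in>space noise. h w = 0} = 0" if "h \<in> H" for h
    using that unfolding H_def
  proof (elim UnE imageE)
    fix j assume "h = (\<lambda>w. 1 / (1 + \<bar>w j\<bar>))"
    then have "{w\<in>space noise. h w = 0} = {}" by (auto simp: add_nonneg_eq_0_iff)
    then show ?thesis by (simp only: measure_empty)
  next
    fix j assume h: "h = (\<lambda>w. \<bar>w j + (if j = q then x else 0)\<bar> - d j * \<sigma>)" and j: "j \<in> {q..<P}"
    let ?m = "if j = q then x else 0"
    have c[measurable]: "(\<lambda>w. w j) \<in> borel_measurable noise"
      using j by (intro component_measurable) auto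
    have "measure noise {w\<in>space noise. h w = 0} \<le>
       measure noise ({w\<in>space noise. w j = d j * \<sigma> - ?m} \<union> {w\<in>space noise. w j = - (d j * \<sigma>) - ?m})"
      by (intro N.finite_measure_mono) (auto simp: h abs_if split: if_splits)
    also have "\<dots> \<le> measure noise {w\<in>space noise. w j = d j * \<sigma> - ?m} + measure noise {w\<in>space noise. w j = - (d j * \<sigma>) - ?m}"
      by (intro measure_Un_le) measurable
    also have "\<dots> = 0" using j by (simp add: noise_component_null)
    finally show ?thesis using measure_nonneg[of noise "{w\<in>space noise. h w = 0}"] by linarith
  next
    fix i assume h: "h = (\<lambda>w. (\<Sum>j<Suc q. B i j * w j) - t i)" and i: "i \<in> {..<k}"
    show ?thesis unfolding h
      by (rule noise_hyperplane_null) (use qP row_nonzero[of i] i in auto)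
  next
    fix i assume h: "h = (\<lambda>w. (\<Sum>j<q. B i j * w j) - (t i + B i q * x))" and i: "i \<in> {..<k}"
    have "(\<exists>j<q. B i j \<noteq> 0) \<or> t i + B i q * x \<noteq> 0"
    proof (rule ccontr)
      assume "\<not> ?thesis"
      then have z: "\<And>j. j < q \<Longrightarrow> B i j = 0" "t i + B i q * x = 0" by auto
      then have Biq: "B i q \<noteq> 0" using row_nonzero[of i] i by (auto simp: less_Suc_eq)
      then have "x = - t i / B i q" using z(2) by (simp add: field_simps)
      then show False using x i by (auto simp: exceptional_def)
    qed
    then show ?thesis unfolding h by (intro noise_hyperplane_null) (use qP in auto)
  qed
  obtain \<eta> where \<eta>: "\<eta> > 0" "{w\<in>space noise. \<exists>h\<in>H. \<bar>h w\<bar> \<le> \<eta>} \<in> sets noise"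
    "measure noise {w\<in>space noise. \<exists>h\<in>H. \<bar>h w\<bar> \<le> \<eta>} < e"
    using N.prob_small_values_family[OF fin meas null \<open>0 < e\<close>] by auto
  have "measure noise {w\<in>space noise. near_boundary x \<eta> w} \<le> measure noise {w\<in>space noise. \<exists>h\<in>H. \<bar>h w\<bar> \<le> \<eta>}"
  proof (rule N.finite_measure_mono[OF _ \<eta>(2)], safe)
    fix w assume "near_boundary x \<eta> w"
    moreover have "\<bar>1 / (1 + \<bar>w j\<bar>)\<bar> \<le> \<eta>" if "1 / \<eta> < \<bar>w j\<bar>" for j
    proof -
      have "1 / (1 + \<bar>w j\<bar>) \<le> 1 / (1 / \<eta>)"
        using that \<eta>(1) by (intro divide_left_mono) (auto intro!: mult_pos_pos add_pos_nonneg)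
      then show ?thesis by simp
    qed
    ultimately show "\<exists>h\<in>H. \<bar>h w\<bar> \<le> \<eta>"
      unfolding near_boundary_def H_def bex_Un Set.bex_simps(7) lessThan_iff Bex_def[of "{..<_}"] by blast
  qed
  then show ?thesis using \<eta> by (intro exI[of _ \<eta>]) auto
qed

text \<open>
  Here \<open>S\<close> is the estimate of \<open>\<sigma>\<close>, \<open>p\<close> the selected order, \<open>w\<close> the vector of error coordinates, \<open>m\<close> that
  of their means, and \<open>b\<close> the finite sample version of \<open>B\<close>.
\<close>
lemma decision_eq:
  assumes nb: "\<not> near_boundary x \<eta> w" and \<eta>: "0 < \<eta>"
    and B0: "\<And>i j. i < k \<Longrightarrow> q < j \<Longrightarrow> j < P \<Longrightarrow> B i j = 0"
    and S: "\<And>j. q \<le> j \<Longrightarrow> j < P \<Longrightarrow> \<bar>d j * S - d j * \<sigma>\<bar> \<le> \<eta>"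
    and b: "\<And>i. i < k \<Longrightarrow> (\<Sum>j<P. \<bar>b i j - B i j\<bar>) * (1 / \<eta> + \<bar>x\<bar>) \<le> \<eta>"
    and m: "m q = x" "\<And>j. q < j \<Longrightarrow> j < P \<Longrightarrow> m j = 0"
    and p: "q \<le> p" "p \<le> P"
    and sel: "q < p \<Longrightarrow> d (p - 1) * S \<le> \<bar>w (p - 1) + m (p - 1)\<bar>"
    and unsel: "\<And>j. p \<le> j \<Longrightarrow> j < P \<Longrightarrow> \<bar>w j + m j\<bar> < d j * S"
  shows "(\<forall>i<k. (\<Sum>j<p. b i j * w j) - (\<Sum>j=p..<P. b i j * m j) \<le> t i) \<longleftrightarrow>
    (if rejects x w then full w else part x w)"
proof -
  have mj: "m j = (if j = q then x else 0)" if "q \<le> j" "j < P" for j using m that by auto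
  have far: "\<eta> < \<bar>\<bar>w j + m j\<bar> - d j * \<sigma>\<bar>" if "q \<le> j" "j < P" for j
    using nb that mj[OF that] by (auto simp: near_boundary_def not_le)
  have wb: "\<bar>w j\<bar> \<le> 1 / \<eta>" if "j < P" for j
    using nb that unfolding near_boundary_def by (meson not_less)
  \<comment> \<open>Using the estimate \<open>S\<close> in place of \<open>\<sigma>\<close> moves
    the threshold by at most \<open>\<eta>\<close>, less than its distance from the statistic, so no
    test changes its outcome.\<close>
  have rej: "d j * \<sigma> \<le> \<bar>w j + m j\<bar> \<longleftrightarrow> d j * S \<le> \<bar>w j + m j\<bar>" if "q \<le> j" "j < P" for j
    using far[OF that] S[OF that] \<eta> by linarith
  have rejects: "rejects x w \<longleftrightarrow> (\<exists>j\<in>{q..<P}. d j * S \<le> \<bar>w j + m j\<bar>)"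
  proof -
    have "rejects x w \<longleftrightarrow> (\<exists>j\<in>{q..<P}. d j * \<sigma> \<le> \<bar>w j + m j\<bar>)"
    proof -
      have e: "{q..<P} = insert q {q<..<P}" using qP by auto
      show ?thesis unfolding e rejects_def using m by auto
    qed
    then show ?thesis using rej by auto
  qed
  define D where "D = (\<lambda>i. \<Sum>j<P. \<bar>b i j - B i j\<bar>)"
  have est: "\<bar>(\<Sum>j<p. b i j * w j) - (\<Sum>j<p. B i j * w j)\<bar> \<le> D i * (1 / \<eta>)" for i
  proof -
    have "\<bar>(\<Sum>j<p. b i j * w j) - (\<Sum>j<p. B i j * w j)\<bar> = \<bar>\<Sum>j<p. (b i j - B i j) * w j\<bar>"
      by (simp add: left_diff_distrib sum_subtractf)
    also have "\<dots> \<le> (\<Sum>j<p. \<bar>(b i j - B i j) * w j\<bar>)" by (rule sum_abs)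
    also have "\<dots> \<le> (\<Sum>j<p. \<bar>b i j - B i j\<bar> * (1 / \<eta>))"
      using wb p by (intro sum_mono) (auto simp: abs_mult intro!: mult_left_mono simp del: times_divide_eq_right)
    also have "\<dots> \<le> (\<Sum>j<P. \<bar>b i j - B i j\<bar> * (1 / \<eta>))"
      using p \<eta> by (intro sum_mono2) auto
    finally show ?thesis by (simp add: D_def sum_distrib_right sum_divide_distrib)
  qed
  have D0: "0 \<le> D i" for i unfolding D_def by (simp add: sum_nonneg)
  show ?thesis
  \<comment> \<open>With order \<open>q\<close> the omitted coordinates contribute only the
    deterministic term \<open>b i q * x\<close>. With any larger order the omitted means are 0 and
    the extra columns of \<open>B\<close> are 0, so all larger orders lead to the same limit
    event.\<close>
  proof (cases "p = q")
    case True
    have nr: "\<not> rejects x w" unfolding rejects using unsel True by (auto simp: not_le)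
    have tail: "(\<Sum>j=p..<P. b i j * m j) = b i q * x" for i
    proof -
      have "(\<Sum>j=p..<P. b i j * m j) = (\<Sum>j=p..<P. if j = q then b i q * x else 0)"
        by (intro sum.cong refl) (use m True in auto)
      then show ?thesis using True qP by simp
    qed
    have "(\<Sum>j<p. b i j * w j) - (\<Sum>j=p..<P. b i j * m j) \<le> t i \<longleftrightarrow> (\<Sum>j<q. B i j * w j) - B i q * x \<le> t i"
      if i: "i < k" for i
    proof -
      have "\<bar>b i q - B i q\<bar> \<le> D i"
        unfolding D_def by (rule member_le_sum) (use qP in auto)
      then have "\<bar>b i q * x - B i q * x\<bar> \<le> D i * \<bar>x\<bar>"
        by (simp add: abs_mult mult_right_mono flip: left_diff_distrib)
      moreover have "D i * (1 / \<eta>) + D i * \<bar>x\<bar> \<le> \<eta>"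
        using b[OF i] by (simp add: D_def distrib_left)
      moreover have "\<eta> < \<bar>(\<Sum>j<q. B i j * w j) - (t i + B i q * x)\<bar>"
        using nb i by (auto simp: near_boundary_def not_le)
      ultimately show ?thesis using est[of i] tail[of i] unfolding True by linarith
    qed
    then show ?thesis using nr by (simp add: part_def Ball_def)
  next
    case False
    then have qp: "q < p" using p by simp
    have r: "rejects x w" unfolding rejects using sel[OF qp] qp p by (intro bexI[of _ "p - 1"]) auto
    have tail: "(\<Sum>j=p..<P. b i j * m j) = 0" for i
      by (intro sum.neutral) (use m qp in auto)
    have "(\<Sum>j<p. b i j * w j) - (\<Sum>j=p..<P. b i j * m j) \<le> t i \<longleftrightarrow> (\<Sum>j<Suc q. B i j * w j) \<le> t i"
      if i: "i < k" for i
    proof -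
      have "(\<Sum>j<p. B i j * w j) = (\<Sum>j<Suc q. B i j * w j)"
        by (intro sum.mono_neutral_right) (use qp p B0[OF i] in auto)
      moreover have "D i * (1 / \<eta>) \<le> \<eta>"
      proof -
        have "D i * (1 / \<eta>) + D i * \<bar>x\<bar> \<le> \<eta>" using b[OF i] by (simp add: D_def distrib_left)
        moreover have "0 \<le> D i * \<bar>x\<bar>" using D0[of i] by simp
        ultimately show ?thesis by linarith
      qed
      moreover have "\<eta> < \<bar>(\<Sum>j<Suc q. B i j * w j) - t i\<bar>"
        using nb i by (auto simp: near_boundary_def not_le simp del: sum.lessThan_Suc)
      ultimately show ?thesis using est[of i] tail[of i] by linarith
    qed
    then show ?thesis using r by (simp add: full_def Ball_def del: sum.lessThan_Suc)
  qed
qed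

end

subsection \<open>Gram-Schmidt vectors\<close>

definition qform :: "nat \<Rightarrow> (nat \<Rightarrow> nat \<Rightarrow> real) \<Rightarrow> (nat \<Rightarrow> real) \<Rightarrow> (nat \<Rightarrow> real) \<Rightarrow> real" where
  "qform n G v w = (\<Sum>a<n. \<Sum>b<n. v a * G a b * w b)"

text \<open>Orthonormalises the unit vectors in the inner product \<open>G\<close>; the sum over
  \<open>b\<close> is the inner product of the unit vector \<open>p\<close> with an earlier result.
  For positive definite \<open>G\<close> the results are the columns of the inverse transposed
  Cholesky factor. The definition takes any \<open>G\<close>, so that the Gram matrices of the
  samples and their limit \<open>Q\<close> can be compared.\<close>

function gram_schmidt :: "nat \<Rightarrow> (nat \<Rightarrow> nat \<Rightarrow> real) \<Rightarrow> nat \<Rightarrow> nat \<Rightarrow> real" where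
  "gram_schmidt n G p =
     (let r = (\<lambda>i. of_bool (i = p) - (\<Sum>j<p. (\<Sum>b<n. G p b * gram_schmidt n G j b) * gram_schmidt n G j i))
      in (\<lambda>i. r i / sqrt (qform n G r r)))"
  by pat_completeness auto
termination by (relation "Wellfounded.measure (\<lambda>(n, G, p). p)") auto

declare gram_schmidt.simps[simp del]

definition gs_residual :: "nat \<Rightarrow> (nat \<Rightarrow> nat \<Rightarrow> real) \<Rightarrow> nat \<Rightarrow> nat \<Rightarrow> real" where
  "gs_residual n G p i =
     of_bool (i = p) - (\<Sum>j<p. (\<Sum>b<n. G p b * gram_schmidt n G j b) * gram_schmidt n G j i)"

lemma gram_schmidt_eq:
  "gram_schmidt n G p i = gs_residual n G p i / sqrt (qform n G (gs_residual n G p) (gs_residual n G p))"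
  by (subst gram_schmidt.simps) (simp add: gs_residual_def[abs_def] Let_def)

lemma qform_diff_left: "qform n G (\<lambda>i. v i - v' i) w = qform n G v w - qform n G v' w"
  by (simp add: qform_def algebra_simps sum_subtractf)

lemma qform_sum_left: "qform n G (\<lambda>i. \<Sum>j\<in>J. c j * v j i) w = (\<Sum>j\<in>J. c j * qform n G (v j) w)"
proof -
  have "qform n G (\<lambda>i. \<Sum>j\<in>J. c j * v j i) w = (\<Sum>a<n. \<Sum>b<n. \<Sum>j\<in>J. c j * (v j a * G a b * w b))"
    by (simp add: qform_def sum_distrib_left sum_distrib_right mult_ac)
  also have "\<dots> = (\<Sum>a<n. \<Sum>j\<in>J. \<Sum>b<n. c j * (v j a * G a b * w b))"
    by (intro sum.cong refl sum.swap)
  also have "\<dots> = (\<Sum>j\<in>J. \<Sum>a<n. \<Sum>b<n. c j * (v j a * G a b * w b))"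
    by (rule sum.swap)
  finally show ?thesis by (simp add: qform_def sum_distrib_left)
qed

lemma qform_scale: "qform n G (\<lambda>i. v i / c) (\<lambda>i. w i / d) = qform n G v w / (c * d)"
  by (simp add: qform_def sum_divide_distrib)

lemma qform_unit: "p < n \<Longrightarrow> qform n G (\<lambda>i. of_bool (i = p)) w = (\<Sum>b<n. G p b * w b)"
proof -
  assume "p < n"
  have "qform n G (\<lambda>i. of_bool (i = p)) w = (\<Sum>a<n. if a = p then \<Sum>b<n. G p b * w b else 0)"
    unfolding qform_def by (intro sum.cong refl) auto
  then show ?thesis using \<open>p < n\<close> by simp
qed

locale pos_def_form =
  fixes n :: nat and G :: "nat \<Rightarrow> nat \<Rightarrow> real"
  assumes sym: "\<And>a b. a < n \<Longrightarrow> b < n \<Longrightarrow> G a b = G b a"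
    and pos: "\<And>v. (\<exists>a<n. v a \<noteq> 0) \<Longrightarrow> 0 < qform n G v v"
begin

abbreviation "T \<equiv> gram_schmidt n G"

lemma qform_commute: "qform n G v w = qform n G w v"
proof -
  have "qform n G v w = (\<Sum>b<n. \<Sum>a<n. v a * G a b * w b)"
    unfolding qform_def by (rule sum.swap)
  also have "\<dots> = qform n G w v"
    unfolding qform_def by (intro sum.cong refl) (simp add: sym)
  finally show ?thesis .
qed

text \<open>The earlier vectors are supported below \<open>p\<close>, so the residual has entry 1 at
  \<open>p\<close>; being nonzero, it has positive norm. The claims are proved together because each
  one for \<open>p\<close> uses the others for smaller indices.\<close>

lemma gram_schmidt_aux:
  "p < n \<Longrightarrow> (\<forall>i>p. T p i = 0) \<and> 0 < T p p \<and> (\<forall>j<p. qform n G (T p) (T j) = 0) \<and>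
     qform n G (T p) (T p) = 1 \<and> 0 < qform n G (gs_residual n G p) (gs_residual n G p)"
proof (induction p rule: less_induct)
  case (less p)
  let ?r = "gs_residual n G p"
  have IH: "(\<forall>i>j. T j i = 0)" "0 < T j j" "\<And>k. k < j \<Longrightarrow> qform n G (T j) (T k) = 0"
    "qform n G (T j) (T j) = 1" if "j < p" for j
    using less.IH[OF that] that less.prems by auto
  have orth: "qform n G (T j) (T k) = of_bool (j = k)" if "j < p" "k < p" for j k
    using IH(3)[of j k] IH(3)[of k j] IH(4)[of j] that qform_commute[of "T j" "T k"]
    by (cases j k rule: linorder_cases) auto
  have r0: "?r i = 0" if "i > p" for i
    using that IH(1) by (auto simp: gs_residual_def intro!: sum.neutral)
  have r1: "?r p = 1"
    using IH(1) by (auto simp: gs_residual_def intro!: sum.neutral)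
  have N: "0 < qform n G ?r ?r"
    by (rule pos) (use r1 less.prems in auto)
  have rT: "qform n G ?r (T j) = 0" if "j < p" for j
  proof -
    have "qform n G ?r (T j) = (\<Sum>b<n. G p b * T j b) -
       (\<Sum>k<p. (\<Sum>b<n. G p b * T k b) * qform n G (T k) (T j))"
      unfolding gs_residual_def[abs_def] qform_diff_left qform_sum_left
      using less.prems by (simp add: qform_unit)
    also have "(\<Sum>k<p. (\<Sum>b<n. G p b * T k b) * qform n G (T k) (T j)) =
       (\<Sum>k<p. if k = j then \<Sum>b<n. G p b * T j b else 0)"
      by (intro sum.cong refl) (auto simp: orth that)
    finally show ?thesis using that by simp
  qed
  have Tp: "T p = (\<lambda>i. ?r i / sqrt (qform n G ?r ?r))"
    by (rule ext) (rule gram_schmidt_eq)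
  have "qform n G (T p) (T j) = 0" if "j < p" for j
    using qform_scale[of n G ?r "sqrt (qform n G ?r ?r)" "T j" 1] rT[OF that] by (simp add: Tp)
  moreover have "qform n G (T p) (T p) = 1"
    unfolding Tp qform_scale using N by simp
  ultimately show ?case
    using N r0 r1 by (auto simp: Tp)
qed

lemma T_upper: "p < n \<Longrightarrow> p < i \<Longrightarrow> T p i = 0"
  and T_diag: "p < n \<Longrightarrow> 0 < T p p"
  and residual_pos: "p < n \<Longrightarrow> 0 < qform n G (gs_residual n G p) (gs_residual n G p)"
  using gram_schmidt_aux by blast+

lemma T_orthonormal: "j < n \<Longrightarrow> k < n \<Longrightarrow> qform n G (T j) (T k) = of_bool (j = k)"
  using gram_schmidt_aux[of j] gram_schmidt_aux[of k] qform_commute[of "T j" "T k"]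
  by (cases j k rule: linorder_cases) auto

lemma unit_eq_comb:
  assumes "p < n"
  shows "of_bool (i = p) = (\<Sum>j<p. (\<Sum>b<n. G p b * T j b) * T j i) +
    sqrt (qform n G (gs_residual n G p) (gs_residual n G p)) * T p i"
  using residual_pos[OF assms] by (simp add: gram_schmidt_eq[of n G p i]) (simp add: gs_residual_def)

text \<open>The unit vector \<open>a\<close> lies in the span of \<open>T 0\<close> to
  \<open>T a\<close>, and \<open>T j\<close> is orthogonal to that span.\<close>

lemma G_T_lower:
  assumes "a < j" "j < n"
  shows "(\<Sum>b<n. G a b * T j b) = 0"
proof -
  have a: "a < n" using assms by simp
  define s where "s = sqrt (qform n G (gs_residual n G a) (gs_residual n G a))"
  have e: "(\<lambda>i. of_bool (i = a)) = (\<lambda>i. \<Sum>k<Suc a. (if k = a then s else (\<Sum>b<n. G a b * T k b)) * T k i)"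
    by (rule ext) (simp add: unit_eq_comb[OF a] s_def)
  have "(\<Sum>b<n. G a b * T j b) = qform n G (\<lambda>i. of_bool (i = a)) (T j)"
    using a by (simp add: qform_unit)
  also have "\<dots> = (\<Sum>k<Suc a. (if k = a then s else (\<Sum>b<n. G a b * T k b)) * qform n G (T k) (T j))"
    unfolding e qform_sum_left ..
  also have "\<dots> = 0"
    using assms by (intro sum.neutral) (auto simp: T_orthonormal)
  finally show ?thesis .
qed

text \<open>The first \<open>p\<close> vectors are supported on the first \<open>p\<close> indices,
  so their inner products involve the leading block only.\<close>

lemma qform_T_restrict:
  assumes "p \<le> n" "j < p" "k < p"
  shows "(\<Sum>a<p. \<Sum>b<p. T j a * G a b * T k b) = of_bool (j = k)"
proof -
  have sub: "{..<n} = {..<p} \<union> {p..<n}" using assms by auto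
  have "qform n G (T j) (T k) = (\<Sum>a<n. \<Sum>b<p. T j a * G a b * T k b)"
    unfolding qform_def
    by (intro sum.cong refl sum.mono_neutral_right) (use assms in \<open>auto intro!: T_upper\<close>)
  also have "\<dots> = (\<Sum>a<p. \<Sum>b<p. T j a * G a b * T k b)"
    by (intro sum.mono_neutral_right) (use assms in \<open>auto intro!: sum.neutral T_upper\<close>)
  finally show ?thesis using assms by (simp add: T_orthonormal)
qed

end

section \<open>Inverses of leading blocks, expansion in the Gram-Schmidt vectors, continuity in the
  form\<close>

lemma minv_eqI:
  fixes B C :: "real mat"
  assumes B: "B \<in> carrier_mat n n" and C: "C \<in> carrier_mat n n" and BC: "B * C = 1\<^sub>m n"
  shows "minv B = C"
proof -
  have CB: "C * B = 1\<^sub>m n" by (rule mat_mult_left_right_inverse[OF B C BC])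
  have "B \<in> Units (ring_mat TYPE(real) n ())"
    using B C BC CB by (auto simp: Units_def ring_mat_def)
  then obtain D where D: "mat_inverse B = Some D"
    using mat_inverse(1)[OF B, where b="()"] by (cases "mat_inverse B") auto
  then have D': "B * D = 1\<^sub>m n" "D * B = 1\<^sub>m n" "D \<in> carrier_mat n n"
    using mat_inverse(2)[OF B D] by auto
  have "D = D * (B * C)" using BC D' by simp
  also have "\<dots> = C" using D' B C by (simp flip: assoc_mult_mat)
  finally show ?thesis by (simp add: minv_def D)
qed

context pos_def_form
begin

text \<open>Let \<open>M\<close> be the triangular matrix of the first \<open>p\<close> vectors.
  Orthonormality makes the product of \<open>M\<close> transposed, \<open>B\<close> and
  \<open>M\<close> the identity, so the inverse of \<open>B\<close> is \<open>M\<close> times its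
  transpose. The same vectors serve every \<open>p\<close>, hence all restricted estimators share
  one coordinate system.\<close>

lemma leading_block_inverse:
  assumes "p \<le> n" and B: "B \<in> carrier_mat p p" and e: "\<And>a b. a < p \<Longrightarrow> b < p \<Longrightarrow> B $$ (a, b) = G a b"
  shows "B * mat p p (\<lambda>(i, k). \<Sum>j<p. T j i * T j k) = 1\<^sub>m p"
    and "mat p p (\<lambda>(i, k). \<Sum>j<p. T j i * T j k) * B = 1\<^sub>m p"
proof -
  define M where "M = mat p p (\<lambda>(i, j). T j i)"
  have M: "M \<in> carrier_mat p p" by (simp add: M_def)
  have M': "transpose_mat M \<in> carrier_mat p p" using M by simp
  have MM: "mat p p (\<lambda>(i, k). \<Sum>j<p. T j i * T j k) = M * transpose_mat M"
    by (rule eq_matI) (auto simp: M_def scalar_prod_def lessThan_atLeast0)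
  have "transpose_mat M * B * M = 1\<^sub>m p"
  proof (rule eq_matI)
    fix i j assume ij: "i < dim_row (1\<^sub>m p :: real mat)" "j < dim_col (1\<^sub>m p :: real mat)"
    then have ij': "i < p" "j < p" by auto
    have "(transpose_mat M * B * M) $$ (i, j) = (\<Sum>b<p. (\<Sum>a<p. T i a * G a b) * T j b)"
      using ij' B by (auto simp: M_def scalar_prod_def lessThan_atLeast0 e intro!: sum.cong)
    also have "\<dots> = (\<Sum>b<p. \<Sum>a<p. T i a * G a b * T j b)"
      by (simp add: sum_distrib_right)
    also have "\<dots> = (\<Sum>a<p. \<Sum>b<p. T i a * G a b * T j b)" by (rule sum.swap)
    also have "\<dots> = of_bool (i = j)" by (rule qform_T_restrict) (use assms ij' in auto)
    finally show "(transpose_mat M * B * M) $$ (i, j) = 1\<^sub>m p $$ (i, j)" using ij' by simp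
  qed (use B M in auto)
  then have "M * (transpose_mat M * B) = 1\<^sub>m p"
    by (rule mat_mult_left_right_inverse[of "transpose_mat M * B" p M, rotated 2]) (simp_all add: M mult_carrier_mat[OF M' B])
  then have 1: "M * transpose_mat M * B = 1\<^sub>m p"
    using assoc_mult_mat[OF M M' B] by simp
  then show "mat p p (\<lambda>(i, k). \<Sum>j<p. T j i * T j k) * B = 1\<^sub>m p" by (simp add: MM)
  show "B * mat p p (\<lambda>(i, k). \<Sum>j<p. T j i * T j k) = 1\<^sub>m p"
    unfolding MM by (rule mat_mult_left_right_inverse[OF _ B 1]) (use M in auto)
qed

lemma minv_leading_block:
  assumes "p \<le> n" and B: "B \<in> carrier_mat p p" and e: "\<And>a b. a < p \<Longrightarrow> b < p \<Longrightarrow> B $$ (a, b) = G a b"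
  shows "minv B = mat p p (\<lambda>(i, k). \<Sum>j<p. T j i * T j k)"
  by (rule minv_eqI[OF B _ leading_block_inverse(1)]) (use assms in auto)

text \<open>Completeness of the orthonormal system, read off from the inverse of the whole
  matrix.\<close>

lemma expand_in_T:
  assumes "a < n"
  shows "v a = (\<Sum>j<n. T j a * qform n G (T j) v)"
proof -
  define B where "B = mat n n (\<lambda>(a, b). G a b)"
  have B: "B \<in> carrier_mat n n" by (simp add: B_def)
  have 1: "mat n n (\<lambda>(i, k). \<Sum>j<n. T j i * T j k) * B = 1\<^sub>m n"
    by (rule leading_block_inverse(2)) (auto simp: B_def)
  have *: "(\<Sum>k<n. (\<Sum>j<n. T j a * T j k) * G k b) = of_bool (a = b)" if "b < n" for b
  proof -
    have "(mat n n (\<lambda>(i, k). \<Sum>j<n. T j i * T j k) * B) $$ (a, b) = of_bool (a = b)"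
      unfolding 1 using assms that by simp
    then show ?thesis
      using assms that by (simp add: B_def scalar_prod_def lessThan_atLeast0)
  qed
  have "v a = (\<Sum>b<n. if b = a then v a else 0)" using assms by simp
  also have "\<dots> = (\<Sum>b<n. (\<Sum>k<n. (\<Sum>j<n. T j a * T j k) * G k b) * v b)"
    by (intro sum.cong refl) (auto simp: *)
  also have "\<dots> = (\<Sum>b<n. \<Sum>k<n. \<Sum>j<n. T j a * (T j k * G k b * v b))"
    by (simp add: sum_distrib_left sum_distrib_right mult_ac)
  also have "\<dots> = (\<Sum>k<n. \<Sum>b<n. \<Sum>j<n. T j a * (T j k * G k b * v b))" by (rule sum.swap)
  also have "\<dots> = (\<Sum>k<n. \<Sum>j<n. \<Sum>b<n. T j a * (T j k * G k b * v b))"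
    by (intro sum.cong refl sum.swap)
  also have "\<dots> = (\<Sum>j<n. \<Sum>k<n. \<Sum>b<n. T j a * (T j k * G k b * v b))" by (rule sum.swap)
  finally show ?thesis by (simp add: qform_def sum_distrib_left)
qed

end

text \<open>The recursion consists of sums, products and a division by the residual norm, which
  stays away from 0 because it is positive for the limit form.\<close>

lemma (in pos_def_form) tendsto_gram_schmidt:
  assumes "\<And>a b. a < n \<Longrightarrow> b < n \<Longrightarrow> ((\<lambda>m. H m a b) \<longlongrightarrow> G a b) F"
  shows "p < n \<Longrightarrow> ((\<lambda>m. gram_schmidt n (H m) p i) \<longlongrightarrow> gram_schmidt n G p i) F"
proof (induction p arbitrary: i rule: less_induct)
  case (less p)
  have IH: "((\<lambda>m. gram_schmidt n (H m) j i) \<longlongrightarrow> gram_schmidt n G j i) F" if "j < p" for i j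
    using less that by simp
  have res: "((\<lambda>m. gs_residual n (H m) p i) \<longlongrightarrow> gs_residual n G p i) F" for i
    unfolding gs_residual_def using less.prems by (intro tendsto_intros IH assms) auto
  have "((\<lambda>m. qform n (H m) (gs_residual n (H m) p) (gs_residual n (H m) p)) \<longlongrightarrow>
     qform n G (gs_residual n G p) (gs_residual n G p)) F"
    unfolding qform_def by (intro tendsto_intros res assms) auto
  then show ?case
    unfolding gram_schmidt_eq using residual_pos[OF less.prems]
    by (intro tendsto_intros res) auto
qed

subsection \<open>Canonical form of the regression model\<close>

lemma scalar_prod_self_nonneg: "0 \<le> v \<bullet> (v :: real vec)"
  by (simp add: scalar_prod_def sum_nonneg)

locale design =
  fixes X :: "real mat" and N P :: nat
  assumes X: "X \<in> carrier_mat N P" and PN: "P < N"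
    and inj: "\<And>v. (\<exists>a<P. v a \<noteq> 0) \<Longrightarrow> \<exists>l<N. (\<Sum>a<P. X $$ (l, a) * v a) \<noteq> 0"
begin

definition gram :: "nat \<Rightarrow> nat \<Rightarrow> real" where
  "gram a b = (transpose_mat X * X) $$ (a, b) / real N"

lemma gram_eq: "a < P \<Longrightarrow> b < P \<Longrightarrow> gram a b = (\<Sum>l<N. X $$ (l, a) * X $$ (l, b)) / real N"
  using X by (simp add: gram_def scalar_prod_def lessThan_atLeast0)

lemma qform_gram:
  "qform P gram v w = (\<Sum>l<N. (\<Sum>a<P. X $$ (l, a) * v a) * (\<Sum>b<P. X $$ (l, b) * w b)) / real N"
proof -
  have "qform P gram v w = (\<Sum>a<P. \<Sum>b<P. \<Sum>l<N. (X $$ (l, a) * v a) * (X $$ (l, b) * w b)) / N"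
    unfolding qform_def by (simp add: gram_eq sum_divide_distrib sum_distrib_left sum_distrib_right mult_ac)
  also have "(\<Sum>a<P. \<Sum>b<P. \<Sum>l<N. (X $$ (l, a) * v a) * (X $$ (l, b) * w b)) =
     (\<Sum>a<P. \<Sum>l<N. \<Sum>b<P. (X $$ (l, a) * v a) * (X $$ (l, b) * w b))"
    by (intro sum.cong refl sum.swap)
  also have "\<dots> = (\<Sum>l<N. \<Sum>a<P. \<Sum>b<P. (X $$ (l, a) * v a) * (X $$ (l, b) * w b))"
    by (rule sum.swap)
  finally show ?thesis by (simp add: sum_product)
qed

sublocale pos_def_form P gram
proof
  show "gram a b = gram b a" if "a < P" "b < P" for a b
    using that by (simp add: gram_eq mult.commute)
  show "0 < qform P gram v v" if v: "\<exists>a<P. v a \<noteq> 0" for v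
  proof -
    obtain l where l: "l < N" "(\<Sum>a<P. X $$ (l, a) * v a) \<noteq> 0" using inj[OF v] by auto
    then have "0 < (\<Sum>l<N. (\<Sum>a<P. X $$ (l, a) * v a) * (\<Sum>b<P. X $$ (l, b) * v b))"
      by (intro sum_pos2[of _ l]) (auto simp: zero_less_mult_iff linorder_neq_iff)
    then show ?thesis using PN by (simp add: qform_gram)
  qed
qed

text \<open>The vectors \<open>U 0\<close> to \<open>U (p - 1)\<close> form an orthonormal basis of
  the span of the first \<open>p\<close> columns of \<open>X\<close>. The division by
  \<open>sqrt N\<close> matches the normalisation of \<open>gram\<close> by
  \<open>N\<close>.\<close>

definition U :: "nat \<Rightarrow> nat \<Rightarrow> real" where
  "U j l = (\<Sum>a<P. X $$ (l, a) * T j a) / sqrt (real N)"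

definition proj :: "(nat \<Rightarrow> real) \<Rightarrow> nat \<Rightarrow> real" where
  "proj y j = (\<Sum>l<N. U j l * y l)"

definition coord :: "real vec \<Rightarrow> nat \<Rightarrow> real" where
  "coord \<eta> = proj (\<lambda>l. (X *\<^sub>v \<eta>) $ l)"

lemma U_orthonormal: "j < P \<Longrightarrow> k < P \<Longrightarrow> (\<Sum>l<N. U j l * U k l) = of_bool (j = k)"
proof -
  assume "j < P" "k < P"
  have "(\<Sum>l<N. U j l * U k l) = (\<Sum>l<N. (\<Sum>a<P. X $$ (l, a) * T j a) * (\<Sum>b<P. X $$ (l, b) * T k b) / real N)"
    by (rule sum.cong[OF refl]) (simp add: U_def)
  also have "\<dots> = qform P gram (T j) (T k)"
    unfolding qform_gram by (rule sum_divide_distrib[symmetric])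
  finally show ?thesis using T_orthonormal \<open>j < P\<close> \<open>k < P\<close> by simp
qed

lemma sum_squares_U: "(\<Sum>l<N. (\<Sum>j<P. U j l * z j)\<^sup>2) = (\<Sum>j<P. (z j)\<^sup>2)"
proof -
  have "(\<Sum>l<N. (\<Sum>j<P. U j l * z j)\<^sup>2) = (\<Sum>l<N. \<Sum>j<P. \<Sum>i<P. U j l * U i l * (z j * z i))"
    by (simp add: power2_eq_square sum_product mult_ac)
  also have "\<dots> = (\<Sum>j<P. \<Sum>l<N. \<Sum>i<P. U j l * U i l * (z j * z i))" by (rule sum.swap)
  also have "\<dots> = (\<Sum>j<P. \<Sum>i<P. \<Sum>l<N. U j l * U i l * (z j * z i))"
    by (rule sum.cong[OF refl], rule sum.swap)
  also have "\<dots> = (\<Sum>j<P. \<Sum>i<P. if i = j then (z j)\<^sup>2 else 0)"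
    by (intro sum.cong refl) (auto simp: U_orthonormal power2_eq_square simp flip: sum_distrib_right)
  finally show ?thesis by simp
qed

lemma proj_add: "proj (\<lambda>l. y l + z l) j = proj y j + proj z j"
  by (simp add: proj_def distrib_left sum.distrib)

lemma coord_eq:
  assumes "\<eta> \<in> carrier_vec P" "j < P"
  shows "coord \<eta> j = sqrt (real N) * qform P gram (T j) (\<lambda>a. \<eta> $ a)"
proof -
  have "(X *\<^sub>v \<eta>) $ l = (\<Sum>a<P. X $$ (l, a) * \<eta> $ a)" if "l < N" for l
    using that X assms by (simp add: scalar_prod_def lessThan_atLeast0)
  then have "coord \<eta> j = (\<Sum>l<N. (\<Sum>a<P. X $$ (l, a) * T j a) * (\<Sum>b<P. X $$ (l, b) * \<eta> $ b)) / sqrt (real N)"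
    by (simp add: coord_def proj_def U_def sum_divide_distrib[where A="{..<N}"])
  also have "\<dots> = sqrt (real N) * qform P gram (T j) (\<lambda>a. \<eta> $ a)"
    using sqrt_divide_self_eq[of "real N"] by (simp add: qform_gram divide_inverse mult_ac)
  finally show ?thesis .
qed

lemma coord_expand:
  assumes "\<eta> \<in> carrier_vec P" "a < P"
  shows "sqrt (real N) * \<eta> $ a = (\<Sum>j<P. T j a * coord \<eta> j)"
proof -
  have "sqrt (real N) * \<eta> $ a = (\<Sum>j<P. sqrt (real N) * (T j a * qform P gram (T j) (\<lambda>a. \<eta> $ a)))"
    by (subst expand_in_T[OF assms(2), of "\<lambda>a. \<eta> $ a"]) (rule sum_distrib_left)
  also have "\<dots> = (\<Sum>j<P. T j a * coord \<eta> j)"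
    by (rule sum.cong[OF refl]) (simp add: coord_eq[OF assms(1)])
  finally show ?thesis .
qed

lemma fitted_eq:
  assumes "\<eta> \<in> carrier_vec P" "l < N"
  shows "(X *\<^sub>v \<eta>) $ l = (\<Sum>j<P. U j l * coord \<eta> j)"
proof -
  have "(X *\<^sub>v \<eta>) $ l = (\<Sum>a<P. X $$ (l, a) * \<eta> $ a)"
    using X assms by (simp add: scalar_prod_def lessThan_atLeast0)
  also have "\<dots> = (\<Sum>a<P. X $$ (l, a) * (\<Sum>j<P. T j a * coord \<eta> j) / sqrt (real N))"
    using PN coord_expand[OF assms(1)] by (intro sum.cong refl) (simp add: field_simps)
  also have "\<dots> = (\<Sum>a<P. \<Sum>j<P. X $$ (l, a) * T j a * coord \<eta> j / sqrt (real N))"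
    by (simp add: sum_distrib_left sum_divide_distrib mult_ac)
  also have "\<dots> = (\<Sum>j<P. \<Sum>a<P. X $$ (l, a) * T j a * coord \<eta> j / sqrt (real N))"
    by (rule sum.swap)
  finally show ?thesis by (simp add: U_def sum_distrib_right sum_divide_distrib)
qed

text \<open>For \<open>a < q \<le> j\<close> the vector \<open>T j\<close> is orthogonal to the unit
  vector \<open>a\<close>, so the coordinates respect the nesting of the models.\<close>

lemma coord_submodel:
  assumes "\<eta> \<in> submodel P q" "q \<le> j" "j < P"
  shows "coord \<eta> j = 0"
proof -
  have \<eta>: "\<eta> \<in> carrier_vec P" "\<And>i. q \<le> i \<Longrightarrow> i < P \<Longrightarrow> \<eta> $ i = 0"
    using assms by (auto simp: submodel_def)
  have "qform P gram (T j) (\<lambda>a. \<eta> $ a) = qform P gram (\<lambda>a. \<eta> $ a) (T j)" by (rule qform_commute)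
  also have "\<dots> = (\<Sum>a<P. \<eta> $ a * (\<Sum>b<P. gram a b * T j b))"
    by (simp add: qform_def sum_distrib_left mult_ac)
  also have "\<dots> = 0"
  proof (rule sum.neutral, intro ballI)
    fix a assume "a \<in> {..<P}"
    then show "\<eta> $ a * (\<Sum>b<P. gram a b * T j b) = 0"
      using \<eta>(2)[of a] G_T_lower[of a j] assms by (cases "a < j") auto
  qed
  finally show ?thesis using \<eta> assms by (simp add: coord_eq)
qed

text \<open>Moves the coordinates of \<open>\<theta>\<close> by \<open>\<Delta>\<close>. Because of
  the factor \<open>1 / sqrt N\<close>, a shift of fixed size in the coordinates is a local
  alternative in the parameter.\<close>

definition shift :: "real vec \<Rightarrow> (nat \<Rightarrow> real) \<Rightarrow> real vec" where
  "shift \<theta> \<Delta> = vec P (\<lambda>a. \<theta> $ a + (\<Sum>j<P. T j a * \<Delta> j) / sqrt (real N))"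

lemma coord_shift:
  assumes "\<theta> \<in> carrier_vec P" "j < P"
  shows "coord (shift \<theta> \<Delta>) j = coord \<theta> j + \<Delta> j"
proof -
  have sh: "shift \<theta> \<Delta> \<in> carrier_vec P" by (simp add: shift_def)
  have "qform P gram (T j) (\<lambda>a. shift \<theta> \<Delta> $ a) =
    qform P gram (T j) (\<lambda>a. \<theta> $ a - (\<Sum>k<P. (- \<Delta> k / sqrt (real N)) * T k a))"
    unfolding qform_def
    by (intro sum.cong refl) (simp add: shift_def sum_divide_distrib sum_negf mult_ac)
  also have "\<dots> = qform P gram (T j) (\<lambda>a. \<theta> $ a) - (\<Sum>k<P. (- \<Delta> k / sqrt (real N)) * qform P gram (T k) (T j))"
    unfolding qform_commute[of "T j"] qform_diff_left qform_sum_left ..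
  also have "(\<Sum>k<P. (- \<Delta> k / sqrt (real N)) * qform P gram (T k) (T j)) =
     (\<Sum>k<P. if k = j then - \<Delta> j / sqrt (real N) else 0)"
    by (intro sum.cong refl) (use assms in \<open>auto simp: T_orthonormal\<close>)
  finally show ?thesis
    using assms PN by (simp add: coord_eq sh distrib_left)
qed

lemma shift_submodel:
  assumes "\<theta> \<in> submodel P q" "\<And>j. q \<le> j \<Longrightarrow> j < P \<Longrightarrow> \<Delta> j = 0"
  shows "shift \<theta> \<Delta> \<in> submodel P q"
proof -
  have "(\<Sum>j<P. T j i * \<Delta> j) = 0" if "q \<le> i" "i < P" for i
  proof (rule sum.neutral, intro ballI)
    fix j assume "j \<in> {..<P}"
    then show "T j i * \<Delta> j = 0"
      using assms(2)[of j] T_upper[of j i] that by (cases "q \<le> j") auto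
  qed
  then show ?thesis using assms(1) by (auto simp: submodel_def shift_def)
qed

lemma vnorm_shift:
  assumes "\<theta> \<in> carrier_vec P"
  shows "sqrt (real N) * vnorm (shift \<theta> \<Delta> - \<theta>) = sqrt (\<Sum>a<P. (\<Sum>j<P. T j a * \<Delta> j)\<^sup>2)"
proof -
  have "(shift \<theta> \<Delta> - \<theta>) \<bullet> (shift \<theta> \<Delta> - \<theta>) = (\<Sum>a<P. ((\<Sum>j<P. T j a * \<Delta> j) / sqrt (real N))\<^sup>2)"
    using assms by (simp add: scalar_prod_def shift_def lessThan_atLeast0 power2_eq_square del: times_divide_eq_left times_divide_eq_right)
  also have "\<dots> = (\<Sum>a<P. (\<Sum>j<P. T j a * \<Delta> j)\<^sup>2) / real N"
    by (simp only: power_divide flip: sum_divide_distrib) simp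
  finally show ?thesis using PN by (simp add: vnorm_def real_sqrt_divide)
qed

section \<open>Estimators, test statistics and the variance estimate in coordinates\<close>

lemma dims[simp]: "dim_row X = N" "dim_col X = P"
  using X by auto

text \<open>The inverse of the restricted Gram matrix is a sum over the first \<open>p\<close>
  Gram-Schmidt vectors, so the estimator depends on \<open>y\<close> only through its projections on
  \<open>U 0\<close> to \<open>U (p - 1)\<close>. Components from \<open>p\<close> on vanish on both
  sides by triangularity.\<close>

lemma restricted_ls_eq:
  assumes p: "p \<le> P" and y: "y \<in> carrier_vec N" and i: "i < P"
  shows "restricted_ls X p y $ i = (\<Sum>j<p. T j i * proj (\<lambda>l. y $ l) j) / sqrt (real N)"
proof -
  let ?Xp = "first_cols X p"
  let ?C = "mat p p (\<lambda>(i, k). \<Sum>j<p. T j i * T j k)"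
  let ?B = "transpose_mat ?Xp * ?Xp"
  have Xp: "?Xp \<in> carrier_mat N p" using X by (simp add: first_cols_def)
  have B: "?B \<in> carrier_mat p p" using Xp by simp
  have Xpe: "?Xp $$ (l, a) = X $$ (l, a)" if "l < N" "a < p" for l a
    using that X by (simp add: first_cols_def)
  have Be: "?B $$ (a, b) = real N * gram a b" if "a < p" "b < p" for a b
    using that Xp p PN by (simp add: gram_eq scalar_prod_def lessThan_atLeast0 Xpe)
  have C: "?C \<in> carrier_mat p p" by simp
  have "?B * ((1 / real N) \<cdot>\<^sub>m ?C) = (1 / real N) \<cdot>\<^sub>m (?B * ?C)"
    by (rule mult_smult_distrib[OF B C])
  also have "\<dots> = ((1 / real N) \<cdot>\<^sub>m ?B) * ?C"
    by (rule mult_smult_assoc_mat[OF B C, symmetric])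
  also have "\<dots> = 1\<^sub>m p"
    by (rule leading_block_inverse(1)[OF p]) (use B PN Be in auto)
  finally have "?B * ((1 / real N) \<cdot>\<^sub>m ?C) = 1\<^sub>m p" .
  then have mi: "minv ?B = (1 / real N) \<cdot>\<^sub>m ?C"
    by (intro minv_eqI[OF B]) auto
  have Uj: "(\<Sum>k<p. T j k * X $$ (l, k)) = sqrt (real N) * U j l" if "j < p" "l < N" for j l
  proof -
    have "(\<Sum>k<p. T j k * X $$ (l, k)) = (\<Sum>k<P. T j k * X $$ (l, k))"
      by (intro sum.mono_neutral_left) (use p that T_upper in auto)
    then show ?thesis using PN by (simp add: U_def mult_ac)
  qed
  have "(minv ?B *\<^sub>v (transpose_mat ?Xp *\<^sub>v y)) $ i = (\<Sum>j<p. T j i * proj (\<lambda>l. y $ l) j) / sqrt (real N)" if "i < p"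
  proof -
    have "(minv ?B *\<^sub>v (transpose_mat ?Xp *\<^sub>v y)) $ i =
       (\<Sum>k<p. (1 / real N) * (\<Sum>j<p. T j i * T j k) * (\<Sum>l<N. X $$ (l, k) * y $ l))"
      unfolding mi using that Xp y by (simp add: scalar_prod_def lessThan_atLeast0 Xpe)
    also have "\<dots> = (\<Sum>k<p. \<Sum>j<p. (T j i / real N) * (\<Sum>l<N. T j k * X $$ (l, k) * y $ l))"
      by (simp add: sum_distrib_left sum_distrib_right sum_divide_distrib mult_ac)
    also have "\<dots> = (\<Sum>j<p. \<Sum>k<p. (T j i / real N) * (\<Sum>l<N. T j k * X $$ (l, k) * y $ l))"
      by (rule sum.swap)
    also have "\<dots> = (\<Sum>j<p. (T j i / real N) * (\<Sum>k<p. \<Sum>l<N. T j k * X $$ (l, k) * y $ l))"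
      by (simp add: sum_distrib_left)
    also have "\<dots> = (\<Sum>j<p. (T j i / real N) * (\<Sum>l<N. \<Sum>k<p. T j k * X $$ (l, k) * y $ l))"
      by (rule sum.cong[OF refl], rule arg_cong2[where f="(*)", OF refl], rule sum.swap)
    also have "\<dots> = (\<Sum>j<p. (T j i / real N) * (\<Sum>l<N. sqrt (real N) * U j l * y $ l))"
      by (intro sum.cong refl arg_cong2[where f="(*)"]) (simp only: Uj[symmetric] sum_distrib_right lessThan_iff)
    also have "\<dots> = (\<Sum>j<p. T j i * proj (\<lambda>l. y $ l) j * (sqrt (real N) / real N))"
    proof (rule sum.cong[OF refl])
      fix j
      have "(\<Sum>l<N. sqrt (real N) * U j l * y $ l) = sqrt (real N) * proj (\<lambda>l. y $ l) j"
        unfolding proj_def sum_distrib_left by (simp only: mult.assoc)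
      then show "T j i / real N * (\<Sum>l<N. sqrt (real N) * U j l * y $ l) =
          T j i * proj (\<lambda>l. y $ l) j * (sqrt (real N) / real N)" by simp
    qed
    also have "\<dots> = (\<Sum>j<p. T j i * proj (\<lambda>l. y $ l) j) * (sqrt (real N) / real N)"
      by (rule sum_distrib_right[symmetric])
    also have "sqrt (real N) / real N = inverse (sqrt (real N))"
      by (rule sqrt_divide_self_eq) simp
    finally show ?thesis
      by (simp only: divide_inverse)
  qed
  moreover have "(\<Sum>j<p. T j i * proj (\<lambda>l. y $ l) j) = 0" if "\<not> i < p"
    using that p T_upper by (intro sum.neutral) auto
  ultimately show ?thesis using i by (simp add: restricted_ls_def Let_def)
qed

text \<open>Among the vectors \<open>T j\<close> with \<open>j < p\<close> only the last has a
  nonzero entry at index \<open>p - 1\<close>, so the last diagonal entry of the inverse is a single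
  square.\<close>

lemma xi_eq:
  assumes "0 < p" "p \<le> P"
  shows "xi X p = T (p - 1) (p - 1)"
proof -
  let ?Xp = "first_cols X p"
  have Xp: "?Xp \<in> carrier_mat N p" using X by (simp add: first_cols_def)
  have Xpe: "?Xp $$ (l, a) = X $$ (l, a)" if "l < N" "a < p" for l a
    using that X by (simp add: first_cols_def)
  have "minv ((1 / real N) \<cdot>\<^sub>m (transpose_mat ?Xp * ?Xp)) = mat p p (\<lambda>(i, k). \<Sum>j<p. T j i * T j k)"
    by (rule minv_leading_block) (use assms Xp PN in \<open>auto simp: gram_eq scalar_prod_def lessThan_atLeast0 Xpe\<close>)
  then have "xi X p = sqrt (\<Sum>j<p. T j (p - 1) * T j (p - 1))"
    using assms by (simp add: xi_def Let_def)
  also have "(\<Sum>j<p. T j (p - 1) * T j (p - 1)) = (\<Sum>j<p. if j = p - 1 then (T (p - 1) (p - 1))\<^sup>2 else 0)"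
    by (intro sum.cong refl) (use assms T_upper in \<open>auto simp: power2_eq_square\<close>)
  finally have "xi X p = \<bar>T (p - 1) (p - 1)\<bar>" using assms by simp
  moreover have "0 < T (p - 1) (p - 1)" using assms by (intro T_diag) auto
  ultimately show ?thesis by simp
qed

text \<open>The last component of the restricted estimator involves only the last vector, and its
  factor cancels against \<open>xi\<close>. Up to the common variance estimate, different orders are
  tested with different coordinates.\<close>

lemma test_stat_eq:
  assumes "0 < p" "p \<le> P" "y \<in> carrier_vec N"
  shows "test_stat X p y = proj (\<lambda>l. y $ l) (p - 1) / sigma_hat X y"
proof -
  have "(\<Sum>j<p. T j (p - 1) * proj (\<lambda>l. y $ l) j) = (\<Sum>j<p. if j = p - 1 then T (p - 1) (p - 1) * proj (\<lambda>l. y $ l) (p - 1) else 0)"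
    by (intro sum.cong refl) (use assms T_upper in auto)
  then have "restricted_ls X p y $ (p - 1) = T (p - 1) (p - 1) * proj (\<lambda>l. y $ l) (p - 1) / sqrt (real N)"
    using assms by (simp add: restricted_ls_eq)
  moreover have "0 < T (p - 1) (p - 1)" using assms by (intro T_diag) auto
  ultimately show ?thesis
    using assms PN by (simp add: test_stat_def xi_eq)
qed

text \<open>Pythagoras for the projection on the column space. The residual sum of squares becomes a
  sum that concentrates, minus the squares of \<open>P\<close> Gaussian coordinates.\<close>

lemma sigma_hat_eq:
  assumes \<eta>: "\<eta> \<in> carrier_vec P" and y: "y \<in> carrier_vec N" and u: "\<And>l. l < N \<Longrightarrow> y $ l = (X *\<^sub>v \<eta>) $ l + u l"
  shows "sigma_hat X y = sqrt (((\<Sum>l<N. (u l)\<^sup>2) - (\<Sum>j<P. (proj u j)\<^sup>2)) / (real N - real P))"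
proof -
  let ?r = "restricted_ls X P y"
  have r: "?r \<in> carrier_vec P" by (simp add: restricted_ls_def Let_def)
  have py: "proj (\<lambda>l. y $ l) j = coord \<eta> j + proj u j" for j
  proof -
    have "proj (\<lambda>l. y $ l) j = proj (\<lambda>l. (X *\<^sub>v \<eta>) $ l + u l) j"
      unfolding proj_def by (intro sum.cong refl) (simp add: u)
    then show ?thesis by (simp add: proj_add coord_def)
  qed
  have e: "(y - X *\<^sub>v ?r) $ l = u l - (\<Sum>j<P. U j l * proj u j)" if l: "l < N" for l
  proof -
    have "(X *\<^sub>v ?r) $ l = (\<Sum>a<P. X $$ (l, a) * ((\<Sum>j<P. T j a * proj (\<lambda>l. y $ l) j) / sqrt (real N)))"
      using X r l y by (simp add: scalar_prod_def lessThan_atLeast0 restricted_ls_eq)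
    also have "\<dots> = (\<Sum>a<P. \<Sum>j<P. X $$ (l, a) * T j a * proj (\<lambda>l. y $ l) j / sqrt (real N))"
      by (simp add: sum_distrib_left sum_divide_distrib mult_ac)
    also have "\<dots> = (\<Sum>j<P. \<Sum>a<P. X $$ (l, a) * T j a * proj (\<lambda>l. y $ l) j / sqrt (real N))"
      by (rule sum.swap)
    also have "\<dots> = (\<Sum>j<P. U j l * proj (\<lambda>l. y $ l) j)"
      by (simp add: U_def sum_distrib_right sum_divide_distrib)
    also have "\<dots> = (X *\<^sub>v \<eta>) $ l + (\<Sum>j<P. U j l * proj u j)"
      using fitted_eq[OF \<eta> l] by (simp add: py distrib_left sum.distrib)
    finally show ?thesis using l y u X by simp
  qed
  have "(y - X *\<^sub>v ?r) \<bullet> (y - X *\<^sub>v ?r) = (\<Sum>l<N. (u l - (\<Sum>j<P. U j l * proj u j))\<^sup>2)"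
    using e X y by (simp add: scalar_prod_def lessThan_atLeast0 power2_eq_square)
  also have "\<dots> = (\<Sum>l<N. (u l)\<^sup>2) - 2 * (\<Sum>l<N. \<Sum>j<P. U j l * u l * proj u j) +
      (\<Sum>l<N. (\<Sum>j<P. U j l * proj u j)\<^sup>2)"
    by (simp add: power2_diff sum.distrib sum_subtractf sum_distrib_left mult_ac)
  also have "(\<Sum>l<N. \<Sum>j<P. U j l * u l * proj u j) = (\<Sum>j<P. \<Sum>l<N. U j l * u l * proj u j)"
    by (rule sum.swap)
  also have "\<dots> = (\<Sum>j<P. (proj u j)\<^sup>2)"
    by (simp add: proj_def power2_eq_square flip: sum_distrib_right)
  also note sum_squares_U
  finally have "(vnorm (y - X *\<^sub>v ?r))\<^sup>2 = (\<Sum>l<N. (u l)\<^sup>2) - (\<Sum>j<P. (proj u j)\<^sup>2)"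
    using scalar_prod_self_nonneg[of "y - X *\<^sub>v ?r"] by (simp add: vnorm_def)
  then show ?thesis by (simp add: sigma_hat_def)
qed

lemma selected_order_bounds:
  assumes "c ord = 0" "ord \<le> P"
  shows "ord \<le> selected_order X ord c y" "selected_order X ord c y \<le> P"
    and "c (selected_order X ord c y) \<le> \<bar>test_stat X (selected_order X ord c y) y\<bar>"
proof -
  let ?S = "{p. ord \<le> p \<and> p \<le> P \<and> c p \<le> \<bar>test_stat X p y\<bar>}"
  have "Max ?S \<in> ?S" by (rule Max_in) (use assms in \<open>auto intro!: exI[of _ ord]\<close>)
  then show "ord \<le> selected_order X ord c y" "selected_order X ord c y \<le> P"
    "c (selected_order X ord c y) \<le> \<bar>test_stat X (selected_order X ord c y) y\<bar>"
    by (auto simp: selected_order_def)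
qed

lemma le_selected_order:
  "ord \<le> p \<Longrightarrow> p \<le> P \<Longrightarrow> c p \<le> \<bar>test_stat X p y\<bar> \<Longrightarrow> p \<le> selected_order X ord c y"
proof -
  assume "ord \<le> p" "p \<le> P" "c p \<le> \<bar>test_stat X p y\<bar>"
  then have "p \<in> {p. ord \<le> p \<and> p \<le> dim_col X \<and> c p \<le> \<bar>test_stat X p y\<bar>}" by simp
  moreover have "finite {p. ord \<le> p \<and> p \<le> dim_col X \<and> c p \<le> \<bar>test_stat X p y\<bar>}"
    by (rule finite_subset[of _ "{..dim_col X}"]) auto
  ultimately show ?thesis unfolding selected_order_def by (intro Max_ge)
qed

lemma post_selection_eq:
  assumes "c ord = 0" "ord \<le> P" "i < P"
  shows "post_selection X ord c y $ i = restricted_ls X (selected_order X ord c y) y $ i"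
proof -
  let ?s = "selected_order X ord c y"
  have s: "?s \<in> {ord..P}" using selected_order_bounds[where c=c, OF assms(1,2)] by auto
  have "post_selection X ord c y $ i = (\<Sum>p = ord..P. if p = ?s then restricted_ls X ?s y $ i else 0)"
    using assms by (auto simp: post_selection_def intro!: sum.cong)
  then show ?thesis using s by simp
qed

text \<open>In coordinates the error of the selected estimator is the noise \<open>proj u j\<close>
  below the selected order and the omitted mean \<open>- coord \<eta> j\<close> from there on;
  \<open>A\<close> acts through its inner products with the vectors \<open>T j\<close>.\<close>

lemma scaled_error_le_iff:
  assumes c: "c ord = 0" and ord: "ord \<le> P" and A: "A \<in> carrier_mat k P" and \<eta>: "\<eta> \<in> carrier_vec P"
    and y: "y \<in> carrier_vec N" and t: "t \<in> carrier_vec k" and u: "\<And>l. l < N \<Longrightarrow> y $ l = (X *\<^sub>v \<eta>) $ l + u l"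
  shows "sqrt (real N) \<cdot>\<^sub>v (A *\<^sub>v (post_selection X ord c y - \<eta>)) \<le> t \<longleftrightarrow>
    (\<forall>i<k. (\<Sum>j<selected_order X ord c y. (\<Sum>a<P. A $$ (i, a) * T j a) * proj u j) -
       (\<Sum>j=selected_order X ord c y..<P. (\<Sum>a<P. A $$ (i, a) * T j a) * coord \<eta> j) \<le> t $ i)"
proof -
  let ?s = "selected_order X ord c y"
  let ?B = "\<lambda>i j. \<Sum>a<P. A $$ (i, a) * T j a"
  have s: "?s \<le> P" using selected_order_bounds[where c=c, OF c ord] by auto
  have py: "proj (\<lambda>l. y $ l) j = coord \<eta> j + proj u j" for j
  proof -
    have "proj (\<lambda>l. y $ l) j = proj (\<lambda>l. (X *\<^sub>v \<eta>) $ l + u l) j"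
      unfolding proj_def by (intro sum.cong refl) (simp add: u)
    then show ?thesis by (simp add: proj_add coord_def)
  qed
  have ent: "(sqrt (real N) \<cdot>\<^sub>v (A *\<^sub>v (post_selection X ord c y - \<eta>))) $ i =
      (\<Sum>j<?s. ?B i j * proj u j) - (\<Sum>j=?s..<P. ?B i j * coord \<eta> j)" if i: "i < k" for i
  proof -
    have "(sqrt (real N) \<cdot>\<^sub>v (A *\<^sub>v (post_selection X ord c y - \<eta>))) $ i =
       sqrt (real N) * (\<Sum>a<P. A $$ (i, a) * (post_selection X ord c y $ a - \<eta> $ a))"
      using A \<eta> i by (simp add: scalar_prod_def lessThan_atLeast0 post_selection_def)
    also have "\<dots> = (\<Sum>a<P. A $$ (i, a) * (sqrt (real N) * post_selection X ord c y $ a - sqrt (real N) * \<eta> $ a))"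
      by (simp add: sum_distrib_left algebra_simps)
    also have "\<dots> = (\<Sum>a<P. A $$ (i, a) * ((\<Sum>j<?s. T j a * proj (\<lambda>l. y $ l) j) - (\<Sum>j<P. T j a * coord \<eta> j)))"
      using PN s y c ord \<eta> by (intro sum.cong refl) (simp add: post_selection_eq restricted_ls_eq coord_expand)
    also have "\<dots> = (\<Sum>a<P. \<Sum>j<?s. A $$ (i, a) * T j a * proj (\<lambda>l. y $ l) j) -
        (\<Sum>a<P. \<Sum>j<P. A $$ (i, a) * T j a * coord \<eta> j)"
      by (simp add: right_diff_distrib sum_subtractf sum_distrib_left mult_ac)
    also have "(\<Sum>a<P. \<Sum>j<?s. A $$ (i, a) * T j a * proj (\<lambda>l. y $ l) j) = (\<Sum>j<?s. ?B i j * proj (\<lambda>l. y $ l) j)"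
      by (subst sum.swap) (simp add: sum_distrib_right)
    also have "(\<Sum>a<P. \<Sum>j<P. A $$ (i, a) * T j a * coord \<eta> j) = (\<Sum>j<P. ?B i j * coord \<eta> j)"
      by (subst sum.swap) (simp add: sum_distrib_right)
    also have "(\<Sum>j<P. ?B i j * coord \<eta> j) = (\<Sum>j<?s. ?B i j * coord \<eta> j) + (\<Sum>j=?s..<P. ?B i j * coord \<eta> j)"
      using s by (simp add: lessThan_atLeast0 sum.atLeastLessThan_concat)
    also have "(\<Sum>j<?s. ?B i j * proj (\<lambda>l. y $ l) j) = (\<Sum>j<?s. ?B i j * coord \<eta> j) + (\<Sum>j<?s. ?B i j * proj u j)"
      by (simp add: py distrib_left sum.distrib)
    finally show ?thesis by simp
  qed
  have "sqrt (real N) \<cdot>\<^sub>v (A *\<^sub>v (post_selection X ord c y - \<eta>)) \<le> t \<longleftrightarrow>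
     (\<forall>i<k. (sqrt (real N) \<cdot>\<^sub>v (A *\<^sub>v (post_selection X ord c y - \<eta>))) $ i \<le> t $ i)"
    using A t unfolding less_eq_vec_def by auto
  also have "\<dots> \<longleftrightarrow> (\<forall>i<k. (\<Sum>j<?s. ?B i j * proj u j) - (\<Sum>j=?s..<P. ?B i j * coord \<eta> j) \<le> t $ i)"
    by (intro all_cong1 imp_cong refl) (simp only: ent)
  finally show ?thesis .
qed

end

subsection \<open>Consequences of the rank conditions\<close>

lemma (in vec_space) rank_eq_card_maximal:
  assumes A: "A \<in> carrier_mat n nc"
  obtains S where "S \<subseteq> set (cols A)" "lin_indpt S" "card S = rank A"
proof -
  have "\<exists>S. finite S \<and> maximal S (\<lambda>T. T \<subseteq> set (cols A) \<and> lin_indpt T)"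
    by (rule maximal_exists[of _ "card (set (cols A))" "{}"])
      (auto intro: finite_subset card_mono finite_lin_indpt2 simp: lin_dep_def)
  then obtain S where S: "maximal S (\<lambda>T. T \<subseteq> set (cols A) \<and> lin_indpt T)" by auto
  show thesis using rank_card_indpt[OF A S] S by (intro that[of S]) (auto simp: maximal_def)
qed

text \<open>The rank is the size of a largest independent subset of the set of columns. If it equals
  the number of columns, these are distinct and independent, which excludes a nontrivial
  relation.\<close>

lemma full_column_rank_inj:
  fixes A :: "real mat"
  assumes A: "A \<in> carrier_mat n nc" and r: "vec_space.rank n A = nc"
    and v: "v \<in> carrier_vec nc" and Av: "A *\<^sub>v v = 0\<^sub>v n"
  shows "v = 0\<^sub>v nc"
proof (rule ccontr)
  assume nz: "v \<noteq> 0\<^sub>v nc"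
  interpret vec_space "TYPE(real)" n .
  obtain S where S: "S \<subseteq> set (cols A)" "lin_indpt S" "card S = nc"
    using rank_eq_card_maximal[OF A] r by auto
  have len: "length (cols A) = nc" using A by simp
  have "nc \<le> card (set (cols A))" using S card_mono[of "set (cols A)" S] by simp
  then have c: "card (set (cols A)) = nc" using card_length[of "cols A"] len by simp
  then have dist: "distinct (cols A)" using len by (intro card_distinct) simp
  have "S = set (cols A)" using S c by (intro card_subset_eq) auto
  then show False using lin_depI[OF A v nz Av dist] S(2) by simp
qed

text \<open>Independent columns, \<open>k\<close> in number, form a basis of the
  \<open>k\<close>-dimensional target space.\<close>

lemma full_row_rank_surj:
  fixes A :: "real mat"
  assumes A: "A \<in> carrier_mat k nc" and r: "vec_space.rank k A = k" and y: "y \<in> carrier_vec k"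
  shows "\<exists>v\<in>carrier_vec nc. A *\<^sub>v v = y"
proof -
  interpret vec_space "TYPE(real)" k .
  obtain S where S: "S \<subseteq> set (cols A)" "lin_indpt S" "card S = k"
    using rank_eq_card_maximal[OF A] r by auto
  have sub: "set (cols A) \<subseteq> carrier_vec k" using A cols_dim by blast
  have "basis S"
    by (rule dim_li_is_basis) (use S sub fin_dim finite_subset[OF S(1)] in \<open>auto simp: dim_is_n\<close>)
  then have "span S = carrier_vec k" by (simp add: basis_def)
  moreover have "span S \<subseteq> span (set (cols A))" by (rule span_is_monotone[OF S(1)])
  ultimately have "y \<in> col_space A" using y by (auto simp: col_space_def)
  then show ?thesis using col_space_eq[OF A] A by auto
qed

lemma regressors_design:
  assumes "regressors P Q X" "P < n"
  shows "design (X n) n P"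
proof
  show X: "X n \<in> carrier_mat n P" and "P < n" using assms by (auto simp: regressors_def)
  fix v :: "nat \<Rightarrow> real" assume v: "\<exists>a<P. v a \<noteq> 0"
  have r: "vec_space.rank n (X n) = P" using assms by (auto simp: regressors_def)
  show "\<exists>l<n. (\<Sum>a<P. X n $$ (l, a) * v a) \<noteq> 0"
  proof (rule ccontr)
    assume "\<not> ?thesis"
    then have "X n *\<^sub>v vec P v = 0\<^sub>v n"
      using X by (intro eq_vecI) (auto simp: scalar_prod_def lessThan_atLeast0)
    from full_column_rank_inj[OF X r _ this] have "vec P v = 0\<^sub>v P" by simp
    then have "v a = 0" if "a < P" for a using that by (metis index_vec index_zero_vec(1))
    then show False using v by auto
  qed
qed

lemma tendsto_gram:
  assumes "regressors P Q X" "a < P" "b < P"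
  shows "(\<lambda>n. design.gram (X n) n a b) \<longlonglongrightarrow> Q $$ (a, b)"
proof -
  have "\<forall>\<^sub>F n in sequentially. design.gram (X n) n a b = (transpose_mat (X n) * X n) $$ (a, b) / real n"
    using eventually_gt_at_top[of P]
  proof eventually_elim
    case (elim n)
    interpret design "X n" n P by (rule regressors_design[OF assms(1) elim])
    show ?case by (simp add: gram_def)
  qed
  moreover have "(\<lambda>n. (transpose_mat (X n) * X n) $$ (a, b) / real n) \<longlonglongrightarrow> Q $$ (a, b)"
    using assms by (simp add: regressors_def)
  ultimately show ?thesis by (simp add: filterlim_cong)
qed

text \<open>Since the form vanishes at \<open>v\<close>, its value at \<open>e - s * v\<close>, for
  the unit vector \<open>e\<close> of index \<open>a\<close>, is affine in \<open>s\<close> with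
  slope \<open>- 2 * g\<close>. A nonzero slope contradicts nonnegativity.\<close>

lemma psd_null_vector:
  fixes G :: "nat \<Rightarrow> nat \<Rightarrow> real"
  assumes sym: "\<And>a b. a < n \<Longrightarrow> b < n \<Longrightarrow> G a b = G b a"
    and psd: "\<And>v. 0 \<le> qform n G v v" and v0: "qform n G v v = 0" and a: "a < n"
  shows "(\<Sum>b<n. G a b * v b) = 0"
proof (rule ccontr)
  define e where "e = (\<lambda>i. of_bool (i = a) :: real)"
  define g where "g = (\<Sum>b<n. G a b * v b)"
  assume "(\<Sum>b<n. G a b * v b) \<noteq> 0"
  then have g: "g \<noteq> 0" by (simp add: g_def)
  have comm: "qform n G x y = qform n G y x" for x y
  proof -
    have "qform n G x y = (\<Sum>b<n. \<Sum>a<n. x a * G a b * y b)"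
      unfolding qform_def by (rule sum.swap)
    also have "\<dots> = qform n G y x"
      unfolding qform_def by (intro sum.cong refl) (simp add: sym)
    finally show ?thesis .
  qed
  have ev: "qform n G e v = g" unfolding e_def g_def using a by (rule qform_unit)
  \<comment> \<open>Chosen so that the form takes the value \<open>- qform n G e e - 2\<close>,
    which is negative.\<close>
  define s where "s = (qform n G e e + 1) / g"
  have d: "qform n G (\<lambda>i. e i - s * v i) w = qform n G e w - s * qform n G v w" for w
  proof -
    have "qform n G (\<lambda>i. s * v i) w = s * qform n G v w"
      by (simp add: qform_def sum_distrib_left mult_ac)
    then show ?thesis by (simp add: qform_diff_left)
  qed
  have "qform n G (\<lambda>i. e i - s * v i) (\<lambda>i. e i - s * v i) = qform n G e e - 2 * s * g"
  proof -
    have "qform n G e (\<lambda>i. e i - s * v i) = qform n G e e - s * g"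
      using comm[of e "\<lambda>i. e i - s * v i"] d[of e] comm[of v e] ev by simp
    moreover have "qform n G v (\<lambda>i. e i - s * v i) = g"
      using comm[of v "\<lambda>i. e i - s * v i"] d[of v] v0 ev by simp
    ultimately show ?thesis using d[of "\<lambda>i. e i - s * v i"] by simp
  qed
  also have "s * g = qform n G e e + 1" using g by (simp add: s_def)
  then have "qform n G e e - 2 * s * g = - qform n G e e - 2" by simp
  finally show False using psd[of "\<lambda>i. e i - s * v i"] psd[of e] by simp
qed

text \<open>Symmetry and nonnegativity pass from the Gram matrices to the limit. A vector at which
  the form vanishes lies in the kernel of \<open>Q\<close>, which is trivial by
  invertibility.\<close>

lemma regressors_pos_def:
  assumes reg: "regressors P Q X" and Q: "Q \<in> carrier_mat P P" and inv: "invertible_mat Q"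
  shows "pos_def_form P (\<lambda>a b. Q $$ (a, b))"
proof
  let ?G = "\<lambda>a b. Q $$ (a, b)"
  have ev: "\<forall>\<^sub>F n in sequentially. P < n" by (rule eventually_gt_at_top)
  show sym: "?G a b = ?G b a" if "a < P" "b < P" for a b
  proof (rule LIMSEQ_unique)
    show "(\<lambda>n. design.gram (X n) n a b) \<longlonglongrightarrow> Q $$ (a, b)" using that by (rule tendsto_gram[OF reg])
    have "\<forall>\<^sub>F n in sequentially. design.gram (X n) n b a = design.gram (X n) n a b"
      using ev
    proof eventually_elim
      case (elim n)
      interpret design "X n" n P by (rule regressors_design[OF reg elim])
      show ?case using that by (simp add: sym)
    qed
    then show "(\<lambda>n. design.gram (X n) n a b) \<longlonglongrightarrow> Q $$ (b, a)"
      using tendsto_gram[OF reg that(2,1)] by (rule Lim_transform_eventually[rotated])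
  qed
  have psd: "0 \<le> qform P ?G v v" for v
  proof (rule tendsto_lowerbound)
    show "(\<lambda>n. qform P (design.gram (X n) n) v v) \<longlonglongrightarrow> qform P ?G v v"
      unfolding qform_def by (intro tendsto_intros tendsto_gram[OF reg]) auto
    show "\<forall>\<^sub>F n in sequentially. 0 \<le> qform P (design.gram (X n) n) v v"
      using ev
    proof eventually_elim
      case (elim n)
      interpret design "X n" n P by (rule regressors_design[OF reg elim])
      show ?case by (simp add: qform_gram sum_nonneg)
    qed
  qed simp
  fix v :: "nat \<Rightarrow> real" assume v: "\<exists>a<P. v a \<noteq> 0"
  have "qform P ?G v v \<noteq> 0"
  proof
    assume "qform P ?G v v = 0"
    then have z: "(\<Sum>b<P. Q $$ (a, b) * v b) = 0" if "a < P" for a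
      using psd_null_vector[OF sym psd _ that] by blast
    have Qv: "Q *\<^sub>v vec P v = 0\<^sub>v P"
      using Q z by (intro eq_vecI) (auto simp: scalar_prod_def lessThan_atLeast0)
    obtain R where R: "inverts_mat Q R" "inverts_mat R Q" using inv by (auto simp: invertible_mat_def)
    then have QR: "Q * R = 1\<^sub>m P" and RQ: "R * Q = 1\<^sub>m (dim_row R)" using Q by (auto simp: inverts_mat_def)
    have "dim_col (Q * R) = P" "dim_col (R * Q) = dim_row R" unfolding QR RQ by auto
    then have dR: "dim_row R = P" "dim_col R = P" using Q by auto
    then have Rc: "R \<in> carrier_mat P P" using dR by auto
    have "vec P v = (R * Q) *\<^sub>v vec P v" by (simp add: RQ dR)
    also have "\<dots> = R *\<^sub>v (Q *\<^sub>v vec P v)" using Rc Q by (intro assoc_mult_mat_vec) auto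
    also have "\<dots> = 0\<^sub>v P" unfolding Qv using Rc by (intro eq_vecI) auto
    finally have "v a = 0" if "a < P" for a using that by (metis index_vec index_zero_vec(1))
    then show False using v by auto
  qed
  then show "0 < qform P ?G v v" using psd[of v] by linarith
qed

subsection \<open>The law of the sample in canonical coordinates\<close>

lemma indep_vars_PiM_gauss:
  fixes \<mu> :: "nat \<Rightarrow> real"
  assumes \<sigma>: "0 < \<sigma>" and N: "0 < N"
  defines "M \<equiv> PiM {..<N} (\<lambda>i. gauss (\<mu> i) \<sigma>)"
  shows "prob_space.indep_vars M (\<lambda>_. borel) (\<lambda>i Y. Y i - \<mu> i) {..<N}"
    and "i < N \<Longrightarrow> distr M borel (\<lambda>Y. Y i - \<mu> i) = gauss 0 \<sigma>"
proof -
  have ps: "prob_space (gauss (\<mu> i) \<sigma>)" for i using \<sigma> by (rule prob_space_normal_density)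
  interpret prob_space M unfolding M_def by (intro prob_space_PiM ps)
  have comp: "distr M (gauss (\<mu> i) \<sigma>) (\<lambda>Y. Y i) = gauss (\<mu> i) \<sigma>" if "i < N" for i
    unfolding M_def using that ps by (intro distr_PiM_component) auto
  have rv: "(\<lambda>Y. Y i) \<in> measurable M (gauss (\<mu> i) \<sigma>)" if "i \<in> {..<N}" for i
    unfolding M_def using that by (rule measurable_component_singleton)
  have "indep_vars (\<lambda>i. gauss (\<mu> i) \<sigma>) (\<lambda>i Y. Y i) {..<N}"
  proof (subst indep_vars_iff_distr_eq_PiM')
    show "{..<N} \<noteq> {}" using N by auto
    have "distr M (PiM {..<N} (\<lambda>i. gauss (\<mu> i) \<sigma>)) (\<lambda>Y. \<lambda>i\<in>{..<N}. Y i) = distr M M (\<lambda>Y. Y)"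
      by (rule distr_cong) (auto simp: M_def space_PiM PiE_iff extensional_restrict)
    also have "\<dots> = M" by (rule distr_id)
    also have "\<dots> = PiM {..<N} (\<lambda>i. distr M (gauss (\<mu> i) \<sigma>) (\<lambda>Y. Y i))"
      unfolding M_def[symmetric] using comp by (subst M_def, intro PiM_cong) auto
    finally show "distr M (PiM {..<N} (\<lambda>i. gauss (\<mu> i) \<sigma>)) (\<lambda>Y. \<lambda>i\<in>{..<N}. Y i) =
      PiM {..<N} (\<lambda>i. distr M (gauss (\<mu> i) \<sigma>) (\<lambda>Y. Y i))" .
  qed (rule rv)
  then show "indep_vars (\<lambda>_. borel) (\<lambda>i Y. Y i - \<mu> i) {..<N}"
    by (rule indep_vars_compose2) auto
  assume i: "i < N"
  have "distr M borel (\<lambda>Y. Y i - \<mu> i) = distr (distr M (gauss (\<mu> i) \<sigma>) (\<lambda>Y. Y i)) borel (\<lambda>x. x - \<mu> i)"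
    using rv[of i] i by (subst distr_distr) (auto simp: comp_def)
  also have "\<dots> = distr (gauss (\<mu> i) \<sigma>) borel (\<lambda>x. x - \<mu> i)" by (simp only: comp[OF i])
  also have "\<dots> = gauss 0 \<sigma>"
    using distr_gauss_affine[OF \<sigma>, of 1 "\<mu> i" "- \<mu> i"] by simp
  finally show "distr M borel (\<lambda>Y. Y i - \<mu> i) = gauss 0 \<sigma>" .
qed

context design
begin

definition resid :: "real vec \<Rightarrow> (nat \<Rightarrow> real) \<Rightarrow> nat \<Rightarrow> real" where
  "resid \<eta> Y l = Y l - (X *\<^sub>v \<eta>) $ l"

lemma sample_law_eq: "sample_law X \<eta> \<sigma> = PiM {..<N} (\<lambda>i. gauss ((X *\<^sub>v \<eta>) $ i) \<sigma>)"
  by (simp add: sample_law_def)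

lemma prob_space_sample_law: "0 < \<sigma> \<Longrightarrow> prob_space (sample_law X \<eta> \<sigma>)"
  unfolding sample_law_eq by (intro prob_space_PiM prob_space_normal_density)

lemma sets_sample_law: "sets (sample_law X \<eta> \<sigma>) = sets (PiM {..<N} (\<lambda>_. borel))"
  and space_sample_law: "space (sample_law X \<eta> \<sigma>) = space (PiM {..<N} (\<lambda>_. borel :: real measure))"
  unfolding sample_law_eq by (auto simp: space_PiM intro!: sets_PiM_cong)

lemma resid_measurable: "l < N \<Longrightarrow> (\<lambda>Y. resid \<eta> Y l) \<in> borel_measurable (sample_law X \<eta>' \<sigma>)"
proof -
  assume "l < N"
  then have "(\<lambda>Y. Y l) \<in> borel_measurable (PiM {..<N} (\<lambda>_. borel :: real measure))"
    by (intro measurable_component_singleton) auto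
  then have [measurable]: "(\<lambda>Y. Y l) \<in> borel_measurable (sample_law X \<eta>' \<sigma>)"
    by (simp add: measurable_cong_sets[OF sets_sample_law refl])
  show ?thesis unfolding resid_def by measurable
qed

lemma proj_resid_measurable: "(\<lambda>Y. proj (resid \<eta> Y) j) \<in> borel_measurable (sample_law X \<eta>' \<sigma>)"
  unfolding proj_def by (intro borel_measurable_sum borel_measurable_times resid_measurable) auto

lemma distr_proj_resid:
  assumes \<sigma>: "0 < \<sigma>"
  shows "distr (sample_law X \<eta> \<sigma>) (PiM {..<P} (\<lambda>_. borel)) (\<lambda>Y. \<lambda>j\<in>{..<P}. proj (resid \<eta> Y) j) =
    PiM {..<P} (\<lambda>_. gauss 0 \<sigma>)"
proof -
  interpret prob_space "sample_law X \<eta> \<sigma>" using \<sigma> by (rule prob_space_sample_law)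
  have N: "0 < N" using PN by simp
  show ?thesis unfolding proj_def resid_def
  proof (rule distr_orthonormal_gauss[OF \<sigma>])
    show "indep_vars (\<lambda>_. borel) (\<lambda>l Y. Y l - (X *\<^sub>v \<eta>) $ l) {..<N}"
      unfolding sample_law_eq by (rule indep_vars_PiM_gauss(1)[OF \<sigma> N])
    show "distr (sample_law X \<eta> \<sigma>) borel (\<lambda>Y. Y l - (X *\<^sub>v \<eta>) $ l) = gauss 0 \<sigma>" if "l \<in> {..<N}" for l
      unfolding sample_law_eq using that by (intro indep_vars_PiM_gauss(2)[OF \<sigma> N]) auto
  qed (auto simp: U_orthonormal)
qed

lemma sum_squares_resid_concentration:
  fixes \<sigma> a :: real
  assumes \<sigma>: "0 < \<sigma>" and a: "0 < a"
  shows "measure (sample_law X \<eta> \<sigma>) {Y\<in>space (sample_law X \<eta> \<sigma>). a \<le> \<bar>(\<Sum>l<N. (resid \<eta> Y l)\<^sup>2) - real N * \<sigma>\<^sup>2\<bar>}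
    \<le> 2 * \<sigma> ^ 4 * real N / a\<^sup>2"
proof -
  interpret prob_space "sample_law X \<eta> \<sigma>" using \<sigma> by (rule prob_space_sample_law)
  have N: "0 < N" using PN by simp
  have "prob {Y\<in>space (sample_law X \<eta> \<sigma>). a \<le> \<bar>(\<Sum>l\<in>{..<N}. (resid \<eta> Y l)\<^sup>2) - card {..<N} * \<sigma>\<^sup>2\<bar>}
    \<le> 2 * \<sigma> ^ 4 * card {..<N} / a\<^sup>2"
  proof (rule concentration_sum_squares_gauss[OF \<sigma> _ a])
    show "indep_vars (\<lambda>_. borel) (\<lambda>l Y. resid \<eta> Y l) {..<N}"
      unfolding sample_law_eq resid_def by (rule indep_vars_PiM_gauss(1)[OF \<sigma> N])
    show "distr (sample_law X \<eta> \<sigma>) borel (\<lambda>Y. resid \<eta> Y l) = gauss 0 \<sigma>" if "l \<in> {..<N}" for l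
      unfolding sample_law_eq resid_def using that by (intro indep_vars_PiM_gauss(2)[OF \<sigma> N]) auto
  qed simp
  then show ?thesis by simp
qed

text \<open>Replaces the maximum by finitely many comparisons, from which the measurability of the
  selection can be derived.\<close>

lemma selected_order_eq_iff:
  assumes "c ord = 0" "ord \<le> P"
  shows "selected_order X ord c y = p \<longleftrightarrow>
    p \<in> {ord..P} \<and> c p \<le> \<bar>test_stat X p y\<bar> \<and> (\<forall>p'\<in>{p<..P}. \<not> c p' \<le> \<bar>test_stat X p' y\<bar>)"
proof
  show "selected_order X ord c y = p \<Longrightarrow> p \<in> {ord..P} \<and> c p \<le> \<bar>test_stat X p y\<bar> \<and> (\<forall>p'\<in>{p<..P}. \<not> c p' \<le> \<bar>test_stat X p' y\<bar>)"
  proof -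
    assume s: "selected_order X ord c y = p"
    note b = selected_order_bounds[where c=c, OF assms, of y, unfolded s]
    have "\<not> c p' \<le> \<bar>test_stat X p' y\<bar>" if "p' \<in> {p<..P}" for p'
    proof
      assume "c p' \<le> \<bar>test_stat X p' y\<bar>"
      then have "p' \<le> p" using le_selected_order[of ord p' c y] b(1) that by (simp add: s)
      then show False using that by simp
    qed
    then show ?thesis using b by simp
  qed
next
  assume p: "p \<in> {ord..P} \<and> c p \<le> \<bar>test_stat X p y\<bar> \<and> (\<forall>p'\<in>{p<..P}. \<not> c p' \<le> \<bar>test_stat X p' y\<bar>)"
  show "selected_order X ord c y = p"
    unfolding selected_order_def
  proof (rule Max_eqI)
    show "finite {p. ord \<le> p \<and> p \<le> dim_col X \<and> c p \<le> \<bar>test_stat X p y\<bar>}"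
      by (rule finite_subset[of _ "{..dim_col X}"]) auto
  qed (use p in \<open>auto simp: not_le[symmetric]\<close>)
qed

lemma vec_resid: "l < N \<Longrightarrow> vec N Y $ l = (X *\<^sub>v \<eta>) $ l + resid \<eta> Y l"
  by (simp add: resid_def)

lemma proj_vec: "proj (\<lambda>l. vec N Y $ l) j = coord \<eta> j + proj (resid \<eta> Y) j"
proof -
  have "proj (\<lambda>l. vec N Y $ l) j = proj (\<lambda>l. (X *\<^sub>v \<eta>) $ l + resid \<eta> Y l) j"
    unfolding proj_def by (intro sum.cong refl) (simp only: lessThan_iff vec_resid[where \<eta>=\<eta>])
  then show ?thesis by (simp add: proj_add coord_def)
qed

lemma sigma_hat_vec:
  "\<eta> \<in> carrier_vec P \<Longrightarrow> sigma_hat X (vec N Y) =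
     sqrt (((\<Sum>l<N. (resid \<eta> Y l)\<^sup>2) - (\<Sum>j<P. (proj (resid \<eta> Y) j)\<^sup>2)) / (real N - real P))"
  by (rule sigma_hat_eq[OF _ vec_carrier vec_resid])

lemma test_stat_measurable:
  assumes "p \<le> P" "\<eta> \<in> carrier_vec P"
  shows "(\<lambda>Y. test_stat X p (vec N Y)) \<in> borel_measurable (sample_law X \<eta> \<sigma>)"
proof (cases "p = 0")
  case True
  then show ?thesis by (simp add: test_stat_def)
next
  case False
  have e: "test_stat X p (vec N Y) = (coord \<eta> (p - 1) + proj (resid \<eta> Y) (p - 1)) /
      sqrt (((\<Sum>l<N. (resid \<eta> Y l)\<^sup>2) - (\<Sum>j<P. (proj (resid \<eta> Y) j)\<^sup>2)) / (real N - real P))" for Y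
    using False assms by (simp add: test_stat_eq sigma_hat_vec proj_vec[of Y _ \<eta>])
  have "(\<lambda>Y. \<Sum>l<N. (resid \<eta> Y l)\<^sup>2) \<in> borel_measurable (sample_law X \<eta> \<sigma>)"
    by (intro borel_measurable_sum borel_measurable_power resid_measurable) auto
  moreover have "(\<lambda>Y. \<Sum>j<P. (proj (resid \<eta> Y) j)\<^sup>2) \<in> borel_measurable (sample_law X \<eta> \<sigma>)"
    by (intro borel_measurable_sum borel_measurable_power proj_resid_measurable)
  ultimately show ?thesis
    unfolding e using proj_resid_measurable[of \<eta> "p - 1" \<eta> \<sigma>] by measurable
qed

text \<open>Splitting by the selected order gives a finite union of events expressed by coordinates
  and test statistics. Without measurability \<open>post_cdf\<close> would not be a probability, as
  \<open>measure\<close> is 0 outside the sigma algebra.\<close>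

lemma error_event_measurable:
  assumes c: "c ord = 0" and ord: "ord \<le> P" and A: "A \<in> carrier_mat k P" and \<eta>: "\<eta> \<in> carrier_vec P"
    and t: "t \<in> carrier_vec k"
  shows "{Y\<in>space (sample_law X \<eta> \<sigma>). sqrt (real N) \<cdot>\<^sub>v (A *\<^sub>v (post_selection X ord c (vec N Y) - \<eta>)) \<le> t}
     \<in> sets (sample_law X \<eta> \<sigma>)"
proof -
  let ?M = "sample_law X \<eta> \<sigma>"
  let ?B = "\<lambda>i j. \<Sum>a<P. A $$ (i, a) * T j a"
  define F where "F = (\<lambda>p Y. \<forall>i\<in>{..<k}. (\<Sum>j<p. ?B i j * proj (resid \<eta> Y) j) - (\<Sum>j=p..<P. ?B i j * coord \<eta> j) \<le> t $ i)"
  have iff: "sqrt (real N) \<cdot>\<^sub>v (A *\<^sub>v (post_selection X ord c (vec N Y) - \<eta>)) \<le> t \<longleftrightarrow>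
    (\<exists>p\<in>{ord..P}. c p \<le> \<bar>test_stat X p (vec N Y)\<bar> \<and>
       (\<forall>p'\<in>{p<..P}. \<not> c p' \<le> \<bar>test_stat X p' (vec N Y)\<bar>) \<and> F p Y)" for Y
  proof -
    have "sqrt (real N) \<cdot>\<^sub>v (A *\<^sub>v (post_selection X ord c (vec N Y) - \<eta>)) \<le> t \<longleftrightarrow>
        F (selected_order X ord c (vec N Y)) Y"
      using scaled_error_le_iff[where c=c and ord=ord and u="resid \<eta> Y", OF c ord A \<eta> vec_carrier t, OF vec_resid]
      by (simp add: F_def Ball_def)
    also have "\<dots> \<longleftrightarrow> (\<exists>p\<in>{ord..P}. c p \<le> \<bar>test_stat X p (vec N Y)\<bar> \<and>
       (\<forall>p'\<in>{p<..P}. \<not> c p' \<le> \<bar>test_stat X p' (vec N Y)\<bar>) \<and> F p Y)" (is "F ?s Y \<longleftrightarrow> ?R")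
    proof
      assume F: "F ?s Y"
      show ?R
        using selected_order_eq_iff[where c=c, OF c ord, of "vec N Y" ?s, THEN iffD1, OF refl] F
        by (intro bexI[of _ ?s]) simp_all
    next
      assume ?R
      then obtain p where p: "p \<in> {ord..P}" "c p \<le> \<bar>test_stat X p (vec N Y)\<bar>"
          "\<forall>p'\<in>{p<..P}. \<not> c p' \<le> \<bar>test_stat X p' (vec N Y)\<bar>" "F p Y"
        by blast
      have "?s = p"
        using selected_order_eq_iff[where c=c, OF c ord, of "vec N Y" p] p(1-3) by simp
      then show "F ?s Y" using p(4) by simp
    qed
    finally show ?thesis .
  qed
  have [measurable]: "Measurable.pred ?M (F p)" for p
  proof -
    have "(\<lambda>Y. \<Sum>j<p. ?B i j * proj (resid \<eta> Y) j) \<in> borel_measurable ?M" for i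
      by (intro borel_measurable_sum borel_measurable_times proj_resid_measurable) auto
    then show ?thesis unfolding F_def by measurable
  qed
  have [measurable]: "(\<lambda>Y. test_stat X p (vec N Y)) \<in> borel_measurable ?M" if "p \<le> P" for p
    using test_stat_measurable[OF that \<eta>] .
  have 1: "Measurable.pred ?M (\<lambda>Y. c p \<le> \<bar>test_stat X p (vec N Y)\<bar>)" if "p \<le> P" for p
    using that by measurable
  have "Measurable.pred ?M (\<lambda>Y. \<exists>p\<in>{ord..P}. c p \<le> \<bar>test_stat X p (vec N Y)\<bar> \<and>
       (\<forall>p'\<in>{p<..P}. \<not> c p' \<le> \<bar>test_stat X p' (vec N Y)\<bar>) \<and> F p Y)"
    by (intro pred_intros_finite pred_intros_logic 1) auto
  then show ?thesis unfolding iff by measurable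
qed

lemma fitted_diff_norm:
  assumes "\<eta> \<in> carrier_vec P" "\<eta>' \<in> carrier_vec P"
  shows "(\<Sum>l<N. ((X *\<^sub>v \<eta>') $ l - (X *\<^sub>v \<eta>) $ l)\<^sup>2) = (\<Sum>j<P. (coord \<eta>' j - coord \<eta> j)\<^sup>2)"
proof -
  have "(\<Sum>l<N. ((X *\<^sub>v \<eta>') $ l - (X *\<^sub>v \<eta>) $ l)\<^sup>2) = (\<Sum>l<N. (\<Sum>j<P. U j l * (coord \<eta>' j - coord \<eta> j))\<^sup>2)"
    by (intro sum.cong refl) (simp only: lessThan_iff fitted_eq[OF assms(1)] fitted_eq[OF assms(2)] right_diff_distrib sum_subtractf)
  then show ?thesis by (simp only: sum_squares_U)
qed

text \<open>The family \<open>U\<close> is orthonormal, so the squared distance of the mean vectors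
  is that of the coordinates, and the comparison depends on the parameters through these
  alone.\<close>

lemma sample_law_compare:
  assumes \<sigma>: "0 < \<sigma>" and l: "0 < l" and E: "E \<in> sets (PiM {..<N} (\<lambda>_. borel))"
    and \<eta>: "\<eta> \<in> carrier_vec P" "\<eta>' \<in> carrier_vec P"
  shows "2 * (measure (sample_law X \<eta>' \<sigma>) E - \<alpha> * measure (sample_law X \<eta> \<sigma>) E) \<le>
    l * (exp ((\<Sum>j<P. (coord \<eta>' j - coord \<eta> j)\<^sup>2) / \<sigma>\<^sup>2) - 2 * \<alpha> + \<alpha>\<^sup>2) + measure (sample_law X \<eta> \<sigma>) E / l"
  using measure_PiM_gauss_compare[OF finite_lessThan \<sigma> E l, of "\<lambda>l. (X *\<^sub>v \<eta>') $ l" \<alpha> "\<lambda>l. (X *\<^sub>v \<eta>) $ l"]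
  by (simp only: sample_law_eq fitted_diff_norm[OF \<eta>])

end

subsection \<open>Convergence to the limit experiment\<close>

lemma (in prob_space) prob_diff_le:
  assumes E: "E \<in> events" and F: "F \<in> events" and B: "B \<in> events"
    and eq: "\<And>\<omega>. \<omega> \<in> space M \<Longrightarrow> \<omega> \<notin> B \<Longrightarrow> \<omega> \<in> E \<longleftrightarrow> \<omega> \<in> F"
  shows "\<bar>prob E - prob F\<bar> \<le> prob B"
proof -
  have "prob E \<le> prob (F \<union> B)" "prob F \<le> prob (E \<union> B)"
    using E F B eq sets.sets_into_space by (intro finite_measure_mono sets.Un; blast)+
  then show ?thesis
    using measure_Un_le[OF F B] measure_Un_le[OF E B] by linarith
qed

lemma eventually_concentration:
  fixes a K e :: real
  assumes "0 < a" "0 < e"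
  shows "\<forall>\<^sub>F n in sequentially. K \<le> a * (real n - real P) \<and> C * real n / (a * (real n - real P))\<^sup>2 \<le> e \<and> P < n"
proof (intro eventually_conj)
  have lin: "filterlim (\<lambda>n. a * (real n - real P)) at_top sequentially"
    using assms(1) by real_asymp
  then show "\<forall>\<^sub>F n in sequentially. K \<le> a * (real n - real P)"
    by (simp add: filterlim_at_top)
  have "(\<lambda>n. C * (real n / (real n - real P)\<^sup>2) / a\<^sup>2) \<longlonglongrightarrow> C * 0 / a\<^sup>2"
  proof (intro tendsto_intros)
    show "(\<lambda>n. real n / (real n - real P)\<^sup>2) \<longlonglongrightarrow> 0" by real_asymp
  qed (use assms in auto)
  then have "(\<lambda>n. C * real n / (a * (real n - real P))\<^sup>2) \<longlonglongrightarrow> 0"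
    by (simp add: power_mult_distrib mult.commute)
  then have "\<forall>\<^sub>F n in sequentially. C * real n / (a * (real n - real P))\<^sup>2 < e"
    using assms(2) by (rule order_tendstoD)
  then show "\<forall>\<^sub>F n in sequentially. C * real n / (a * (real n - real P))\<^sup>2 \<le> e"
    by eventually_elim simp
  show "\<forall>\<^sub>F n in sequentially. P < n" by (rule eventually_gt_at_top)
qed

lemma sqrt_close:
  fixes s :: real
  assumes "0 < s" "\<bar>r - s\<^sup>2\<bar> \<le> e * s" "0 \<le> e" "e < s"
  shows "\<bar>sqrt r - s\<bar> \<le> e" "0 < sqrt r"
proof -
  have "e * s < s * s" using assms by (intro mult_strict_right_mono) auto
  then have r: "0 < r" using assms(2) by (auto simp: power2_eq_square abs_le_iff)
  then show "0 < sqrt r" by simp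
  have "\<bar>sqrt r - s\<bar> * s \<le> \<bar>sqrt r - s\<bar> * (sqrt r + s)"
    using r by (intro mult_left_mono) auto
  also have "\<dots> = \<bar>(sqrt r - s) * (sqrt r + s)\<bar>" using r assms(1) by (simp add: abs_mult)
  also have "(sqrt r - s) * (sqrt r + s) = r - s\<^sup>2"
    using r by (simp add: algebra_simps power2_eq_square)
  finally have "\<bar>sqrt r - s\<bar> * s \<le> e * s" using assms(2) by linarith
  then show "\<bar>sqrt r - s\<bar> \<le> e" using assms(1) by simp
qed

definition (in design) scaled_coeff :: "real mat \<Rightarrow> nat \<Rightarrow> nat \<Rightarrow> real" where
  "scaled_coeff A i j = (\<Sum>a<P. A $$ (i, a) * T j a)"

text \<open>Design and parameter are quantified inside, so that \<open>K\<close>,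
  \<open>\<delta>\<close> and the threshold for \<open>n\<close> can be chosen before them. The
  condition on the coordinate \<open>q - 1\<close> is imposed only for \<open>ord < q\<close>, since
  otherwise no order below \<open>q\<close> competes.\<close>

definition (in limit_experiment) cdf_close ::
  "real mat \<Rightarrow> nat \<Rightarrow> (nat \<Rightarrow> real) \<Rightarrow> real vec \<Rightarrow> real \<Rightarrow> real \<Rightarrow> real \<Rightarrow> real \<Rightarrow> nat \<Rightarrow> bool" where
  "cdf_close A ord c tv x K \<delta> e n \<longleftrightarrow> (\<forall>X \<eta>.
     design X n P \<longrightarrow> (\<forall>i<k. \<forall>j<P. \<bar>design.scaled_coeff X n P A i j - B i j\<bar> \<le> \<delta>) \<longrightarrow>
     \<eta> \<in> carrier_vec P \<longrightarrow> design.coord X n P \<eta> q = x \<longrightarrow> (\<forall>j. q < j \<longrightarrow> j < P \<longrightarrow> design.coord X n P \<eta> j = 0) \<longrightarrow>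
     (ord < q \<longrightarrow> K \<le> \<bar>design.coord X n P \<eta> (q - 1)\<bar>) \<longrightarrow>
     \<bar>post_cdf X A ord c \<eta> \<sigma> tv - limit_prob x\<bar> \<le> e)"

text \<open>The noise coordinates have exactly the law \<open>noise\<close> for every
  \<open>n\<close>, so both events live on the sample space. They coincide outside
  \<open>C1\<close>, where the sum of squared errors deviates, and \<open>C2\<close>, where the
  noise is near a boundary; each of these has probability at most \<open>e / 2\<close>.\<close>

lemma (in limit_experiment) post_cdf_close:
  fixes A :: "real mat" and c :: "nat \<Rightarrow> real" and tv :: "real vec"
  assumes x: "x \<notin> exceptional" and e: "0 < e"
    and c: "c ord = 0" and ord: "ord \<le> q" and A: "A \<in> carrier_mat k P"
    and dc: "\<And>j. d j = c (Suc j)" and tv: "tv \<in> carrier_vec k" "\<And>i. t i = tv $ i"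
    and B0: "\<And>i j. i < k \<Longrightarrow> q < j \<Longrightarrow> j < P \<Longrightarrow> B i j = 0"
  shows "\<exists>K>0. \<exists>\<delta>>0. \<forall>\<^sub>F n in sequentially. cdf_close A ord c tv x K \<delta> e n"
proof -
  obtain h where h: "0 < h" "measure noise {w\<in>space noise. near_boundary x h w} < e / 2"
    using near_boundary_small[OF x, of "e / 2"] e by auto
  have ordP: "ord \<le> P" using ord qP by simp
  define Dm where "Dm = (\<Sum>j<P. \<bar>d j\<bar>)"
  have Dm: "0 \<le> Dm" "\<And>j. j < P \<Longrightarrow> \<bar>d j\<bar> \<le> Dm"
    unfolding Dm_def by (auto intro!: sum_nonneg member_le_sum)
  \<comment> \<open>Accuracy demanded of the variance estimate: critical values then move by at most
    \<open>Dm * s0 \<le> h\<close>, and the estimate stays positive and below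
    \<open>2 * \<sigma>\<close>.\<close>
  define s0 where "s0 = min (h / (1 + Dm)) (\<sigma> / 2)"
  have s0: "0 < s0" "s0 \<le> \<sigma> / 2" "Dm * s0 \<le> h"
  proof -
    show "0 < s0" using h \<sigma> Dm(1) by (simp add: s0_def)
    show "s0 \<le> \<sigma> / 2" unfolding s0_def by (rule min.cobounded2)
    have "Dm * s0 \<le> Dm * (h / (1 + Dm))" using Dm by (intro mult_left_mono) (auto simp: s0_def)
    also have "\<dots> \<le> h" using Dm h by (simp add: field_simps)
    finally show "Dm * s0 \<le> h" .
  qed
  \<comment> \<open>Off \<open>C1\<close> the sum of squares deviates by at most
    \<open>a * (n - P)\<close>. The lower order terms add at most as much for large
    \<open>n\<close>, so the variance estimate is off by at most
    \<open>2 * a = s0 * \<sigma>\<close>, as \<open>sqrt_close\<close> requires.\<close>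
  define a where "a = s0 * \<sigma> / 2"
  have a: "0 < a" using s0 \<sigma> by (simp add: a_def)
  \<comment> \<open>A mean of this size exceeds noise up to \<open>1 / h\<close> and a threshold up
    to \<open>\<bar>c q\<bar> * (2 * \<sigma>)\<close> together, which forces the test of order
    \<open>q\<close> to reject.\<close>
  define K where "K = 1 / h + \<bar>c q\<bar> * (2 * \<sigma>)"
  have K: "0 < K" using h \<sigma> by (simp add: K_def add_pos_nonneg)
  \<comment> \<open>Coefficient errors of this size, summed over \<open>P\<close> columns and
    multiplied by the bound for noise and mean, stay within the margin \<open>h\<close>.\<close>
  define \<delta> where "\<delta> = h / ((1 + real P) * (1 / h + \<bar>x\<bar>))"
  have hx: "0 < 1 / h + \<bar>x\<bar>" using h by (simp add: add_pos_nonneg)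
  have \<delta>: "0 < \<delta>" "real P * \<delta> * (1 / h + \<bar>x\<bar>) \<le> h"
  proof -
    show "0 < \<delta>" using h hx by (simp add: \<delta>_def)
    have "real P * \<delta> * (1 / h + \<bar>x\<bar>) = real P / (1 + real P) * h"
      using hx by (simp add: \<delta>_def)
    also have "\<dots> \<le> 1 * h" using h by (intro mult_right_mono) auto
    finally show "real P * \<delta> * (1 / h + \<bar>x\<bar>) \<le> h" by simp
  qed
  have "\<forall>\<^sub>F n in sequentially. real P * (1 / h)\<^sup>2 + real P * \<sigma>\<^sup>2 \<le> a * (real n - real P) \<and>
      (2 * \<sigma> ^ 4) * real n / (a * (real n - real P))\<^sup>2 \<le> e / 2 \<and> P < n"
    by (rule eventually_concentration[OF a]) (use e in simp)
  then have "\<forall>\<^sub>F n in sequentially. cdf_close A ord c tv x K \<delta> e n"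
    unfolding cdf_close_def
  proof (eventually_elim, intro allI impI)
    fix n X \<eta>
    assume n: "real P * (1 / h)\<^sup>2 + real P * \<sigma>\<^sup>2 \<le> a * (real n - real P) \<and>
      (2 * \<sigma> ^ 4) * real n / (a * (real n - real P))\<^sup>2 \<le> e / 2 \<and> P < n"
      and "design X n P" and asm1: "\<forall>i<k. \<forall>j<P. \<bar>design.scaled_coeff X n P A i j - B i j\<bar> \<le> \<delta>"
      and \<eta>: "\<eta> \<in> carrier_vec P" and asm2: "design.coord X n P \<eta> q = x"
      and asm3: "\<forall>j. q < j \<longrightarrow> j < P \<longrightarrow> design.coord X n P \<eta> j = 0"
      and asm4: "ord < q \<longrightarrow> K \<le> \<bar>design.coord X n P \<eta> (q - 1)\<bar>"
    interpret X: design X n P by fact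
    have bB: "\<And>i j. i < k \<Longrightarrow> j < P \<Longrightarrow> \<bar>X.scaled_coeff A i j - B i j\<bar> \<le> \<delta>"
      and m: "X.coord \<eta> q = x" "\<And>j. q < j \<Longrightarrow> j < P \<Longrightarrow> X.coord \<eta> j = 0"
      and mK: "ord < q \<Longrightarrow> K \<le> \<bar>X.coord \<eta> (q - 1)\<bar>"
      using asm1 asm2 asm3 asm4 by simp_all
    let ?M = "sample_law X \<eta> \<sigma>"
    let ?u = "X.resid \<eta>"
    define W where "W = (\<lambda>Y. \<lambda>j\<in>{..<P}. X.proj (?u Y) j)"
    interpret M: prob_space ?M using \<sigma> by (rule X.prob_space_sample_law)
    have W[measurable]: "W \<in> measurable ?M noise"
    proof -
      have "W \<in> measurable ?M (PiM {..<P} (\<lambda>_. borel))"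
        unfolding W_def by (intro measurable_restrict X.proj_resid_measurable)
      also have "measurable ?M (PiM {..<P} (\<lambda>_. borel)) = measurable ?M noise"
        by (intro measurable_cong_sets sets_PiM_cong) auto
      finally show ?thesis .
    qed
    have distrW: "distr ?M noise W = noise"
    proof -
      have "distr ?M noise W = distr ?M (PiM {..<P} (\<lambda>_. borel)) W"
        by (intro distr_cong sets_PiM_cong) auto
      then show ?thesis unfolding W_def by (simp add: X.distr_proj_resid[OF \<sigma>])
    qed
    have law: "M.prob {Y\<in>space ?M. R (W Y)} = measure noise {w\<in>space noise. R w}"
      if [measurable]: "Measurable.pred noise R" for R
    proof -
      have "measure noise {w\<in>space noise. R w} = measure (distr ?M noise W) {w\<in>space noise. R w}"
        by (simp only: distrW)
      also have "\<dots> = M.prob (W -` {w\<in>space noise. R w} \<inter> space ?M)"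
        by (intro measure_distr) measurable
      also have "W -` {w\<in>space noise. R w} \<inter> space ?M = {Y\<in>space ?M. R (W Y)}"
        using measurable_space[OF W] by auto
      finally show ?thesis by simp
    qed
    define E where "E = {Y\<in>space ?M. sqrt (real n) \<cdot>\<^sub>v (A *\<^sub>v (post_selection X ord c (vec n Y) - \<eta>)) \<le> tv}"
    define F where "F = {Y\<in>space ?M. if rejects x (W Y) then full (W Y) else part x (W Y)}"
    define C1 where "C1 = {Y\<in>space ?M. a * (real n - real P) \<le> \<bar>(\<Sum>l<n. (?u Y l)\<^sup>2) - real n * \<sigma>\<^sup>2\<bar>}"
    define C2 where "C2 = {Y\<in>space ?M. near_boundary x h (W Y)}"
    have E: "E \<in> M.events" unfolding E_def by (rule X.error_event_measurable[where c=c, OF c ordP A \<eta> tv(1)])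
    have F: "F \<in> M.events" unfolding F_def by measurable
    have C2: "C2 \<in> M.events" unfolding C2_def by measurable
    have C1: "C1 \<in> M.events"
    proof -
      have "(\<lambda>Y. \<Sum>l<n. (?u Y l)\<^sup>2) \<in> borel_measurable ?M"
        by (intro borel_measurable_sum borel_measurable_power X.resid_measurable) auto
      then show ?thesis unfolding C1_def by measurable
    qed
    have "0 < a * (real n - real P)" using a n by simp
    then have "M.prob C1 \<le> 2 * \<sigma> ^ 4 * real n / (a * (real n - real P))\<^sup>2"
      unfolding C1_def by (rule X.sum_squares_resid_concentration[OF \<sigma>])
    then have pC1: "M.prob C1 \<le> e / 2" using n by linarith
    have pC2: "M.prob C2 < e / 2" unfolding C2_def using h(2) by (subst law) auto
    have EF: "Y \<in> E \<longleftrightarrow> Y \<in> F" if Y: "Y \<in> space ?M" "Y \<notin> C1 \<union> C2" for Y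
    proof -
      define S where "S = sigma_hat X (vec n Y)"
      have nb: "\<not> near_boundary x h (W Y)" using Y by (auto simp: C2_def)
      have Wj: "W Y j = X.proj (?u Y) j" if "j < P" for j using that by (simp add: W_def)
      have Wb: "\<bar>X.proj (?u Y) j\<bar> \<le> 1 / h" if "j < P" for j
        using nb that Wj[OF that] unfolding near_boundary_def by (metis not_less)
      define s1 where "s1 = (\<Sum>l<n. (?u Y l)\<^sup>2)"
      define s2 where "s2 = (\<Sum>j<P. (X.proj (?u Y) j)\<^sup>2)"
      have s1: "\<bar>s1 - real n * \<sigma>\<^sup>2\<bar> \<le> a * (real n - real P)"
        using Y by (auto simp: C1_def s1_def)
      have s2: "0 \<le> s2" "s2 \<le> real P * (1 / h)\<^sup>2"
      proof -
        show "0 \<le> s2" by (simp add: s2_def sum_nonneg)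
        have "s2 \<le> (\<Sum>j<P. (1 / h)\<^sup>2)" unfolding s2_def
        proof (rule sum_mono)
          fix j assume "j \<in> {..<P}"
          then show "(X.proj (?u Y) j)\<^sup>2 \<le> (1 / h)\<^sup>2"
            using power_mono[OF Wb[of j] abs_ge_zero, of 2] by simp
        qed
        then show "s2 \<le> real P * (1 / h)\<^sup>2" by simp
      qed
      have pos: "0 < real n - real P" using n by simp
      have "\<bar>(s1 - s2) - (real n - real P) * \<sigma>\<^sup>2\<bar> \<le> 2 * a * (real n - real P)"
      proof -
        have "(s1 - s2) - (real n - real P) * \<sigma>\<^sup>2 = (s1 - real n * \<sigma>\<^sup>2) - s2 + real P * \<sigma>\<^sup>2"
          by (simp add: algebra_simps)
        moreover have "0 \<le> real P * \<sigma>\<^sup>2" by simp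
        ultimately show ?thesis using s1 s2 n by linarith
      qed
      then have "\<bar>(s1 - s2) - (real n - real P) * \<sigma>\<^sup>2\<bar> / (real n - real P) \<le> 2 * a"
        using pos by (simp add: pos_divide_le_eq)
      also have "\<bar>(s1 - s2) - (real n - real P) * \<sigma>\<^sup>2\<bar> / (real n - real P) = \<bar>((s1 - s2) - (real n - real P) * \<sigma>\<^sup>2) / (real n - real P)\<bar>"
        using pos by simp
      also have "((s1 - s2) - (real n - real P) * \<sigma>\<^sup>2) / (real n - real P) = (s1 - s2) / (real n - real P) - \<sigma>\<^sup>2"
        using pos by (simp add: diff_divide_distrib)
      also have "2 * a = s0 * \<sigma>" by (simp add: a_def)
      finally have r: "\<bar>(s1 - s2) / (real n - real P) - \<sigma>\<^sup>2\<bar> \<le> s0 * \<sigma>" .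
      have Sr: "S = sqrt ((s1 - s2) / (real n - real P))"
        unfolding S_def s1_def s2_def by (rule X.sigma_hat_vec[OF \<eta>])
      have S: "\<bar>S - \<sigma>\<bar> \<le> s0" "0 < S"
        unfolding Sr using sqrt_close[OF \<sigma> r] s0 \<sigma> by auto
      have test: "c p \<le> \<bar>test_stat X p (vec n Y)\<bar> \<longleftrightarrow> c p * S \<le> \<bar>X.proj (?u Y) (p - 1) + X.coord \<eta> (p - 1)\<bar>"
        if "0 < p" "p \<le> P" for p
        using that S by (simp add: X.test_stat_eq X.proj_vec[of Y _ \<eta>] S_def[symmetric] abs_divide pos_le_divide_eq add.commute)
      define p where "p = selected_order X ord c (vec n Y)"
      have p: "p \<in> {ord..P}" "c p \<le> \<bar>test_stat X p (vec n Y)\<bar>"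
        "\<And>p'. p < p' \<Longrightarrow> p' \<le> P \<Longrightarrow> \<not> c p' \<le> \<bar>test_stat X p' (vec n Y)\<bar>"
        using X.selected_order_eq_iff[where c=c, OF c ordP, of "vec n Y" p] by (auto simp: p_def)
      \<comment> \<open>If \<open>ord < q\<close>, the large mean of coordinate \<open>q - 1\<close>
        lets order \<open>q\<close> pass its test; otherwise \<open>q\<close> is itself the minimal
        order.\<close>
      have qp: "q \<le> p"
      proof (cases "ord < q")
        case True
        have "c q * S \<le> \<bar>c q\<bar> * (2 * \<sigma>)"
        proof -
          have "c q * S \<le> \<bar>c q\<bar> * S" using S by (intro mult_right_mono) auto
          also have "\<dots> \<le> \<bar>c q\<bar> * (2 * \<sigma>)" using S s0 \<sigma> by (intro mult_left_mono) auto
          finally show ?thesis .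
        qed
        moreover have "\<bar>X.proj (?u Y) (q - 1)\<bar> \<le> 1 / h" using Wb[of "q - 1"] qP by simp
        ultimately have "c q * S \<le> \<bar>X.proj (?u Y) (q - 1) + X.coord \<eta> (q - 1)\<bar>"
          using mK[OF True] unfolding K_def by linarith
        then have "c q \<le> \<bar>test_stat X q (vec n Y)\<bar>" using test[of q] True qP by simp
        then show ?thesis
          unfolding p_def using ord qP by (intro X.le_selected_order) auto
      next
        case False
        then show ?thesis using p(1) ord by simp
      qed
      have "Y \<in> E \<longleftrightarrow> (\<forall>i<k. (\<Sum>j<p. X.scaled_coeff A i j * X.proj (?u Y) j) - (\<Sum>j=p..<P. X.scaled_coeff A i j * X.coord \<eta> j) \<le> tv $ i)"
        using Y X.scaled_error_le_iff[where c=c and ord=ord and u="?u Y", OF c ordP A \<eta> vec_carrier tv(1), OF X.vec_resid]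
        by (simp add: E_def p_def X.scaled_coeff_def)
      also have "\<dots> \<longleftrightarrow> (\<forall>i<k. (\<Sum>j<p. X.scaled_coeff A i j * W Y j) - (\<Sum>j=p..<P. X.scaled_coeff A i j * X.coord \<eta> j) \<le> t i)"
      proof -
        have "(\<Sum>j<p. X.scaled_coeff A i j * X.proj (?u Y) j) = (\<Sum>j<p. X.scaled_coeff A i j * W Y j)" for i
          by (intro sum.cong refl) (use p in \<open>auto simp: Wj\<close>)
        then show ?thesis by (simp add: tv(2))
      qed
      also have "\<dots> \<longleftrightarrow> (if rejects x (W Y) then full (W Y) else part x (W Y))"
      proof (rule decision_eq[where S=S and m="X.coord \<eta>" and b="X.scaled_coeff A", OF nb h(1) B0 _ _ m qp])
        show "\<bar>d j * S - d j * \<sigma>\<bar> \<le> h" if "j < P" for j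
        proof -
          have "\<bar>d j * S - d j * \<sigma>\<bar> = \<bar>d j\<bar> * \<bar>S - \<sigma>\<bar>" by (simp flip: right_diff_distrib abs_mult)
          also have "\<dots> \<le> Dm * s0" using Dm that S by (intro mult_mono) auto
          finally show ?thesis using s0 by linarith
        qed
        show "(\<Sum>j<P. \<bar>X.scaled_coeff A i j - B i j\<bar>) * (1 / h + \<bar>x\<bar>) \<le> h" if "i < k" for i
        proof -
          have "(\<Sum>j<P. \<bar>X.scaled_coeff A i j - B i j\<bar>) \<le> (\<Sum>j<P. \<delta>)"
            by (intro sum_mono bB that) auto
          then have "(\<Sum>j<P. \<bar>X.scaled_coeff A i j - B i j\<bar>) * (1 / h + \<bar>x\<bar>) \<le> (real P * \<delta>) * (1 / h + \<bar>x\<bar>)"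
            using hx by (intro mult_right_mono) auto
          then show ?thesis using \<delta>(2) by linarith
        qed
        show "p \<le> P" using p by simp
        show "d (p - 1) * S \<le> \<bar>W Y (p - 1) + X.coord \<eta> (p - 1)\<bar>" if "q < p"
        proof -
          have "p - 1 < P" "0 < p" "Suc (p - 1) = p" using that p(1) by auto
          then show ?thesis using p(1,2) test[of p] by (simp add: dc Wj del: diff_Suc_1 One_nat_def)
        qed
        show "\<bar>W Y j + X.coord \<eta> j\<bar> < d j * S" if "p \<le> j" "j < P" for j
          using that p(3)[of "Suc j"] test[of "Suc j"] by (simp add: dc Wj not_le)
      qed auto
      also have "\<dots> \<longleftrightarrow> Y \<in> F" using Y by (simp add: F_def)
      finally show ?thesis .
    qed
    have "\<bar>M.prob E - M.prob F\<bar> \<le> M.prob (C1 \<union> C2)"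
      by (rule M.prob_diff_le[OF E F sets.Un[OF C1 C2] EF])
    also have "\<dots> \<le> M.prob C1 + M.prob C2" by (rule measure_Un_le[OF C1 C2])
    finally have "\<bar>M.prob E - M.prob F\<bar> \<le> e" using pC1 pC2 by linarith
    moreover have "M.prob F = limit_prob x"
      unfolding F_def limit_prob_def by (rule law) measurable
    moreover have "M.prob E = post_cdf X A ord c \<eta> \<sigma> tv"
      by (simp add: E_def post_cdf_def)
    ultimately show "\<bar>post_cdf X A ord c \<eta> \<sigma> tv - limit_prob x\<bar> \<le> e" by simp
  qed
  then show ?thesis using K \<delta>(1) by blast
qed

text \<open>Only the last Gram-Schmidt vector contributes to the last column of the inverse of the
  block. Its diagonal entry is positive, so \<open>C_inf A Q p\<close> vanishes exactly when column
  \<open>p - 1\<close> of the limit coefficients does.\<close>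

lemma (in pos_def_form) C_inf_eq:
  assumes Q: "Q \<in> carrier_mat n n" "\<And>a b. a < n \<Longrightarrow> b < n \<Longrightarrow> Q $$ (a, b) = G a b"
    and A: "A \<in> carrier_mat k n" and p: "0 < p" "p \<le> n" and i: "i < k"
  shows "C_inf A Q p $ i = T (p - 1) (p - 1) * (\<Sum>a<n. A $$ (i, a) * T (p - 1) a)"
proof -
  have mi: "minv (upper_left Q p) = mat p p (\<lambda>(i, l). \<Sum>j<p. T j i * T j l)"
    by (rule minv_leading_block[OF p(2)]) (use p Q in \<open>auto simp: upper_left_def\<close>)
  have col: "(minv (upper_left Q p) *\<^sub>v unit_vec p (p - 1)) $ a = T (p - 1) a * T (p - 1) (p - 1)" if a: "a < p" for a
  proof -
    have "(minv (upper_left Q p) *\<^sub>v unit_vec p (p - 1)) $ a = (\<Sum>j<p. T j a * T j (p - 1))"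
      unfolding mi using a p by simp
    also have "\<dots> = (\<Sum>j<p. if j = p - 1 then T (p - 1) a * T (p - 1) (p - 1) else 0)"
      by (intro sum.cong refl) (use p T_upper in auto)
    finally show ?thesis using p by simp
  qed
  have "C_inf A Q p $ i = (\<Sum>a<p. A $$ (i, a) * (minv (upper_left Q p) *\<^sub>v unit_vec p (p - 1)) $ a)"
    using A i p mi by (simp add: C_inf_def first_cols_def scalar_prod_def lessThan_atLeast0)
  also have "\<dots> = (\<Sum>a<p. A $$ (i, a) * (T (p - 1) a * T (p - 1) (p - 1)))"
    by (intro sum.cong refl) (simp only: lessThan_iff col)
  also have "\<dots> = (\<Sum>a<n. A $$ (i, a) * (T (p - 1) a * T (p - 1) (p - 1)))"
    by (intro sum.mono_neutral_left) (use p T_upper in auto)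
  finally show ?thesis by (simp add: sum_distrib_left mult_ac)
qed

text \<open>\<open>A\<close> is onto by its full row rank, and the coordinates of a preimage in the
  basis \<open>T\<close> solve the system.\<close>

lemma (in pos_def_form) row_space_surj:
  assumes A: "A \<in> carrier_mat k n" "vec_space.rank k A = k"
  shows "\<exists>w. \<forall>i<k. (\<Sum>j<n. (\<Sum>a<n. A $$ (i, a) * T j a) * w j) = s i"
proof -
  obtain v where v: "v \<in> carrier_vec n" "A *\<^sub>v v = vec k s"
    using full_row_rank_surj[OF A, of "vec k s"] by auto
  define w where "w = (\<lambda>j. qform n G (T j) (\<lambda>a. v $ a))"
  have "(\<Sum>j<n. (\<Sum>a<n. A $$ (i, a) * T j a) * w j) = s i" if i: "i < k" for i
  proof -
    have "s i = vec k s $ i" using i by simp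
    also have "\<dots> = (A *\<^sub>v v) $ i" by (simp only: v(2))
    also have "\<dots> = (\<Sum>a<n. A $$ (i, a) * v $ a)"
      using A v(1) i by (simp add: scalar_prod_def lessThan_atLeast0)
    also have "\<dots> = (\<Sum>a<n. A $$ (i, a) * (\<Sum>j<n. T j a * w j))"
    proof (intro sum.cong refl arg_cong2[where f="(*)"])
      fix a assume "a \<in> {..<n}"
      then show "v $ a = (\<Sum>j<n. T j a * w j)"
        unfolding w_def using expand_in_T[of a "\<lambda>a. v $ a"] by simp
    qed
    also have "\<dots> = (\<Sum>a<n. \<Sum>j<n. A $$ (i, a) * T j a * w j)"
      by (simp add: sum_distrib_left mult_ac)
    also have "\<dots> = (\<Sum>j<n. \<Sum>a<n. A $$ (i, a) * T j a * w j)" by (rule sum.swap)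
    finally show ?thesis by (simp add: sum_distrib_right)
  qed
  then show ?thesis by blast
qed

text \<open>The coordinates of \<open>local_shift\<close>: only the last one, \<open>x\<close>, varies; the one before is moved away
  from 0 so that an order below \<open>q\<close> is selected with small probability.\<close>
definition local_shift :: "nat \<Rightarrow> real \<Rightarrow> (nat \<Rightarrow> real) \<Rightarrow> real \<Rightarrow> nat \<Rightarrow> real" where
  "local_shift q K m x j = (if j = q then x else if Suc j = q then (if 0 \<le> m j then K else - K) else 0)"

text \<open>The interface to the final argument: the bound \<open>D\<close> on the distance from
  \<open>\<theta>\<close> yields contiguity, and the exact distance between two members yields total
  variation bounds along the segment.\<close>

definition local_family ::
  "real mat \<Rightarrow> nat \<Rightarrow> nat \<Rightarrow> nat \<Rightarrow> real vec \<Rightarrow> real \<Rightarrow> real \<Rightarrow> real \<Rightarrow> (real \<Rightarrow> real vec) \<Rightarrow> bool" where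
  "local_family X n P q \<theta> r D L \<eta> \<longleftrightarrow>
     (\<forall>x. \<bar>x\<bar> \<le> L \<longrightarrow> \<eta> x \<in> submodel P q \<and> vnorm (\<eta> x - \<theta>) < r \<and>
        (\<Sum>j<P. (design.coord X n P (\<eta> x) j - design.coord X n P \<theta> j)\<^sup>2) \<le> D) \<and>
     (\<forall>x y. (\<Sum>j<P. (design.coord X n P (\<eta> x) j - design.coord X n P (\<eta> y) j)\<^sup>2) = (x - y)\<^sup>2)"

text \<open>The point \<open>s\<close> has \<open>limit_prob s \<noteq> full_prob\<close>, and
  \<open>s'\<close> is so large that its limit is within half of that gap of
  \<open>full_prob\<close>. All constants come from limit quantities and therefore precede
  \<open>X\<close> and \<open>\<theta>\<close>.\<close>

lemma local_alternatives:
  fixes P ord k qs :: nat and A Q :: "real mat" and c :: "nat \<Rightarrow> real" and \<sigma> :: real and t :: "real vec"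
  assumes "ord < P" and Q: "Q \<in> carrier_mat P P" and pd: "pos_def_form P (\<lambda>a b. Q $$ (a, b))"
    and c: "c ord = 0" and cpos: "\<And>p. ord < p \<Longrightarrow> p \<le> P \<Longrightarrow> 0 < c p"
    and A: "A \<in> carrier_mat k P" and rk: "vec_space.rank k A = k"
    and ex: "\<exists>q. ord < q \<and> q \<le> P \<and> C_inf A Q q \<noteq> 0\<^sub>v k"
    and qs: "qs = Max {q. ord < q \<and> q \<le> P \<and> C_inf A Q q \<noteq> 0\<^sub>v k}"
    and \<sigma>: "0 < \<sigma>" and t: "t \<in> carrier_vec k"
  shows "\<exists>\<delta>>0. \<exists>\<rho>>0. \<exists>D s s'. \<forall>X. \<forall>\<theta>\<in>submodel P (qs - 1). regressors P Q X \<longrightarrow>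
     (\<forall>\<^sub>F n in sequentially. P < n \<and> (\<exists>\<eta>.
        local_family (X n) n P qs \<theta> (\<rho> / sqrt (real n)) D (\<bar>s\<bar> + \<bar>s'\<bar>) \<eta> \<and>
        4 * \<delta> < \<bar>post_cdf (X n) A ord c (\<eta> s) \<sigma> t - post_cdf (X n) A ord c (\<eta> s') \<sigma> t\<bar>))"
proof -
  define G where "G = (\<lambda>a b. Q $$ (a, b))"
  interpret Q: pos_def_form P G unfolding G_def by (rule pd)
  let ?S = "{q. ord < q \<and> q \<le> P \<and> C_inf A Q q \<noteq> 0\<^sub>v k}"
  have fin: "finite ?S" by (rule finite_subset[of _ "{..P}"]) auto
  have "qs \<in> ?S" unfolding qs by (rule Max_in[OF fin]) (use ex in auto)
  then have qs1: "ord < qs" "qs \<le> P" "C_inf A Q qs \<noteq> 0\<^sub>v k" by auto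
  have qs2: "C_inf A Q p = 0\<^sub>v k" if "qs < p" "p \<le> P" for p
  proof (rule ccontr)
    assume "C_inf A Q p \<noteq> 0\<^sub>v k"
    then have "p \<in> ?S" using that qs1 by auto
    then have "p \<le> qs" unfolding qs by (rule Max_ge[OF fin])
    then show False using that by simp
  qed
  define q where "q = qs - 1"
  have q: "Suc q = qs" "q < P" "ord \<le> q" using qs1 by (auto simp: q_def)
  define B where "B = (\<lambda>i j. \<Sum>a<P. A $$ (i, a) * Q.T j a)"
  have CB: "C_inf A Q p $ i = Q.T (p - 1) (p - 1) * B i (p - 1)" if "0 < p" "p \<le> P" "i < k" for p i
    unfolding B_def by (rule Q.C_inf_eq[OF Q _ A that]) (simp add: G_def)
  have Cdim: "dim_vec (C_inf A Q p) = k" for p using A by (simp add: C_inf_def first_cols_def)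
  have Bq: "\<exists>i<k. B i q \<noteq> 0"
  proof (rule ccontr)
    assume "\<not> ?thesis"
    then have "C_inf A Q qs = 0\<^sub>v k"
      using CB[of qs] qs1 by (intro eq_vecI) (auto simp: Cdim q_def)
    then show False using qs1 by simp
  qed
  have B0: "B i j = 0" if "i < k" "q < j" "j < P" for i j
  proof -
    have "C_inf A Q (Suc j) $ i = 0" using qs2[of "Suc j"] that q by simp
    then show ?thesis using CB[of "Suc j" i] that Q.T_diag[of j] by simp
  qed
  define d where "d = (\<lambda>j. c (Suc j))"
  define tt where "tt = (\<lambda>i. t $ i)"
  interpret limit_experiment P q k \<sigma> B d tt
  proof
    show "0 < \<sigma>" "q < P" "\<exists>i<k. B i q \<noteq> 0" by fact+
    show "0 < d j" if "q \<le> j" "j < P" for j using that q by (simp add: d_def cpos)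
    fix s
    obtain w where w: "\<And>i. i < k \<Longrightarrow> (\<Sum>j<P. B i j * w j) = s i"
      using Q.row_space_surj[OF A rk, of s] unfolding B_def by blast
    have "(\<Sum>j<Suc q. B i j * w j) = s i" if "i < k" for i
    proof -
      have "(\<Sum>j<Suc q. B i j * w j) = (\<Sum>j<P. B i j * w j)"
        by (intro sum.mono_neutral_left) (use q B0 that in auto)
      then show ?thesis using w that by simp
    qed
    then show "\<exists>w. \<forall>i<k. (\<Sum>j<Suc q. B i j * w j) = s i" by blast
  qed
  obtain s where s: "s \<notin> exceptional" "limit_prob s \<noteq> full_prob"
    using limit_prob_ne_full_prob[OF finite_exceptional] by auto
  define g0 where "g0 = \<bar>limit_prob s - full_prob\<bar> / 2"
  have g0: "0 < g0" using s by (simp add: g0_def)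
  have "\<forall>\<^sub>F x in at_top. \<bar>limit_prob x - full_prob\<bar> < g0"
    using tendstoD[OF tendsto_limit_prob g0] by (simp add: dist_real_def)
  moreover have "\<forall>\<^sub>F x in at_top. Max (insert 0 exceptional) < x"
    by (rule eventually_gt_at_top)
  ultimately have "\<forall>\<^sub>F x in at_top. \<bar>limit_prob x - full_prob\<bar> < g0 \<and> x \<notin> exceptional"
  proof eventually_elim
    case (elim x)
    have "x \<notin> exceptional"
    proof
      assume "x \<in> exceptional"
      then have "x \<le> Max (insert 0 exceptional)" using finite_exceptional by (intro Max_ge) auto
      then show False using elim by simp
    qed
    then show ?case using elim by simp
  qed
  then obtain s' where s': "\<bar>limit_prob s' - full_prob\<bar> < g0" "s' \<notin> exceptional"
    by (metis (mono_tags, lifting) eventually_happens' trivial_limit_at_top_linorder)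
  have gap: "g0 < \<bar>limit_prob s - limit_prob s'\<bar>"
  proof -
    have "\<bar>limit_prob s - full_prob\<bar> \<le> \<bar>limit_prob s - limit_prob s'\<bar> + \<bar>limit_prob s' - full_prob\<bar>" by linarith
    moreover have "a / 2 < b" if "a \<le> b + c" "c < a / 2" for a b c :: real using that by linarith
    ultimately show ?thesis using s'(1) unfolding g0_def by blast
  qed
  \<comment> \<open>The limits at \<open>s\<close> and \<open>s'\<close> are more than
    \<open>8 * e\<close> apart; two approximation errors of at most \<open>e\<close> leave more than
    \<open>4 * e\<close>.\<close>
  define e where "e = g0 / 8"
  have e: "0 < e" using g0 by (simp add: e_def)
  have close: "\<exists>K>0. \<exists>\<delta>>0. \<forall>\<^sub>F n in sequentially. cdf_close A ord c t x K \<delta> e n" if "x \<notin> exceptional" for x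
    by (rule post_cdf_close[where c=c and ord=ord, OF that e c q(3) A]) (auto simp: d_def tt_def t B0)
  obtain K1 \<delta>1 where 1: "0 < K1" "0 < \<delta>1" "\<forall>\<^sub>F n in sequentially. cdf_close A ord c t s K1 \<delta>1 e n"
    using close[OF s(1)] by blast
  obtain K2 \<delta>2 where 2: "0 < K2" "0 < \<delta>2" "\<forall>\<^sub>F n in sequentially. cdf_close A ord c t s' K2 \<delta>2 e n"
    using close[OF s'(2)] by blast
  define K where "K = max K1 K2"
  have K: "K1 \<le> K" "K2 \<le> K" "0 < K" using 1 by (auto simp: K_def)
  define R where "R = K + \<bar>s\<bar> + \<bar>s'\<bar>"
  have R: "0 < R" using K by (simp add: R_def add_pos_nonneg)
  define D where "D = real P * R\<^sup>2"
  \<comment> \<open>Bounds the squared norm of the shift before scaling;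
    \<open>\<bar>Q.T j a\<bar> + 1\<close> dominates the finite sample vectors for large
    \<open>n\<close>. Adding 1 to its root makes the distance bound strict.\<close>
  define V where "V = (\<Sum>a<P. (\<Sum>j<P. (\<bar>Q.T j a\<bar> + 1) * R)\<^sup>2)"
  have V: "0 \<le> V" by (simp add: V_def sum_nonneg)
  define \<rho> where "\<rho> = sqrt V + 1"
  have main: "\<forall>\<^sub>F n in sequentially. P < n \<and> (\<exists>\<eta>.
        local_family (X n) n P qs \<theta> (\<rho> / sqrt (real n)) D (\<bar>s\<bar> + \<bar>s'\<bar>) \<eta> \<and>
        4 * e < \<bar>post_cdf (X n) A ord c (\<eta> s) \<sigma> t - post_cdf (X n) A ord c (\<eta> s') \<sigma> t\<bar>)"
    if \<theta>: "\<theta> \<in> submodel P (qs - 1)" and reg: "regressors P Q X" for X \<theta>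
  proof -
    let ?T = "\<lambda>n. gram_schmidt P (design.gram (X n) n)"
    have Tlim: "(\<lambda>n. ?T n j a) \<longlonglongrightarrow> Q.T j a" if "j < P" for j a
      by (rule Q.tendsto_gram_schmidt[OF _ that]) (simp add: G_def tendsto_gram[OF reg])
    have Blim: "(\<lambda>n. \<Sum>a<P. A $$ (i, a) * ?T n j a) \<longlonglongrightarrow> B i j" if "j < P" for i j
      unfolding B_def by (intro tendsto_intros Tlim that)
    have ev1: "\<forall>\<^sub>F n in sequentially. \<forall>j\<in>{..<P}. \<forall>a\<in>{..<P}. \<bar>?T n j a\<bar> < \<bar>Q.T j a\<bar> + 1"
      by (intro eventually_ball_finite ballI finite_lessThan order_tendstoD(2)[OF tendsto_rabs[OF Tlim]]) auto
    have ev2: "\<forall>\<^sub>F n in sequentially. \<forall>i\<in>{..<k}. \<forall>j\<in>{..<P}. \<bar>(\<Sum>a<P. A $$ (i, a) * ?T n j a) - B i j\<bar> < min \<delta>1 \<delta>2"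
    proof (intro eventually_ball_finite ballI finite_lessThan)
      fix i j assume "j \<in> {..<P}"
      then show "\<forall>\<^sub>F n in sequentially. \<bar>(\<Sum>a<P. A $$ (i, a) * ?T n j a) - B i j\<bar> < min \<delta>1 \<delta>2"
        using tendstoD[OF Blim, of j "min \<delta>1 \<delta>2" i] 1 2 by (simp add: dist_real_def)
    qed
    show ?thesis
      using ev1 ev2 1(3)[unfolded cdf_close_def] 2(3)[unfolded cdf_close_def] eventually_gt_at_top[of P]
    proof eventually_elim
      case (elim n)
      interpret X: design "X n" n P by (rule regressors_design[OF reg]) (rule elim(5))
      have \<theta>c: "\<theta> \<in> carrier_vec P" using \<theta> by (auto simp: submodel_def)
      define \<eta> where "\<eta> = (\<lambda>x. X.shift \<theta> (local_shift q K (X.coord \<theta>) x))"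
      have \<eta>c: "\<eta> x \<in> carrier_vec P" for x by (simp add: \<eta>_def X.shift_def)
      have co: "X.coord (\<eta> x) j = X.coord \<theta> j + local_shift q K (X.coord \<theta>) x j" if "j < P" for x j
        unfolding \<eta>_def by (rule X.coord_shift[OF \<theta>c that])
      have co0: "X.coord \<theta> j = 0" if "q \<le> j" "j < P" for j
        using X.coord_submodel[OF \<theta>] that by (simp add: q_def)
      have coq: "X.coord (\<eta> x) q = x" for x using co[of q] co0[of q] q by (simp add: local_shift_def)
      have coj: "\<forall>j. q < j \<longrightarrow> j < P \<longrightarrow> X.coord (\<eta> x) j = 0" for x
        using co co0 by (auto simp: local_shift_def)
      \<comment> \<open>The shift by \<open>K\<close> has the sign of the coordinate of
        \<open>\<theta>\<close>, so the two cannot cancel, whatever \<open>\<theta>\<close>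
        is.\<close>
      have coK: "ord < q \<longrightarrow> K \<le> \<bar>X.coord (\<eta> x) (q - 1)\<bar>" for x
      proof
        assume "ord < q"
        then have "q - 1 < P" "Suc (q - 1) = q" "q - 1 \<noteq> q" using q by auto
        then show "K \<le> \<bar>X.coord (\<eta> x) (q - 1)\<bar>"
          using co[of "q - 1" x] K by (auto simp: local_shift_def)
      qed
      have ls: "\<bar>local_shift q K m x j\<bar> \<le> R" if "\<bar>x\<bar> \<le> \<bar>s\<bar> + \<bar>s'\<bar>" for m x j
        using that K by (auto simp: local_shift_def R_def)
      have ball: "\<eta> x \<in> submodel P qs \<and> vnorm (\<eta> x - \<theta>) < \<rho> / sqrt (real n) \<and>
          (\<Sum>j<P. (X.coord (\<eta> x) j - X.coord \<theta> j)\<^sup>2) \<le> D" if x: "\<bar>x\<bar> \<le> \<bar>s\<bar> + \<bar>s'\<bar>" for x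
      proof (intro conjI)
        have "\<theta> \<in> submodel P qs" using \<theta> q by (auto simp: submodel_def)
        then show "\<eta> x \<in> submodel P qs"
          unfolding \<eta>_def using q by (intro X.shift_submodel) (auto simp: local_shift_def)
        let ?\<Delta> = "local_shift q K (X.coord \<theta>) x"
        have "(\<Sum>a<P. (\<Sum>j<P. X.T j a * ?\<Delta> j)\<^sup>2) \<le> V"
          unfolding V_def
        proof (rule sum_mono)
          fix a assume a: "a \<in> {..<P}"
          have "\<bar>\<Sum>j<P. X.T j a * ?\<Delta> j\<bar> \<le> (\<Sum>j<P. \<bar>X.T j a * ?\<Delta> j\<bar>)" by (rule sum_abs)
          also have "\<dots> \<le> (\<Sum>j<P. (\<bar>Q.T j a\<bar> + 1) * R)"
          proof (rule sum_mono)
            fix j assume "j \<in> {..<P}"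
            then have "\<bar>X.T j a\<bar> \<le> \<bar>Q.T j a\<bar> + 1" using elim(1) a by (meson less_imp_le)
            then show "\<bar>X.T j a * ?\<Delta> j\<bar> \<le> (\<bar>Q.T j a\<bar> + 1) * R"
              unfolding abs_mult using ls[OF x] by (intro mult_mono) auto
          qed
          finally have "\<bar>\<Sum>j<P. X.T j a * ?\<Delta> j\<bar>\<^sup>2 \<le> (\<Sum>j<P. (\<bar>Q.T j a\<bar> + 1) * R)\<^sup>2"
            by (intro power_mono) auto
          then show "(\<Sum>j<P. X.T j a * ?\<Delta> j)\<^sup>2 \<le> (\<Sum>j<P. (\<bar>Q.T j a\<bar> + 1) * R)\<^sup>2" by simp
        qed
        then have "sqrt (real n) * vnorm (\<eta> x - \<theta>) \<le> sqrt V"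
          unfolding \<eta>_def X.vnorm_shift[OF \<theta>c] by (rule real_sqrt_le_mono)
        then have "sqrt (real n) * vnorm (\<eta> x - \<theta>) < \<rho>" by (simp add: \<rho>_def)
        then show "vnorm (\<eta> x - \<theta>) < \<rho> / sqrt (real n)"
          using elim(5) by (simp add: pos_less_divide_eq mult.commute)
        have "(\<Sum>j<P. (X.coord (\<eta> x) j - X.coord \<theta> j)\<^sup>2) \<le> (\<Sum>j<P. R\<^sup>2)"
        proof (rule sum_mono)
          fix j assume "j \<in> {..<P}"
          then have "X.coord (\<eta> x) j - X.coord \<theta> j = ?\<Delta> j" using co by simp
          then show "(X.coord (\<eta> x) j - X.coord \<theta> j)\<^sup>2 \<le> R\<^sup>2"
            using power_mono[OF ls[OF x, of "X.coord \<theta>" j] abs_ge_zero, of 2] by simp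
        qed
        then show "(\<Sum>j<P. (X.coord (\<eta> x) j - X.coord \<theta> j)\<^sup>2) \<le> D" by (simp add: D_def)
      qed
      have pair: "(\<Sum>j<P. (X.coord (\<eta> x) j - X.coord (\<eta> y) j)\<^sup>2) = (x - y)\<^sup>2" for x y
      proof -
        have "(\<Sum>j<P. (X.coord (\<eta> x) j - X.coord (\<eta> y) j)\<^sup>2) = (\<Sum>j<P. if j = q then (x - y)\<^sup>2 else 0)"
          by (intro sum.cong refl) (auto simp: co local_shift_def)
        then show ?thesis using q by simp
      qed
      have coeff: "\<forall>i<k. \<forall>j<P. \<bar>X.scaled_coeff A i j - B i j\<bar> \<le> \<delta>1"
         "\<forall>i<k. \<forall>j<P. \<bar>X.scaled_coeff A i j - B i j\<bar> \<le> \<delta>2"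
        using elim(2) by (auto simp: X.scaled_coeff_def intro: less_imp_le)
      have "\<bar>post_cdf (X n) A ord c (\<eta> s) \<sigma> t - limit_prob s\<bar> \<le> e"
        using coK[of s] K(1)
        by (intro elim(3)[rule_format] X.design_axioms coeff(1)[rule_format] \<eta>c coq coj[rule_format])
          (auto intro: order_trans)
      moreover have "\<bar>post_cdf (X n) A ord c (\<eta> s') \<sigma> t - limit_prob s'\<bar> \<le> e"
        using coK[of s'] K(2)
        by (intro elim(4)[rule_format] X.design_axioms coeff(2)[rule_format] \<eta>c coq coj[rule_format])
          (auto intro: order_trans)
      ultimately have "4 * e < \<bar>post_cdf (X n) A ord c (\<eta> s) \<sigma> t - post_cdf (X n) A ord c (\<eta> s') \<sigma> t\<bar>"
        using gap unfolding e_def by linarith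
      moreover have "local_family (X n) n P qs \<theta> (\<rho> / sqrt (real n)) D (\<bar>s\<bar> + \<bar>s'\<bar>) \<eta>"
        using ball pair by (simp add: local_family_def)
      ultimately show ?case using elim(5) by blast
    qed
  qed
  have "0 < \<rho>" using V by (simp add: \<rho>_def add_nonneg_pos)
  then show ?thesis using e main by blast
qed

subsection \<open>Non-uniformity\<close>

text \<open>The target \<open>v\<close> is kept apart from the law, because the event of missing the
  value at one parameter is also measured under another.\<close>

definition miss_event :: "nat \<Rightarrow> ((nat \<Rightarrow> real) \<Rightarrow> real) \<Rightarrow> real \<Rightarrow> real \<Rightarrow> (nat \<Rightarrow> real) set" where
  "miss_event n g v \<delta> = {Y\<in>space (sample_space n). \<bar>g Y - v\<bar> > \<delta>}"

lemma miss_event_sets: "g \<in> estimators n \<Longrightarrow> miss_event n g v \<delta> \<in> sets (PiM {..<n} (\<lambda>_. borel))"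
proof -
  assume "g \<in> estimators n"
  then have [measurable]: "g \<in> borel_measurable (sample_space n)" by (simp add: estimators_def)
  have "miss_event n g v \<delta> \<in> sets (sample_space n)" unfolding miss_event_def by measurable
  then show ?thesis by (simp add: sample_space_def)
qed

context design
begin

lemma miss_prob_eq:
  "miss_prob X A ord c \<eta> \<sigma> t g \<delta> = measure (sample_law X \<eta> \<sigma>) (miss_event N g (post_cdf X A ord c \<eta> \<sigma> t) \<delta>)"
  by (simp add: miss_prob_def miss_event_def sample_space_def space_sample_law)

text \<open>No estimate can be within \<open>\<delta>\<close> of two values that are more than
  \<open>2 * \<delta>\<close> apart.\<close>

lemma miss_event_cover:
  assumes \<sigma>: "0 < \<sigma>" and g: "g \<in> estimators N" and sep: "2 * \<delta> < \<bar>v - v'\<bar>"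
  shows "1 \<le> measure (sample_law X \<eta> \<sigma>) (miss_event N g v \<delta>) + measure (sample_law X \<eta> \<sigma>) (miss_event N g v' \<delta>)"
proof -
  interpret prob_space "sample_law X \<eta> \<sigma>" using \<sigma> by (rule prob_space_sample_law)
  have E: "miss_event N g v \<delta> \<in> events" "miss_event N g v' \<delta> \<in> events"
    using miss_event_sets[OF g] by (simp_all add: sets_sample_law)
  have "miss_event N g v \<delta> \<union> miss_event N g v' \<delta> = space (sample_law X \<eta> \<sigma>)"
    using sep by (auto simp: miss_event_def space_sample_law sample_space_def)
  then have "1 = prob (miss_event N g v \<delta> \<union> miss_event N g v' \<delta>)" by (simp add: prob_space)
  also have "\<dots> \<le> prob (miss_event N g v \<delta>) + prob (miss_event N g v' \<delta>)"
    by (rule measure_Un_le[OF E])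
  finally show ?thesis .
qed

lemma miss_prob_le_worst:
  assumes "\<eta> \<in> submodel P q" "vnorm (\<eta> - \<theta>) < r"
  shows "ereal (miss_prob X A ord c \<eta> \<sigma> t g \<delta>) \<le> worst_miss_prob X A ord c q \<theta> r \<sigma> t g \<delta>"
  unfolding worst_miss_prob_def by (rule SUP_upper) (use assms in simp)

lemma worst_miss_prob_le_1:
  assumes "0 < \<sigma>"
  shows "worst_miss_prob X A ord c q \<theta> r \<sigma> t g \<delta> \<le> 1"
  unfolding worst_miss_prob_def
proof (rule SUP_least)
  fix \<eta>
  interpret prob_space "sample_law X \<eta> \<sigma>" using assms by (rule prob_space_sample_law)
  show "ereal (miss_prob X A ord c \<eta> \<sigma> t g \<delta>) \<le> 1" by (simp add: miss_prob_eq)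
qed

end

lemma exists_large_step:
  fixes f :: "real \<Rightarrow> real"
  assumes m: "0 < m" and big: "real m * \<epsilon> < \<bar>f s - f s'\<bar>"
  shows "\<exists>i<m. \<epsilon> < \<bar>f (s + real (Suc i) * ((s' - s) / real m)) - f (s + real i * ((s' - s) / real m))\<bar>"
proof (rule ccontr)
  let ?p = "\<lambda>i. s + real i * ((s' - s) / real m)"
  assume "\<not> ?thesis"
  then have le: "\<And>i. i < m \<Longrightarrow> \<bar>f (?p (Suc i)) - f (?p i)\<bar> \<le> \<epsilon>" by (meson not_less)
  have "f (?p m) - f (?p 0) = (\<Sum>i<m. f (?p (Suc i)) - f (?p i))"
    by (rule sum_lessThan_telescope[symmetric])
  moreover have "?p m = s'" "?p 0 = s" using m by auto
  ultimately have "\<bar>f s - f s'\<bar> = \<bar>\<Sum>i<m. f (?p (Suc i)) - f (?p i)\<bar>" by (simp add: abs_minus_commute)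
  also have "\<dots> \<le> (\<Sum>i<m. \<bar>f (?p (Suc i)) - f (?p i)\<bar>)" by (rule sum_abs)
  also have "\<dots> \<le> (\<Sum>i<m. \<epsilon>)" by (intro sum_mono le) simp
  finally show False using big by simp
qed

lemma segment_bound:
  assumes "i \<le> m" "0 < m"
  shows "\<bar>s + real i * ((s' - s) / real m)\<bar> \<le> \<bar>s\<bar> + \<bar>s'\<bar>"
proof -
  define a where "a = real i / real m"
  have a: "0 \<le> a" "a \<le> 1" using assms by (auto simp: a_def)
  have "s + real i * ((s' - s) / real m) = (1 - a) * s + a * s'" by (simp add: a_def algebra_simps diff_divide_distrib)
  also have "\<bar>\<dots>\<bar> \<le> (1 - a) * \<bar>s\<bar> + a * \<bar>s'\<bar>"
    using abs_triangle_ineq[of "(1 - a) * s" "a * s'"] a by (simp add: abs_mult)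
  also have "\<dots> \<le> 1 * \<bar>s\<bar> + 1 * \<bar>s'\<bar>" using a by (intro add_mono mult_right_mono) auto
  finally show ?thesis by simp
qed

theorem theorem2p3:
  fixes P ord k qs :: nat
    and A Q :: "real mat"
    and c :: "nat \<Rightarrow> real"
    and \<sigma> :: real
    and t :: "real vec"
  assumes "1 \<le> P" and "ord < P"
    and "Q \<in> carrier_mat P P" and "invertible_mat Q"
    and "c ord = 0" and "\<And>p. ord < p \<Longrightarrow> p \<le> P \<Longrightarrow> 0 < c p"
    and "1 \<le> k" and "k \<le> P"
    and "A \<in> carrier_mat k P" and "vec_space.rank k A = k"
    and "\<exists>q. ord < q \<and> q \<le> P \<and> C_inf A Q q \<noteq> 0\<^sub>v k"
    and "qs = Max {q. ord < q \<and> q \<le> P \<and> C_inf A Q q \<noteq> 0\<^sub>v k}"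
    and "0 < \<sigma>"
    and "t \<in> carrier_vec k"
  shows "\<exists>\<delta>\<^sub>0>0. \<exists>\<rho>\<^sub>0>0. \<forall>X. \<forall>\<theta> \<in> submodel P (qs - 1). regressors P Q X \<longrightarrow>
      (\<forall>g. (\<forall>n>P. g n \<in> estimators n) \<and>
           (\<forall>\<delta>>0. (\<lambda>n. miss_prob (X n) A ord c \<theta> \<sigma> t (g n) \<delta>) \<longlonglongrightarrow> 0) \<longrightarrow>
           (\<lambda>n. worst_miss_prob (X n) A ord c qs \<theta> (\<rho>\<^sub>0 / sqrt (real n)) \<sigma> t (g n) \<delta>\<^sub>0) \<longlonglongrightarrow> 1)
      \<and> liminf (\<lambda>n. INF g \<in> estimators n.
           worst_miss_prob (X n) A ord c qs \<theta> (\<rho>\<^sub>0 / sqrt (real n)) \<sigma> t g \<delta>\<^sub>0) > 0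
      \<and> (SUP \<delta> \<in> {0<..}. liminf (\<lambda>n. INF g \<in> estimators n.
           worst_miss_prob (X n) A ord c qs \<theta> (\<rho>\<^sub>0 / sqrt (real n)) \<sigma> t g \<delta>)) \<ge> 1 / 2"
\<comment> \<open>The constants require \<open>Q\<close> to be positive definite, which follows from
  the existence of one admissible sequence. Without any, the claim is vacuous.\<close>
proof (cases "\<exists>X. regressors P Q X")
  case False
  then show ?thesis by (intro exI[of _ 1] conjI) auto
next
  case True
  then obtain X\<^sub>0 where X0: "regressors P Q X\<^sub>0" by blast
  have pd: "pos_def_form P (\<lambda>a b. Q $$ (a, b))"
    by (rule regressors_pos_def[OF X0 assms(3,4)])
  note \<sigma> = \<open>0 < \<sigma>\<close>
  obtain \<delta> \<rho> D s s' where pos: "0 < \<delta>" "0 < \<rho>" and loc: "\<And>X \<theta>. \<theta> \<in> submodel P (qs - 1) \<Longrightarrow> regressors P Q X \<Longrightarrow>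
     (\<forall>\<^sub>F n in sequentially. P < n \<and> (\<exists>\<eta>.
        local_family (X n) n P qs \<theta> (\<rho> / sqrt (real n)) D (\<bar>s\<bar> + \<bar>s'\<bar>) \<eta> \<and>
        4 * \<delta> < \<bar>post_cdf (X n) A ord c (\<eta> s) \<sigma> t - post_cdf (X n) A ord c (\<eta> s') \<sigma> t\<bar>))"
    using local_alternatives[where c=c, OF assms(2,3) pd assms(5,6) assms(9-12) \<sigma> assms(14)] by blast
  let ?worst = "\<lambda>X \<theta> g \<delta> n. worst_miss_prob (X n) A ord c qs \<theta> (\<rho> / sqrt (real n)) \<sigma> t g \<delta>"
  \<comment> \<open>The cdf values at \<open>s\<close> and \<open>s'\<close> are more than
    \<open>4 * \<delta>\<close> apart, so one of them is more than
    \<open>2 * \<delta>\<^sub>0\<close> away from the value at \<open>\<theta>\<close>. By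
    contiguity the estimator stays near the value at \<open>\<theta>\<close> under that alternative
    too, and so misses there.\<close>
  have consistent: "(\<lambda>n. ?worst X \<theta> (g n) \<delta>\<^sub>0 n) \<longlonglongrightarrow> 1"
    if \<delta>0: "0 < \<delta>\<^sub>0" "\<delta>\<^sub>0 \<le> \<delta>" and \<theta>: "\<theta> \<in> submodel P (qs - 1)" and reg: "regressors P Q X" and g: "\<And>n. P < n \<Longrightarrow> g n \<in> estimators n"
      and cons: "\<And>\<delta>. 0 < \<delta> \<Longrightarrow> (\<lambda>n. miss_prob (X n) A ord c \<theta> \<sigma> t (g n) \<delta>) \<longlonglongrightarrow> 0" for \<delta>\<^sub>0 X \<theta> g
  proof (rule order_tendstoI)
    fix a :: ereal assume "1 < a"
    show "\<forall>\<^sub>F n in sequentially. ?worst X \<theta> (g n) \<delta>\<^sub>0 n < a"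
      using eventually_gt_at_top[of P]
    proof eventually_elim
      case (elim n)
      interpret X: design "X n" n P by (rule regressors_design[OF reg elim])
      show ?case using X.worst_miss_prob_le_1[OF \<sigma>] \<open>1 < a\<close> by (rule le_less_trans)
    qed
  next
    fix a :: ereal assume "a < 1"
    then obtain r where r: "a < ereal r" "ereal r < 1" using ereal_dense2 by blast
    define \<epsilon> where "\<epsilon> = (1 - r) / 2"
    have \<epsilon>: "0 < \<epsilon>" "r < 1 - \<epsilon>" using r by (auto simp: \<epsilon>_def field_simps)
    \<comment> \<open>Makes the first term of the contiguity bound at most
      \<open>\<epsilon>\<close>. The second is below \<open>\<epsilon>\<close> once the miss
      probability at \<open>\<theta>\<close> is below \<open>\<epsilon> * l\<close>.\<close>
    define l where "l = \<epsilon> / exp (D / \<sigma>\<^sup>2)"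
    have l: "0 < l" using \<epsilon> by (simp add: l_def)
    have "\<forall>\<^sub>F n in sequentially. miss_prob (X n) A ord c \<theta> \<sigma> t (g n) \<delta>\<^sub>0 < \<epsilon> * l"
      using cons[OF \<delta>0(1)] \<epsilon> l by (intro order_tendstoD(2)) auto
    then show "\<forall>\<^sub>F n in sequentially. a < ?worst X \<theta> (g n) \<delta>\<^sub>0 n"
      using loc[OF \<theta> reg]
    proof eventually_elim
      case (elim n)
      then have n: "P < n" by simp
      interpret X: design "X n" n P by (rule regressors_design[OF reg n])
      let ?G = "\<lambda>\<eta>. post_cdf (X n) A ord c \<eta> \<sigma> t"
      obtain \<eta> where fam: "local_family (X n) n P qs \<theta> (\<rho> / sqrt (real n)) D (\<bar>s\<bar> + \<bar>s'\<bar>) \<eta>"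
          and sep: "4 * \<delta> < \<bar>?G (\<eta> s) - ?G (\<eta> s')\<bar>"
        using elim by blast
      note \<eta> = fam[unfolded local_family_def, THEN conjunct1, rule_format]
      obtain x where x: "\<bar>x\<bar> \<le> \<bar>s\<bar> + \<bar>s'\<bar>" "2 * \<delta>\<^sub>0 < \<bar>?G (\<eta> x) - ?G \<theta>\<bar>"
      proof (cases "2 * \<delta>\<^sub>0 < \<bar>?G (\<eta> s) - ?G \<theta>\<bar>")
        case True
        then show thesis by (intro that[of s]) auto
      next
        case False
        then have "2 * \<delta>\<^sub>0 < \<bar>?G (\<eta> s') - ?G \<theta>\<bar>" using sep \<delta>0 by linarith
        then show thesis by (intro that[of s']) auto
      qed
      have c: "\<theta> \<in> carrier_vec P" "\<eta> x \<in> carrier_vec P" using \<theta> \<eta>[OF x(1)] by (auto simp: submodel_def)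
      let ?E = "miss_event n (g n) (?G \<theta>) \<delta>\<^sub>0"
      have "2 * measure (sample_law (X n) (\<eta> x) \<sigma>) ?E \<le>
          l * exp ((\<Sum>j<P. (X.coord (\<eta> x) j - X.coord \<theta> j)\<^sup>2) / \<sigma>\<^sup>2) + measure (sample_law (X n) \<theta> \<sigma>) ?E / l"
        using X.sample_law_compare[where \<alpha>=0, OF \<sigma> l miss_event_sets[OF g[OF n]] c] by simp
      also have "l * exp ((\<Sum>j<P. (X.coord (\<eta> x) j - X.coord \<theta> j)\<^sup>2) / \<sigma>\<^sup>2) \<le> l * exp (D / \<sigma>\<^sup>2)"
        using \<eta>[OF x(1)] l by (intro mult_left_mono) (auto intro: divide_right_mono)
      also have "l * exp (D / \<sigma>\<^sup>2) = \<epsilon>" by (simp add: l_def)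
      also have "measure (sample_law (X n) \<theta> \<sigma>) ?E / l < \<epsilon>"
        using elim(1) l by (simp add: X.miss_prob_eq pos_divide_less_eq)
      finally have "measure (sample_law (X n) (\<eta> x) \<sigma>) ?E < \<epsilon>" by simp
      moreover have "1 \<le> miss_prob (X n) A ord c (\<eta> x) \<sigma> t (g n) \<delta>\<^sub>0 + measure (sample_law (X n) (\<eta> x) \<sigma>) ?E"
        unfolding X.miss_prob_eq by (rule X.miss_event_cover[OF \<sigma> g[OF n] x(2)])
      ultimately have "r < miss_prob (X n) A ord c (\<eta> x) \<sigma> t (g n) \<delta>\<^sub>0" using \<epsilon> by linarith
      then have "a < ereal (miss_prob (X n) A ord c (\<eta> x) \<sigma> t (g n) \<delta>\<^sub>0)" using r(1) by (simp add: less_trans)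
      also have "\<dots> \<le> ?worst X \<theta> (g n) \<delta>\<^sub>0 n"
        using \<eta>[OF x(1)] by (intro X.miss_prob_le_worst) auto
      finally show ?case .
    qed
  qed
  \<comment> \<open>Keeping \<open>\<delta>' \<le> \<delta>\<close> lets \<open>consistent\<close>
    apply to the same constant.\<close>
  have half: "\<exists>\<delta>'>0. \<delta>' \<le> \<delta> \<and> (\<forall>X. \<forall>\<theta>\<in>submodel P (qs - 1). regressors P Q X \<longrightarrow>
      ereal r \<le> liminf (\<lambda>n. INF g \<in> estimators n. ?worst X \<theta> g \<delta>' n))" if r: "r < 1 / 2" for r
  proof -
    \<comment> \<open>If neighbouring laws differ by at most \<open>\<epsilon>\<close>, the two miss
      probabilities sum to at least \<open>1 - \<epsilon> = 2 * r\<close>, so the larger one is at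
      least \<open>r\<close>.\<close>
    define \<epsilon> where "\<epsilon> = 1 - 2 * r"
    have \<epsilon>: "0 < \<epsilon>" using r by (simp add: \<epsilon>_def)
    have "(\<lambda>m. exp (((s' - s) / real m)\<^sup>2 / \<sigma>\<^sup>2)) \<longlonglongrightarrow> exp ((0 :: real)\<^sup>2 / \<sigma>\<^sup>2)"
      using \<sigma> by (intro tendsto_intros lim_const_over_n) auto
    then have "(\<lambda>m. exp (((s' - s) / real m)\<^sup>2 / \<sigma>\<^sup>2)) \<longlonglongrightarrow> 1" by simp
    then have "\<forall>\<^sub>F m in sequentially. exp (((s' - s) / real m)\<^sup>2 / \<sigma>\<^sup>2) < 1 + \<epsilon>\<^sup>2"
      by (rule order_tendstoD(2)) (use \<epsilon> in simp)
    then have "\<forall>\<^sub>F m in sequentially. exp (((s' - s) / real m)\<^sup>2 / \<sigma>\<^sup>2) < 1 + \<epsilon>\<^sup>2 \<and> 0 < m"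
      using eventually_gt_at_top[of 0] by (rule eventually_conj)
    \<comment> \<open>Pieces so short that the chi-square distance between the laws at their ends is
      below \<open>\<epsilon>\<^sup>2\<close>.\<close>
    then obtain m :: nat where m: "exp (((s' - s) / real m)\<^sup>2 / \<sigma>\<^sup>2) < 1 + \<epsilon>\<^sup>2" "0 < m"
      using eventually_happens'[OF sequentially_bot] by blast
    \<comment> \<open>The total change of the cdf exceeds \<open>4 * \<delta>\<close>, hence
      \<open>m * (2 * \<delta>')\<close>, so some piece carries a change above
      \<open>2 * \<delta>'\<close>. Which piece depends on \<open>n\<close>.\<close>
    define \<delta>' where "\<delta>' = \<delta> / real m"
    have \<delta>': "0 < \<delta>'" "\<delta>' \<le> \<delta>" using pos m by (auto simp: \<delta>'_def divide_le_eq)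
    let ?p = "\<lambda>i. s + real i * ((s' - s) / real m)"
    have "\<forall>\<^sub>F n in sequentially. ereal r \<le> (INF g \<in> estimators n. ?worst X \<theta> g \<delta>' n)"
      if \<theta>: "\<theta> \<in> submodel P (qs - 1)" and reg: "regressors P Q X" for X \<theta>
      using loc[OF \<theta> reg]
    proof eventually_elim
      case (elim n)
      then have n: "P < n" by simp
      interpret X: design "X n" n P by (rule regressors_design[OF reg n])
      let ?G = "\<lambda>\<eta>. post_cdf (X n) A ord c \<eta> \<sigma> t"
      obtain \<eta> where fam: "local_family (X n) n P qs \<theta> (\<rho> / sqrt (real n)) D (\<bar>s\<bar> + \<bar>s'\<bar>) \<eta>"
          and sep: "4 * \<delta> < \<bar>?G (\<eta> s) - ?G (\<eta> s')\<bar>"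
        using elim by blast
      note \<eta> = fam[unfolded local_family_def, THEN conjunct1, rule_format]
      note dist = fam[unfolded local_family_def, THEN conjunct2, rule_format]
      have "real m * (2 * \<delta>') < \<bar>?G (\<eta> s) - ?G (\<eta> s')\<bar>"
        using sep pos m by (simp add: \<delta>'_def)
      from exists_large_step[OF m(2), of "2 * \<delta>'" "\<lambda>x. ?G (\<eta> x)", OF this]
      obtain i where i: "i < m" "2 * \<delta>' < \<bar>?G (\<eta> (?p (Suc i))) - ?G (\<eta> (?p i))\<bar>" by blast
      define x y where "x = ?p (Suc i)" and "y = ?p i"
      have sb: "\<bar>x\<bar> \<le> \<bar>s\<bar> + \<bar>s'\<bar>" "\<bar>y\<bar> \<le> \<bar>s\<bar> + \<bar>s'\<bar>"
        unfolding x_def y_def by (rule segment_bound; use i m in simp)+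
      have xy: "x - y = (s' - s) / real m" by (simp add: x_def y_def distrib_right add_divide_distrib)
      have c: "\<eta> x \<in> carrier_vec P" "\<eta> y \<in> carrier_vec P"
        using \<eta>[OF sb(1)] \<eta>[OF sb(2)] by (auto simp: submodel_def)
      show ?case
      proof (rule INF_greatest)
        fix g assume g: "g \<in> estimators n"
        let ?a = "miss_prob (X n) A ord c (\<eta> x) \<sigma> t g \<delta>'" and ?b = "miss_prob (X n) A ord c (\<eta> y) \<sigma> t g \<delta>'"
        let ?E = "miss_event n g (?G (\<eta> y)) \<delta>'"
        \<comment> \<open>The choice \<open>l = 1 / \<epsilon>\<close> balances the bound: each of
          the two terms is at most \<open>\<epsilon>\<close>.\<close>
        have "2 * (measure (sample_law (X n) (\<eta> x) \<sigma>) ?E - ?b) \<le>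
            (1 / \<epsilon>) * (exp (((s' - s) / real m)\<^sup>2 / \<sigma>\<^sup>2) - 1) + ?b * \<epsilon>"
          using X.sample_law_compare[where \<alpha>=1 and l="1 / \<epsilon>", OF \<sigma> _ miss_event_sets[OF g] c(2,1)] \<epsilon>
          by (simp add: dist xy X.miss_prob_eq)
        also have "\<dots> \<le> (1 / \<epsilon>) * \<epsilon>\<^sup>2 + 1 * \<epsilon>"
          using m(1) \<epsilon> prob_space.prob_le_1[OF X.prob_space_sample_law[OF \<sigma>]]
          by (intro add_mono mult_left_mono mult_right_mono) (auto simp: X.miss_prob_eq)
        also have "\<dots> = 2 * \<epsilon>" using \<epsilon> by (simp add: power2_eq_square)
        finally have "measure (sample_law (X n) (\<eta> x) \<sigma>) ?E \<le> ?b + \<epsilon>" by simp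
        moreover have "1 \<le> ?a + measure (sample_law (X n) (\<eta> x) \<sigma>) ?E"
          unfolding X.miss_prob_eq using i(2) unfolding x_def y_def by (intro X.miss_event_cover[OF \<sigma> g])
        ultimately have "r \<le> max ?a ?b" unfolding \<epsilon>_def by linarith
        then have "ereal r \<le> max (ereal ?a) (ereal ?b)" by (simp add: max_def split: if_splits)
        also have "\<dots> \<le> ?worst X \<theta> g \<delta>' n"
          using \<eta>[OF sb(1)] \<eta>[OF sb(2)] by (intro max.boundedI X.miss_prob_le_worst) auto
        finally show "ereal r \<le> ?worst X \<theta> g \<delta>' n" .
      qed
    qed
    then have "ereal r \<le> liminf (\<lambda>n. INF g \<in> estimators n. ?worst X \<theta> g \<delta>' n)"
      if "\<theta> \<in> submodel P (qs - 1)" "regressors P Q X" for X \<theta>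
      using that by (intro Liminf_bounded)
    then show ?thesis using \<delta>' by blast
  qed
  \<comment> \<open>The level \<open>1 / 4\<close> stands for any number strictly between 0 and
    \<open>1 / 2\<close>.\<close>
  obtain \<delta>\<^sub>0 where \<delta>0: "0 < \<delta>\<^sub>0" "\<delta>\<^sub>0 \<le> \<delta>" and lower: "\<And>X \<theta>. \<theta> \<in> submodel P (qs - 1) \<Longrightarrow> regressors P Q X \<Longrightarrow>
      ereal (1 / 4) \<le> liminf (\<lambda>n. INF g \<in> estimators n. ?worst X \<theta> g \<delta>\<^sub>0 n)"
    using half[of "1 / 4"] by auto
  have pos_lower: "0 < liminf (\<lambda>n. INF g \<in> estimators n. ?worst X \<theta> g \<delta>\<^sub>0 n)"
    if "\<theta> \<in> submodel P (qs - 1)" "regressors P Q X" for X \<theta>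
    by (rule less_le_trans[OF _ lower[OF that]]) simp
  have sup: "1 / 2 \<le> (SUP \<delta> \<in> {0<..}. liminf (\<lambda>n. INF g \<in> estimators n. ?worst X \<theta> g \<delta> n))"
    if \<theta>: "\<theta> \<in> submodel P (qs - 1)" and reg: "regressors P Q X" for X \<theta>
  \<comment> \<open>Each \<open>r\<close> below \<open>1 / 2\<close> is reached with its own
    \<open>\<delta>'\<close>, and the supremum over \<open>\<delta>\<close> collects them.\<close>
  proof (rule dense_le)
    fix a :: ereal assume "a < 1 / 2"
    then have "a < ereal (1 / 2)" by (simp add: numeral_eq_ereal one_ereal_def divide_ereal_def)
    then obtain r where r: "a < ereal r" "ereal r < ereal (1 / 2)" using ereal_dense2 by blast
    obtain \<delta>' where \<delta>': "0 < \<delta>'" "ereal r \<le> liminf (\<lambda>n. INF g \<in> estimators n. ?worst X \<theta> g \<delta>' n)"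
      using half[of r] r(2) \<theta> reg by auto
    note less_imp_le[OF r(1)]
    also note \<delta>'(2)
    also have "liminf (\<lambda>n. INF g \<in> estimators n. ?worst X \<theta> g \<delta>' n) \<le>
        (SUP \<delta> \<in> {0<..}. liminf (\<lambda>n. INF g \<in> estimators n. ?worst X \<theta> g \<delta> n))"
      using \<delta>'(1) by (intro SUP_upper) simp
    finally show "a \<le> (SUP \<delta> \<in> {0<..}. liminf (\<lambda>n. INF g \<in> estimators n. ?worst X \<theta> g \<delta> n))" .
  qed
  show ?thesis
    by (intro exI[of _ \<delta>\<^sub>0] exI[of _ \<rho>] conjI \<delta>0(1) pos(2) allI ballI impI)
      (use consistent[OF \<delta>0] pos_lower sup in \<open>auto\<close>)
qed

end
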